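(* Let $B=(B^1,\dots,B^d)$ be a standard $d$-dimensional Brownian motion on $[0,T]$, let $A^\circ=\{1,\dots,d,\circ\}$, and let $I,S\colon[0,T]^2\to(T(A^\circ))^*$ be the processes of iterated It\^o and Stratonovich integrals of $(B^1,\dots,B^d,t)$. Then almost surely $\exp^*I=S$ and $\log^*S=I$; that is, for any word $w\in W(A^\circ)$ and $s,t\in[0,T]$, $$\langle S_{st},w\rangle=\langle I_{st},w\rangle+\sum_{u\in[[w]]}\frac{1}{2^{|w|-|u|}}\langle I_{st},u\rangle,\qquad \langle I_{st},w\rangle=\langle S_{st},w\rangle+\sum_{u\in[[w]]}\frac{(-1)^{|w|-|u|}}{2^{|w|-|u|}}\langle S_{st},u\rangle,$$ where $[[w]]$ is the set of words that can be constructed from $w$ by successively replacing (at least once) with $\circ$ any neighbouring pair of letters of the form $ii$, $i\in\{1,\dots,d\}$.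
   Context: $W(A^\circ)$ is the set of words in letters of $A^\circ$ including the empty word $\mathbf 1$, $T(A^\circ)$ the free real vector space on $W(A^\circ)$, and $|w|$ the length of $w$. The bracket on $\mathbb R^{A^\circ}$ is the bilinear map with $[a,b]_\diamond=\circ$ if $a=b\in\{1,\dots,d\}$ and $[a,b]_\diamond=0$ for all other pairs of letters; $[a_1\cdots a_n]$ denotes the iterated bracket of letters ($[a]=a$). For a word $w=a_1\cdots a_n$ and a composition $J=(j_1,\dots,j_m)$ of $n$ (positive integers with sum $n$), $[w]_J\in T(A^\circ)$ is the (multilinearly extended) word with successive letters $[a_1\cdots a_{j_1}],[a_{j_1+1}\cdots a_{j_1+j_2}],\dots,[a_{j_1+\cdots+j_{m-1}+1}\cdots a_n]$. The linear maps $\exp,\log$ on $T(A^\circ)$ are $$\exp(w)=\sum_{J}\frac{1}{j_1!\cdots j_m!}[w]_J,\qquad\log(w)=\sum_J\frac{(-1)^{n-m}}{j_1\cdots j_m}[w]_J,$$ summing over compositions of $n=|w|$, with $\exp(\mathbf 1)=\log(\mathbf 1)=\mathbf 1$; $\exp^*,\log^*$ are the dual maps, e.g. $\langle\exp^*I_{st},w\rangle=\langle I_{st},\exp(w)\rangle$. For $s\le t$, $\langle I_{st},\mathbf 1\rangle=\langle S_{st},\mathbf 1\rangle=1$ and recursively $$\langle I_{st},w\circ\rangle=\int_s^t\langle I_{sr},w\rangle dr,\quad\langle S_{st},w\circ\rangle=\int_s^t\langle S_{sr},w\rangle dr,\quad\langle I_{st},wi\rangle=\int_s^t\langle I_{sr},w\rangle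 dB^i_r,\quad\langle S_{st},wi\rangle=\int_s^t\langle S_{sr},w\rangle d^\circ B^i_r,$$ with $dB$ the It\^o and $d^\circ B$ the Stratonovich integral, in versions continuous in $(s,t)$. For $s>t$, $I_{st}$ and $S_{st}$ are the inverses of $I_{ts}$ and $S_{ts}$ for the convolution product $\langle\alpha*\beta,h\rangle=\langle\alpha\otimes\beta,\nabla h\rangle$, where $\nabla$ is deconcatenation, $\nabla(a_1\cdots a_m)=\sum_{i=0}^m a_1\cdots a_i\otimes a_{i+1}\cdots a_m$. *)

theory Defs
  imports "HOL-Probability.Probability" "HOL-Library.Poly_Mapping"
begin

section \<open>Words, contractions, exponential and logarithm\<close>

text \<open>
  The alphabet consists of the elements of a finite index type, playing the role of
  \<open>{1,\<dots>,d}\<close>, and the time letter.  The free vector space on a set is the type of finitely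
  supported real functions.  An element of the dual of the free vector space on words is
  identified with its family of values on words; \<open>pairing\<close> is its linear extension.
\<close>

datatype 'd letter = Idx 'd | Circ

type_synonym 'd word = "'d letter list"

type_synonym 'd tensors = "'d word \<Rightarrow>\<^sub>0 real"

type_synonym 'd dual = "'d word \<Rightarrow> real"

definition pairing :: "('a \<Rightarrow> real) \<Rightarrow> ('a \<Rightarrow>\<^sub>0 real) \<Rightarrow> real" where
  "pairing \<alpha> h = (\<Sum>x\<in>Poly_Mapping.keys h. Poly_Mapping.lookup h x * \<alpha> x)"

definition scale :: "real \<Rightarrow> ('a \<Rightarrow>\<^sub>0 real) \<Rightarrow> ('a \<Rightarrow>\<^sub>0 real)" where
  "scale c h = Poly_Mapping.map (\<lambda>x. c * x) h"

definition lin_ext :: "('a \<Rightarrow> ('b \<Rightarrow>\<^sub>0 real)) \<Rightarrow> ('a \<Rightarrow>\<^sub>0 real) \<Rightarrow> ('b \<Rightarrow>\<^sub>0 real)" where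
  "lin_ext f h = (\<Sum>x\<in>Poly_Mapping.keys h. scale (Poly_Mapping.lookup h x) (f x))"

definition basis :: "'a \<Rightarrow> ('a \<Rightarrow>\<^sub>0 real)" where
  "basis x = Poly_Mapping.single x 1"

fun letter_bracket :: "'d letter \<Rightarrow> 'd letter \<Rightarrow> ('d letter \<Rightarrow>\<^sub>0 real)" where
  "letter_bracket (Idx i) (Idx j) = (if i = j then basis Circ else 0)"
| "letter_bracket _ _ = 0"

definition bracket ::
  "('d letter \<Rightarrow>\<^sub>0 real) \<Rightarrow> ('d letter \<Rightarrow>\<^sub>0 real) \<Rightarrow> ('d letter \<Rightarrow>\<^sub>0 real)" where
  "bracket x y = lin_ext (\<lambda>a. lin_ext (\<lambda>b. letter_bracket a b) y) x"

text \<open>The value on the empty word is never used.\<close>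

fun iterated_bracket :: "'d word \<Rightarrow> ('d letter \<Rightarrow>\<^sub>0 real)" where
  "iterated_bracket [] = 0"
| "iterated_bracket (a # w) = foldl (\<lambda>x b. bracket x (basis b)) (basis a) w"

fun multilinear_word :: "('d letter \<Rightarrow>\<^sub>0 real) list \<Rightarrow> 'd tensors" where
  "multilinear_word [] = basis []"
| "multilinear_word (x # xs) =
     lin_ext (\<lambda>a. lin_ext (\<lambda>u. basis (a # u)) (multilinear_word xs)) x"

definition compositions :: "nat \<Rightarrow> nat list set" where
  "compositions n = {J. (\<forall>j\<in>set J. 0 < j) \<and> sum_list J = n}"

fun blocks :: "'a list \<Rightarrow> nat list \<Rightarrow> 'a list list" where
  "blocks w [] = []"
| "blocks w (j # J) = take j w # blocks (drop j w) J"

definition block_word :: "'d word \<Rightarrow> nat list \<Rightarrow> 'd tensors" where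
  "block_word w J = multilinear_word (map iterated_bracket (blocks w J))"

definition word_exp :: "'d tensors \<Rightarrow> 'd tensors" where
  "word_exp = lin_ext (\<lambda>w. \<Sum>J\<in>compositions (length w).
     scale (1 / prod_list (map fact J)) (block_word w J))"

definition word_log :: "'d tensors \<Rightarrow> 'd tensors" where
  "word_log = lin_ext (\<lambda>w. \<Sum>J\<in>compositions (length w).
     scale ((- 1) ^ (length w - length J) / prod_list (map real J)) (block_word w J))"

definition dual_map :: "('d tensors \<Rightarrow> 'd tensors) \<Rightarrow> 'd dual \<Rightarrow> 'd dual" where
  "dual_map f \<alpha> = (\<lambda>w. pairing \<alpha> (f (basis w)))"

inductive contract_pair :: "'d word \<Rightarrow> 'd word \<Rightarrow> bool" where
  "contract_pair (x @ [Idx i, Idx i] @ y) (x @ [Circ] @ y)"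

definition contractions :: "'d word \<Rightarrow> 'd word set" where
  "contractions w = {u. contract_pair\<^sup>+\<^sup>+ w u}"

definition deconcatenation :: "'d word \<Rightarrow> ('d word \<times> 'd word \<Rightarrow>\<^sub>0 real)" where
  "deconcatenation w = (\<Sum>k\<le>length w. basis (take k w, drop k w))"

definition convolution :: "'d dual \<Rightarrow> 'd dual \<Rightarrow> 'd dual" where
  "convolution \<alpha> \<beta> = (\<lambda>w. pairing (\<lambda>(u, v). \<alpha> u * \<beta> v) (deconcatenation w))"

definition counit :: "'d dual" where
  "counit w = (if w = [] then 1 else 0)"

definition convolution_inverse :: "'d dual \<Rightarrow> 'd dual \<Rightarrow> bool" where
  "convolution_inverse \<alpha> \<beta> \<longleftrightarrow>
     convolution \<alpha> \<beta> = counit \<and> convolution \<beta> \<alpha> = counit"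

section \<open>Brownian motion and stochastic integrals\<close>

definition past :: "'w measure \<Rightarrow> (real \<Rightarrow> 'w \<Rightarrow> real ^ 'd) \<Rightarrow> real \<Rightarrow> 'w measure" where
  "past M B s =
     sigma (space M) {B u -` A \<inter> space M | u A. 0 \<le> u \<and> u \<le> s \<and> A \<in> sets borel}"

definition brownian_motion ::
  "'w measure \<Rightarrow> real \<Rightarrow> (real \<Rightarrow> 'w \<Rightarrow> real ^ 'd::finite) \<Rightarrow> bool" where
  "brownian_motion M T B \<longleftrightarrow>
     prob_space M \<and>
     (\<forall>t\<in>{0..T}. B t \<in> borel_measurable M) \<and>
     (AE \<omega> in M. B 0 \<omega> = 0) \<and>
     (\<forall>s t. 0 \<le> s \<and> s < t \<and> t \<le> T \<longrightarrow>
        distributed M lborel (\<lambda>\<omega>. B t \<omega> - B s \<omega>)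
          (\<lambda>x. ennreal (\<Prod>i\<in>UNIV. normal_density 0 (sqrt (t - s)) (x $ i))) \<and>
        prob_space.indep_set M
          {(\<lambda>\<omega>. B t \<omega> - B s \<omega>) -` A \<inter> space M | A. A \<in> sets borel}
          (sets (past M B s))) \<and>
     (AE \<omega> in M. continuous_on {0..T} (\<lambda>t. B t \<omega>))"

definition is_partition :: "real \<Rightarrow> real \<Rightarrow> nat \<Rightarrow> (nat \<Rightarrow> real) \<Rightarrow> bool" where
  "is_partition s t n r \<longleftrightarrow> r 0 = s \<and> r n = t \<and> (\<forall>k<n. r k \<le> r (Suc k))"

text \<open>
  A simple integrand on \<open>[s,t]\<close> is \<open>\<Sum>\<^bsub>k<n\<^esub> \<xi>\<^sub>k 1\<^bsub>(r\<^sub>k, r\<^sub>k\<^sub>+\<^sub>1]\<^esub>\<close> with each \<open>\<xi>\<^sub>k\<close> bounded and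
  measurable with respect to the Brownian past at time \<open>r\<^sub>k\<close>.
\<close>

definition simple_integrand ::
  "'w measure \<Rightarrow> (real \<Rightarrow> 'w \<Rightarrow> real ^ 'd) \<Rightarrow> real \<Rightarrow> real \<Rightarrow>
     nat \<Rightarrow> (nat \<Rightarrow> real) \<Rightarrow> (nat \<Rightarrow> 'w \<Rightarrow> real) \<Rightarrow> bool" where
  "simple_integrand M B s t n r \<xi> \<longleftrightarrow>
     is_partition s t n r \<and>
     (\<forall>k<n. \<xi> k \<in> borel_measurable (past M B (r k)) \<and>
            (\<exists>C. \<forall>\<omega>\<in>space M. \<bar>\<xi> k \<omega>\<bar> \<le> C))"

definition simple_value ::
  "nat \<Rightarrow> (nat \<Rightarrow> real) \<Rightarrow> (nat \<Rightarrow> 'w \<Rightarrow> real) \<Rightarrow> real \<Rightarrow> 'w \<Rightarrow> real" where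
  "simple_value n r \<xi> u \<omega> = (\<Sum>k<n. \<xi> k \<omega> * indicator {r k<..r (Suc k)} u)"

definition simple_integral ::
  "(real \<Rightarrow> 'w \<Rightarrow> real) \<Rightarrow> nat \<Rightarrow> (nat \<Rightarrow> real) \<Rightarrow> (nat \<Rightarrow> 'w \<Rightarrow> real) \<Rightarrow> 'w \<Rightarrow> real" where
  "simple_integral b n r \<xi> \<omega> = (\<Sum>k<n. \<xi> k \<omega> * (b (r (Suc k)) \<omega> - b (r k) \<omega>))"

text \<open>
  \<open>X\<close> is (a version of) the Ito integral of \<open>H\<close> over \<open>[s,t]\<close> against the \<open>i\<close>-th component
  of \<open>B\<close>: the extension by the Ito isometry from simple integrands to the
  \<open>L\<^sup>2(du \<otimes> P)\<close>-closure of the simple integrands.  All the iterated integrals are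
  square integrable, so no localisation is needed.
\<close>

definition has_ito_integral ::
  "'w measure \<Rightarrow> (real \<Rightarrow> 'w \<Rightarrow> real ^ 'd) \<Rightarrow> 'd \<Rightarrow> real \<Rightarrow> real \<Rightarrow>
     (real \<Rightarrow> 'w \<Rightarrow> real) \<Rightarrow> ('w \<Rightarrow> real) \<Rightarrow> bool" where
  "has_ito_integral M B i s t H X \<longleftrightarrow>
     (\<lambda>(u, \<omega>). H u \<omega>) \<in> borel_measurable (restrict_space borel {s..t} \<Otimes>\<^sub>M M) \<and>
     X \<in> borel_measurable M \<and>
     (\<exists>n r \<xi>. (\<forall>m. simple_integrand M B s t (n m) (r m) (\<xi> m)) \<and>
        ((\<lambda>m. \<integral>\<^sup>+ \<omega>. (\<integral>\<^sup>+ u\<in>{s..t}.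
            ennreal ((H u \<omega> - simple_value (n m) (r m) (\<xi> m) u \<omega>)\<^sup>2) \<partial>lborel) \<partial>M)
          \<longlonglongrightarrow> 0) \<and>
        ((\<lambda>m. \<integral>\<^sup>+ \<omega>. ennreal
            ((X \<omega> - simple_integral (\<lambda>u \<omega>. B u \<omega> $ i) (n m) (r m) (\<xi> m) \<omega>)\<^sup>2) \<partial>M)
          \<longlonglongrightarrow> 0))"

text \<open>
  \<open>Q\<close> is the quadratic covariation of \<open>H\<close> and \<open>K\<close> on \<open>[s,t]\<close>: the limit in probability, as the
  mesh of the partition tends to zero, of the sums of products of increments.
\<close>

definition has_covariation ::
  "'w measure \<Rightarrow> real \<Rightarrow> real \<Rightarrow> (real \<Rightarrow> 'w \<Rightarrow> real) \<Rightarrow> (real \<Rightarrow> 'w \<Rightarrow> real) \<Rightarrow>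
     ('w \<Rightarrow> real) \<Rightarrow> bool" where
  "has_covariation M s t H K Q \<longleftrightarrow>
     (\<forall>u\<in>{s..t}. H u \<in> borel_measurable M \<and> K u \<in> borel_measurable M) \<and>
     Q \<in> borel_measurable M \<and>
     (\<forall>\<epsilon>>0. \<forall>\<eta>>0. \<exists>\<delta>>0. \<forall>n r.
        is_partition s t n r \<and> (\<forall>k<n. r (Suc k) - r k < \<delta>) \<longrightarrow>
        measure M {\<omega> \<in> space M.
          \<bar>(\<Sum>k<n. (H (r (Suc k)) \<omega> - H (r k) \<omega>) * (K (r (Suc k)) \<omega> - K (r k) \<omega>)) - Q \<omega>\<bar> > \<epsilon>}
        < \<eta>)"

text \<open>The Stratonovich integral is the Ito integral plus half the covariation.\<close>

definition has_stratonovich_integral ::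
  "'w measure \<Rightarrow> (real \<Rightarrow> 'w \<Rightarrow> real ^ 'd) \<Rightarrow> 'd \<Rightarrow> real \<Rightarrow> real \<Rightarrow>
     (real \<Rightarrow> 'w \<Rightarrow> real) \<Rightarrow> ('w \<Rightarrow> real) \<Rightarrow> bool" where
  "has_stratonovich_integral M B i s t H X \<longleftrightarrow>
     X \<in> borel_measurable M \<and>
     (\<exists>Y Q. has_ito_integral M B i s t H Y \<and>
        has_covariation M s t H (\<lambda>u \<omega>. B u \<omega> $ i) Q \<and>
        (AE \<omega> in M. X \<omega> = Y \<omega> + Q \<omega> / 2))"

text \<open>
  The process of iterated integrals with respect to a notion of stochastic integral \<open>stoch\<close>.
  The recursion determines each value almost surely; the continuity condition selects the
  version, which makes the process unique up to indistinguishability.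
\<close>

definition iterated_integrals ::
  "'w measure \<Rightarrow> real \<Rightarrow>
     ('d \<Rightarrow> real \<Rightarrow> real \<Rightarrow> (real \<Rightarrow> 'w \<Rightarrow> real) \<Rightarrow> ('w \<Rightarrow> real) \<Rightarrow> bool) \<Rightarrow>
     (real \<Rightarrow> real \<Rightarrow> 'w \<Rightarrow> 'd dual) \<Rightarrow> bool" where
  "iterated_integrals M T stoch X \<longleftrightarrow>
     (\<forall>s\<in>{0..T}. \<forall>t\<in>{0..T}. \<forall>w. (\<lambda>\<omega>. X s t \<omega> w) \<in> borel_measurable M) \<and>
     (\<forall>s t. 0 \<le> s \<and> s \<le> t \<and> t \<le> T \<longrightarrow>
        (AE \<omega> in M. X s t \<omega> [] = 1) \<and>
        (\<forall>w. AE \<omega> in M. X s t \<omega> (w @ [Circ]) = integral {s..t} (\<lambda>r. X s r \<omega> w)) \<and>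
        (\<forall>w i. stoch i s t (\<lambda>r \<omega>. X s r \<omega> w) (\<lambda>\<omega>. X s t \<omega> (w @ [Idx i])))) \<and>
     (\<forall>w. AE \<omega> in M.
        continuous_on {(s, t). 0 \<le> s \<and> s \<le> t \<and> t \<le> T} (\<lambda>(s, t). X s t \<omega> w)) \<and>
     (AE \<omega> in M. \<forall>s t. 0 \<le> t \<and> t < s \<and> s \<le> T \<longrightarrow>
        convolution_inverse (X s t \<omega>) (X t s \<omega>))"

end

theory Submission
  imports Defs
begin

text \<open>
  Appending a letter to a word turns the combinatorial exponential into the recursion
  \<open>exp\<^sup>*I(wii) = \<integral>exp\<^sup>*I(wi) dB\<^sup>i + (1/2) \<integral>exp\<^sup>*I(w) dt\<close>, with no correction when \<open>wi\<close> is followed by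
  another letter.  This is the Ito form of the Stratonovich recursion, because the covariation of an
  Ito integral \<open>\<integral>H dB\<^sup>j\<close> with \<open>B\<^sup>i\<close> is \<open>\<delta>\<^sub>i\<^sub>j \<integral>H dt\<close> and that of a time integral vanishes.  Induction on the
  word gives \<open>S = exp\<^sup>*I\<close> almost surely for fixed \<open>s \<le> t\<close>, continuity makes the exceptional set independent of \<open>s\<close>
  and \<open>t\<close>, and \<open>s > t\<close> follows since \<open>exp\<^sup>*\<close> is multiplicative for the convolution product.  The logarithm is
  the same sum over contractions with \<open>1/2\<close> replaced by \<open>-1/2\<close>, which inverts it.

  The covariation is computed along uniform partitions: for a step integrand the error is a sum
  of orthogonal terms with small fourth-moment bounds, and the isometry controls the approximation of \<open>H\<close> by
  step integrands uniformly in the partition.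
\<close>

section \<open>Contractions of words\<close>

text \<open>The Stratonovich hypothesis supplies some covariation \<open>Q\<close>, a limit over all
  partitions of small mesh. It only has to be identified, and since limits in probability are
  unique, one sequence of partitions does this. The obstacle is that the integrand \<open>H\<close>
  is close to step integrands only in the square norm over time and probability, while the sums of
  increment products involve more and more intervals. One step integrand is therefore fixed before
  the partition is refined, and its error is charged through a weighted Young inequality, the
  squared errors on the pieces of any partition adding up to at most the total. The induction
  hypothesis is used inside an integral over an inner time, so it must hold for all pairs of times
  outside one null set. On the algebraic side, integrals append letters on the right while blocks
  and contractions are peeled off on the left, which explains the inductions generalised over
  \<alpha>. Both series reduce to contractions because brackets of three or more letters vanish, so
  only the coefficients of blocks of length one and two survive.\<close>

fun contracted :: "'d word \<Rightarrow> 'd word set" where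
  "contracted [] = {[]}"
| "contracted [a] = {[a]}"
| "contracted (a # b # w) = Cons a ` contracted (b # w) \<union>
     (if a = b \<and> a \<noteq> Circ then Cons Circ ` contracted w else {})"

lemma finite_contracted [simp]: "finite (contracted w)"
  by (induction w rule: contracted.induct) auto

lemma length_contracted: "u \<in> contracted w \<Longrightarrow> length u \<le> length w"
  by (induction w arbitrary: u rule: contracted.induct) (fastforce split: if_splits)+

lemma self_in_contracted [simp]: "w \<in> contracted w"
  by (induction w rule: contracted.induct) auto

text \<open>Contraction creates only \<open>Circ\<close>, so an index letter heading a contracted
  word is an original letter of \<open>w\<close> that was kept.\<close>

lemma Idx_Cons_in_contracted: "Idx i # y \<in> contracted w \<Longrightarrow> \<exists>w'. w = Idx i # w' \<and> y \<in> contracted w'"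
  by (cases w rule: contracted.cases) (auto split: if_splits)

lemma contract_pair_Cons: "contract_pair w u \<Longrightarrow> contract_pair (a # w) (a # u)"
  by (metis append_Cons contract_pair.simps)

lemma contract_pair_head: "contract_pair (Idx i # Idx i # w) (Circ # w)"
  using contract_pair.intros[of "[]" i w] by simp

lemma contract_pair_length: "contract_pair w u \<Longrightarrow> length w = Suc (length u)"
  by (auto elim!: contract_pair.cases)

lemma contract_pair_ConsE:
  assumes "contract_pair (a # w) v"
  obtains v' where "v = a # v'" "contract_pair w v'"
  | i y where "a = Idx i" "w = Idx i # y" "v = Circ # y"
proof -
  from assms obtain x i y where *: "a # w = x @ [Idx i, Idx i] @ y" "v = x @ [Circ] @ y"
    by (auto elim!: contract_pair.cases)
  show thesis
  proof (cases x)
    case Nil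
    then show thesis using * that(2) by auto
  next
    case (Cons b x')
    then have "a = b" "contract_pair w (x' @ [Circ] @ y)"
      using * contract_pair.intros[of x' i y] by auto
    then show thesis using * Cons that(1) by auto
  qed
qed

text \<open>The two index letters consumed by a further contraction are untouched letters of
  \<open>w\<close> and adjacent there as well, so the scan could have contracted them
  itself.\<close>

lemma contract_pair_in_contracted: "contract_pair u v \<Longrightarrow> u \<in> contracted w \<Longrightarrow> v \<in> contracted w"
proof (induction w arbitrary: u v rule: contracted.induct)
  case 1
  then show ?case using contract_pair_length by fastforce
next
  case (2 a)
  then show ?case by (auto elim!: contract_pair_ConsE dest: contract_pair_length)
next
  case (3 a b w)
  from 3(4) consider u' where "u = a # u'" "u' \<in> contracted (b # w)"
    | u' where "a = b" "a \<noteq> Circ" "u = Circ # u'" "u' \<in> contracted w"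
    by (auto split: if_splits)
  then show ?case
  proof cases
    case 1
    from 3(3)[unfolded 1(1)] show ?thesis
    proof (cases rule: contract_pair_ConsE)
      case (1 v')
      then show ?thesis using 3(1) \<open>u' \<in> contracted (b # w)\<close> by auto
    next
      case (2 i y)
      then show ?thesis using Idx_Cons_in_contracted[of i y "b # w"] \<open>u' \<in> contracted (b # w)\<close> by auto
    qed
  next
    case 2
    from 3(3)[unfolded 2(3)] obtain v' where "v = Circ # v'" "contract_pair u' v'"
      by (auto elim: contract_pair_ConsE)
    then show ?thesis using 3(2)[of u' v'] 2 by auto
  qed
qed

text \<open>A contracted pair becomes \<open>Circ\<close>, which takes part in no further
  contraction. Successive replacements therefore amount to choosing disjoint pairs \<open>ii\<close>
  at once, and a single scan from left to right makes that choice.\<close>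

lemma contracted_eq: "contracted w = {u. contract_pair\<^sup>*\<^sup>* w u}"
proof (intro set_eqI iffI)
  fix u
  have lift: "contract_pair\<^sup>*\<^sup>* (a # w) (a # u)" if "contract_pair\<^sup>*\<^sup>* w u" for a :: "'a letter" and w u
    using that by induction (auto intro: rtranclp.rtrancl_into_rtrancl contract_pair_Cons)
  show "u \<in> {u. contract_pair\<^sup>*\<^sup>* w u}" if "u \<in> contracted w"
    using that
  proof (induction w arbitrary: u rule: contracted.induct)
    case (3 a b w)
    from 3(3) consider u' where "u = a # u'" "u' \<in> contracted (b # w)"
      | u' where "a = b" "a \<noteq> Circ" "u = Circ # u'" "u' \<in> contracted w"
      by (auto split: if_splits)
    then show ?case
    proof cases
      case 1
      then show ?thesis using 3(1) lift by auto
    next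
      case 2
      then obtain i where "a = Idx i" by (cases a) auto
      then have "contract_pair (a # b # w) (Circ # w)" using 2 contract_pair_head by auto
      moreover have "contract_pair\<^sup>*\<^sup>* (Circ # w) u" using 2 3(2)[of u'] lift by auto
      ultimately show ?thesis by (simp add: converse_rtranclp_into_rtranclp)
    qed
  qed auto
  show "u \<in> contracted w" if "u \<in> {u. contract_pair\<^sup>*\<^sup>* w u}"
  proof -
    from that have "contract_pair\<^sup>*\<^sup>* w u" by simp
    then show ?thesis by induction (auto intro: contract_pair_in_contracted)
  qed
qed

text \<open>Each replacement shortens the word by one letter, so a nonempty sequence of them never
  returns to \<open>w\<close>.\<close>

lemma contractions_eq: "contractions w = contracted w - {w}"
proof -
  have "length u < length w" if "contract_pair\<^sup>+\<^sup>+ w u" for u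
    using that by induction (auto dest!: contract_pair_length)
  then show ?thesis
    unfolding contractions_def contracted_eq by (auto simp: rtranclp_into_tranclp1 dest: rtranclpD tranclp_into_rtranclp)
qed

text \<open>The exponent is the number of contracted pairs. The value \<open>c = 1 / 2\<close> gives
  the dual of \<open>word_exp\<close> and \<open>c = - 1 / 2\<close> that of
  \<open>word_log\<close>; a free \<open>c\<close> lets one set of lemmas serve both.\<close>

definition contraction_sum :: "real \<Rightarrow> 'd dual \<Rightarrow> 'd dual" where
  "contraction_sum c \<alpha> w = (\<Sum>u\<in>contracted w. c ^ (length w - length u) * \<alpha> u)"

lemma contraction_sum_contractions:
  "contraction_sum c \<alpha> w = \<alpha> w + (\<Sum>u\<in>contractions w. c ^ (length w - length u) * \<alpha> u)"
  unfolding contraction_sum_def contractions_eq by (subst sum.remove[of _ w]) auto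

lemma contraction_sum_Nil [simp]: "contraction_sum c \<alpha> [] = \<alpha> []"
  and contraction_sum_single [simp]: "contraction_sum c \<alpha> [a] = \<alpha> [a]"
  by (simp_all add: contraction_sum_def)

lemma contraction_sum_Cons_Cons [simp]:
  "contraction_sum c \<alpha> (a # b # w) = contraction_sum c (\<lambda>u. \<alpha> (a # u)) (b # w) +
     (if a = b \<and> a \<noteq> Circ then c * contraction_sum c (\<lambda>u. \<alpha> (Circ # u)) w else 0)"
proof -
  let ?g = "\<lambda>u. c ^ (length (a # b # w) - length u) * \<alpha> u"
  have 1: "sum ?g (Cons a ` contracted (b # w)) = contraction_sum c (\<lambda>u. \<alpha> (a # u)) (b # w)"
    unfolding contraction_sum_def by (subst sum.reindex) auto
  have 2: "sum ?g (Cons Circ ` contracted w) = c * contraction_sum c (\<lambda>u. \<alpha> (Circ # u)) w"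
    unfolding contraction_sum_def by (subst sum.reindex)
      (auto simp: sum_distrib_left Suc_diff_le length_contracted intro!: sum.cong)
  \<comment> \<open>No word is counted twice: the first branch keeps \<open>a\<close>, which differs
    from \<open>Circ\<close>, and the second starts with \<open>Circ\<close>.\<close>
  have "Cons a ` contracted (b # w) \<inter> Cons Circ ` contracted w = {}" if "a \<noteq> Circ" using that by auto
  then have "sum ?g (contracted (a # b # w)) = sum ?g (Cons a ` contracted (b # w)) +
      (if a = b \<and> a \<noteq> Circ then sum ?g (Cons Circ ` contracted w) else 0)"
    by (cases "a = b \<and> a \<noteq> Circ") (auto intro!: sum.union_disjoint)
  then show ?thesis
    unfolding 1 2 by (simp only: contraction_sum_def[of c \<alpha> "a # b # w"])
qed

lemma contraction_sum_add: "contraction_sum c (\<lambda>u. \<alpha> u + \<beta> u) w = contraction_sum c \<alpha> w + contraction_sum c \<beta> w"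
  by (simp add: contraction_sum_def sum.distrib algebra_simps)

lemma contraction_sum_cmult: "contraction_sum c (\<lambda>u. k * \<alpha> u) w = k * contraction_sum c \<alpha> w"
  by (simp add: contraction_sum_def sum_distrib_left algebra_simps)

lemma contraction_sum_zero [simp]: "contraction_sum c (\<lambda>u. 0) w = 0"
  by (simp add: contraction_sum_def)

text \<open>The integral recursions act on the last letter, the definition of
  \<open>contracted\<close> on the first. This and the next two lemmas move to the last letter;
  \<alpha> stays general because each peeled letter is absorbed into it.\<close>

lemma contraction_sum_snoc_Circ: "contraction_sum c \<alpha> (w @ [Circ]) = contraction_sum c (\<lambda>u. \<alpha> (u @ [Circ])) w"
  by (induction w arbitrary: \<alpha> rule: contracted.induct) auto

lemma contraction_sum_snoc_other:
  "w = [] \<or> last w \<noteq> Idx i \<Longrightarrow> contraction_sum c \<alpha> (w @ [Idx i]) = contraction_sum c (\<lambda>u. \<alpha> (u @ [Idx i])) w"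
  by (induction w arbitrary: \<alpha> rule: contracted.induct) (auto split: if_splits)

lemma contraction_sum_snoc_same:
  "contraction_sum c \<alpha> (w @ [Idx i, Idx i]) =
     contraction_sum c (\<lambda>u. \<alpha> (u @ [Idx i])) (w @ [Idx i]) + c * contraction_sum c (\<lambda>u. \<alpha> (u @ [Circ])) w"
  by (induction w arbitrary: \<alpha> rule: contracted.induct) (auto split: if_splits simp: algebra_simps)

text \<open>A word obtained by contracting \<open>k\<close> pairs is reached in two stages by
  letting the first stage perform any subset of them; the signed count \<open>(1 - 1)^k\<close>
  vanishes unless \<open>k = 0\<close>. The induction realises this one pair at a time.\<close>

lemma contraction_sum_inverse: "contraction_sum (- c) (contraction_sum c \<alpha>) w = \<alpha> w"
proof (induction w arbitrary: \<alpha> rule: contracted.induct)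
  case (3 a b w)
  \<comment> \<open>\<open>g u\<close> is the part of
    \<open>contraction_sum c \<alpha> (a # u)\<close> in which \<open>a\<close> is contracted with
    the head of \<open>u\<close>. Its contribution on \<open>b # w\<close> is exactly the term that
    the outer weight \<open>- c\<close> cancels.\<close>
  define g where "g = (\<lambda>u. if u \<noteq> [] \<and> hd u = a \<and> a \<noteq> Circ
    then c * contraction_sum c (\<lambda>u. \<alpha> (Circ # u)) (tl u) else 0)"
  have Cons: "contraction_sum c \<alpha> (x # u) = contraction_sum c (\<lambda>u. \<alpha> (x # u)) u + (if u \<noteq> [] \<and> hd u = x \<and> x \<noteq> Circ
    then c * contraction_sum c (\<lambda>u. \<alpha> (Circ # u)) (tl u) else 0)" for x u
    by (cases u) auto
  have shift: "(\<lambda>u. contraction_sum c \<alpha> (a # u)) = (\<lambda>u. contraction_sum c (\<lambda>u. \<alpha> (a # u)) u + g u)"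
    using Cons[of a] by (auto simp: g_def)
  have Circ: "(\<lambda>u. contraction_sum c \<alpha> (Circ # u)) = contraction_sum c (\<lambda>u. \<alpha> (Circ # u))"
    using Cons[of Circ] by auto
  have "contraction_sum (- c) g (b # w) = (if a = b \<and> a \<noteq> Circ then c * \<alpha> (Circ # w) else 0)"
  proof (cases "a = b \<and> a \<noteq> Circ")
    case True
    have "g (Circ # u) = 0" for u
      using True by (auto simp: g_def)
    then have "contraction_sum (- c) g (b # w) = contraction_sum (- c) (\<lambda>u. g (b # u)) w"
      by (cases w) simp_all
    also have "(\<lambda>u. g (b # u)) = (\<lambda>u. c * contraction_sum c (\<lambda>u. \<alpha> (Circ # u)) u)"
      using True by (auto simp: g_def)
    finally show ?thesis using True 3(2) by (auto simp: contraction_sum_cmult)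
  next
    case False
    have *: "g (Circ # u) = 0" "g (b # u) = 0" for u
      using False by (auto simp: g_def)
    have "contraction_sum (- c) g (b # w) = 0"
      by (cases w) (simp_all add: *)
    with False show ?thesis by auto
  qed
  then show ?case
    using 3 by (auto simp: shift contraction_sum_add Circ)
qed auto

section \<open>Linear extensions and the expansion over compositions\<close>

lemma pairing_superset:
  assumes "finite A" "Poly_Mapping.keys h \<subseteq> A"
  shows "pairing \<alpha> h = (\<Sum>x\<in>A. Poly_Mapping.lookup h x * \<alpha> x)"
  unfolding pairing_def using assms by (intro sum.mono_neutral_left) (auto simp: in_keys_iff)

lemma pairing_add: "pairing \<alpha> (f + g) = pairing \<alpha> f + pairing \<alpha> g"
proof -
  let ?A = "Poly_Mapping.keys f \<union> Poly_Mapping.keys g"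
  have "Poly_Mapping.keys (f + g) \<subseteq> ?A" by (rule Poly_Mapping.keys_add)
  then show ?thesis
    by (simp add: pairing_superset[of ?A] lookup_add sum.distrib algebra_simps)
qed

lemma pairing_zero [simp]: "pairing \<alpha> 0 = 0"
  by (simp add: pairing_def)

lemma pairing_sum: "pairing \<alpha> (\<Sum>x\<in>A. f x) = (\<Sum>x\<in>A. pairing \<alpha> (f x))"
  by (induction A rule: infinite_finite_induct) (auto simp: pairing_add)

lemma lookup_scale [simp]: "Poly_Mapping.lookup (scale c h) x = c * Poly_Mapping.lookup h x"
  unfolding scale_def by (simp add: map.rep_eq when_def)

lemma pairing_scale: "pairing \<alpha> (scale c h) = c * pairing \<alpha> h"
proof -
  have "Poly_Mapping.keys (scale c h) \<subseteq> Poly_Mapping.keys h" by (auto simp: in_keys_iff)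
  then show ?thesis
    by (simp add: pairing_superset[of "Poly_Mapping.keys h"] sum_distrib_left mult_ac)
qed

lemma pairing_basis [simp]: "pairing \<alpha> (basis x) = \<alpha> x"
  by (simp add: pairing_def basis_def)

lemma pairing_lin_ext: "pairing \<alpha> (lin_ext f h) = pairing (\<lambda>x. pairing \<alpha> (f x)) h"
  by (simp add: lin_ext_def pairing_sum pairing_scale) (simp add: pairing_def)

lemma lin_ext_basis [simp]: "lin_ext f (basis x) = f x"
  by (rule poly_mapping_eqI) (simp add: lin_ext_def basis_def)

lemma lin_ext_zero [simp]: "lin_ext f 0 = 0"
  by (simp add: lin_ext_def)

lemma bracket_basis [simp]: "bracket (basis a) (basis b) = letter_bracket a b"
  by (simp add: bracket_def)

lemma bracket_zero [simp]: "bracket 0 x = 0"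
  by (simp add: bracket_def)

lemma foldl_bracket_zero: "foldl (\<lambda>x b. bracket x (basis b)) 0 w = 0"
  by (induction w) auto

text \<open>A bracket of two letters is \<open>Circ\<close> or zero, and \<open>Circ\<close>
  brackets to zero with every letter, so three letters already give zero.\<close>

lemma iterated_bracket_long: "iterated_bracket (a # b # c # w) = 0"
  by (cases a; cases b) (auto simp: foldl_bracket_zero)

lemma compositions_0: "compositions 0 = {[]}"
proof -
  have "J = []" if "\<forall>j\<in>set J. 0 < j" "sum_list J = 0" for J :: "nat list"
    using that by (cases J) auto
  then show ?thesis by (auto simp: compositions_def)
qed

lemma compositions_pos:
  assumes "0 < n"
  shows "compositions n = (\<Union>j\<in>{1..n}. Cons j ` compositions (n - j))"
proof (intro set_eqI iffI)
  fix J assume J: "J \<in> compositions n"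
  then obtain j J' where "J = j # J'"
    using assms by (cases J) (auto simp: compositions_def)
  with J have "j \<in> {1..n}" "J' \<in> compositions (n - j)"
    by (auto simp: compositions_def)
  with \<open>J = j # J'\<close> show "J \<in> (\<Union>j\<in>{1..n}. Cons j ` compositions (n - j))"
    by blast
qed (auto simp: compositions_def)

lemma finite_compositions [simp]: "finite (compositions n)"
proof (induction n rule: less_induct)
  case (less n)
  then show ?case
    by (cases "n = 0") (auto simp: compositions_0 compositions_pos)
qed

text \<open>The coefficients of both series are products over blocks:
  \<open>g j = 1 / fact j\<close> for the exponential and \<open>g j = (- 1)^(j - 1) / j\<close> for
  the logarithm.\<close>

definition block_sum :: "(nat \<Rightarrow> real) \<Rightarrow> 'd dual \<Rightarrow> 'd dual" where
  "block_sum g \<alpha> w = (\<Sum>J\<in>compositions (length w). prod_list (map g J) * pairing \<alpha> (block_word w J))"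

text \<open>The sum over compositions is organised by the length \<open>j\<close> of the first
  block. Its bracket is a combination of letters \<open>a\<close>, and multilinearity moves the
  letter into the functional applied to the remaining blocks.\<close>

lemma block_sum_rec:
  assumes "w \<noteq> []"
  shows "block_sum g \<alpha> w = (\<Sum>j\<in>{1..length w}. g j *
    pairing (\<lambda>a. block_sum g (\<lambda>u. \<alpha> (a # u)) (drop j w)) (iterated_bracket (take j w)))"
proof -
  have "block_sum g \<alpha> w = (\<Sum>j\<in>{1..length w}. \<Sum>J\<in>Cons j ` compositions (length w - j).
      prod_list (map g J) * pairing \<alpha> (block_word w J))"
    unfolding block_sum_def using assms
    by (subst compositions_pos) (auto intro!: sum.UNION_disjoint)
  also have "\<dots> = (\<Sum>j\<in>{1..length w}. g j *
    pairing (\<lambda>a. block_sum g (\<lambda>u. \<alpha> (a # u)) (drop j w)) (iterated_bracket (take j w)))"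
  proof (rule sum.cong)
    fix j assume j: "j \<in> {1..length w}"
    let ?x = "iterated_bracket (take j w)" and ?C = "compositions (length w - j)"
    let ?q = "\<lambda>a J. prod_list (map g J) * pairing (\<lambda>u. \<alpha> (a # u)) (block_word (drop j w) J)"
    have *: "pairing \<alpha> (block_word w (j # J)) =
        pairing (\<lambda>a. pairing (\<lambda>u. \<alpha> (a # u)) (block_word (drop j w) J)) ?x" for J
      by (simp add: block_word_def pairing_lin_ext)
    have "(\<Sum>J\<in>Cons j ` ?C. prod_list (map g J) * pairing \<alpha> (block_word w J)) =
        (\<Sum>J\<in>?C. g j * (prod_list (map g J) * pairing \<alpha> (block_word w (j # J))))"
      by (subst sum.reindex) (simp_all add: mult.assoc)
    also have "\<dots> = g j * (\<Sum>J\<in>?C. pairing (\<lambda>a. ?q a J) ?x)"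
      by (simp add: * pairing_def[of _ ?x] sum_distrib_left mult_ac)
    also have "(\<Sum>J\<in>?C. pairing (\<lambda>a. ?q a J) ?x) = pairing (\<lambda>a. \<Sum>J\<in>?C. ?q a J) ?x"
      unfolding pairing_def[of _ ?x] sum_distrib_left by (rule sum.swap)
    finally show "(\<Sum>J\<in>Cons j ` ?C. prod_list (map g J) * pairing \<alpha> (block_word w J)) =
        g j * pairing (\<lambda>a. block_sum g (\<lambda>u. \<alpha> (a # u)) (drop j w)) ?x"
      by (simp add: block_sum_def)
  qed simp
  finally show ?thesis .
qed

text \<open>Blocks of length three or more vanish, so the recursion by first block has the two
  branches of \<open>contracted\<close>: keep one letter with weight \<open>g 1\<close>, or merge
  two equal index letters with weight \<open>g 2\<close>.\<close>

lemma block_sum_eq_contraction_sum: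
  assumes "g 1 = 1" "g 2 = c"
  shows "block_sum g \<alpha> w = contraction_sum c \<alpha> w"
proof (induction w arbitrary: \<alpha> rule: contracted.induct)
  case 1
  then show ?case by (simp add: block_sum_def compositions_0 block_word_def)
next
  case (2 a)
  then show ?case using assms by (simp add: block_sum_rec) (simp add: block_sum_def compositions_0 block_word_def)
next
  case (3 a b w)
  let ?t = "\<lambda>j. g j * pairing (\<lambda>x. block_sum g (\<lambda>u. \<alpha> (x # u)) (drop j (a # b # w)))
    (iterated_bracket (take j (a # b # w)))"
  have "block_sum g \<alpha> (a # b # w) = sum ?t {1..length (a # b # w)}"
    by (rule block_sum_rec) simp
  also have "\<dots> = sum ?t {1, 2}"
  proof (rule sum.mono_neutral_right)
    show "\<forall>j\<in>{1..length (a # b # w)} - {1, 2}. ?t j = 0"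
    proof
      fix j assume j: "j \<in> {1..length (a # b # w)} - {1, 2}"
      then obtain k where "j = Suc (Suc (Suc k))"
        using that[of "j - 3"] by (auto simp: numeral_eq_Suc)
      moreover from this j obtain c w' where "w = c # w'" by (cases w) auto
      ultimately show "?t j = 0" by (simp add: iterated_bracket_long del: iterated_bracket.simps)
    qed
  qed auto
  also have "\<dots> = contraction_sum c \<alpha> (a # b # w)"
    using 3 assms by (cases a; cases b) (auto simp: numeral_2_eq_2)
  finally show ?case .
qed

lemma dual_map_exp: "dual_map word_exp \<alpha> = contraction_sum (1 / 2) \<alpha>"
proof
  fix w
  have "prod_list (map (\<lambda>j. 1 / fact j) J) = (1 / prod_list (map fact J) :: real)" for J
    by (induction J) simp_all
  then have "dual_map word_exp \<alpha> w = block_sum (\<lambda>j. 1 / fact j) \<alpha> w"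
    by (simp add: dual_map_def word_exp_def block_sum_def pairing_sum pairing_scale)
  then show "dual_map word_exp \<alpha> w = contraction_sum (1 / 2) \<alpha> w"
    by (simp add: block_sum_eq_contraction_sum)
qed

lemma dual_map_log: "dual_map word_log \<alpha> = contraction_sum (- 1 / 2) \<alpha>"
proof
  fix w
  \<comment> \<open>Guards the truncated subtraction: with positive parts the exponent
    \<open>sum_list J - length J\<close> splits into the exponents \<open>j - 1\<close> of the
    parts.\<close>
  have le: "\<forall>j\<in>set J. 0 < j \<Longrightarrow> length J \<le> sum_list J" for J
    by (induction J) (auto simp: Suc_le_eq add_less_le_mono)
  have "prod_list (map (\<lambda>j. (- 1) ^ (j - 1) / j) J) =
      (- 1) ^ (sum_list J - length J) / prod_list (map real J)" if "\<forall>j\<in>set J. 0 < j" for J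
    using that
  proof (induction J)
    case (Cons j J)
    then have *: "sum_list (j # J) - length (j # J) = (j - 1) + (sum_list J - length J)"
      using le[of J] by auto
    show ?case
      unfolding * power_add using Cons by simp
  qed auto
  then have "dual_map word_log \<alpha> w = block_sum (\<lambda>j. (- 1) ^ (j - 1) / j) \<alpha> w"
    by (auto simp: dual_map_def word_log_def block_sum_def pairing_sum pairing_scale compositions_def
        intro!: sum.cong)
  then show "dual_map word_log \<alpha> w = contraction_sum (- 1 / 2) \<alpha> w"
    by (simp add: block_sum_eq_contraction_sum)
qed

section \<open>Convolution and its compatibility with contractions\<close>

lemma convolution_eq: "convolution \<alpha> \<beta> w = (\<Sum>k\<le>length w. \<alpha> (take k w) * \<beta> (drop k w))"
  by (simp add: convolution_def deconcatenation_def pairing_sum)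

lemma convolution_Nil: "convolution \<alpha> \<beta> [] = \<alpha> [] * \<beta> []"
  by (simp add: convolution_eq)

lemma convolution_Cons:
  "convolution \<alpha> \<beta> (a # w) = \<alpha> [] * \<beta> (a # w) + convolution (\<lambda>u. \<alpha> (a # u)) \<beta> w"
  by (simp only: convolution_eq list.size sum.atMost_Suc_shift add_0_right add_Suc_right) simp

lemma convolution_add_left:
  "convolution (\<lambda>u. \<alpha> u + \<gamma> u) \<beta> w = convolution \<alpha> \<beta> w + convolution \<gamma> \<beta> w"
  by (simp add: convolution_eq sum.distrib algebra_simps)

lemma convolution_cmult_left: "convolution (\<lambda>u. k * \<alpha> u) \<beta> w = k * convolution \<alpha> \<beta> w"
  by (simp add: convolution_eq sum_distrib_left algebra_simps)

text \<open>A cut of a contracted word never falls inside a contracted pair. Contracting and then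
  cutting is therefore the same as cutting \<open>w\<close> and contracting both pieces, and the
  numbers of contractions add up.\<close>

lemma contraction_sum_convolution: "contraction_sum c (convolution \<alpha> \<beta>) w = convolution (contraction_sum c \<alpha>) (contraction_sum c \<beta>) w"
proof (induction w arbitrary: \<alpha> rule: contracted.induct)
  case (3 a b w)
  let ?\<alpha> = "\<lambda>x u. \<alpha> (x # u)"
  \<comment> \<open>Again the part of the left factor in which \<open>a\<close> is contracted with
    the letter after it. It vanishes on the empty word, so its convolution on \<open>b # w\<close>
    starts only after the letter \<open>b\<close>.\<close>
  define g where "g = (\<lambda>u. if u \<noteq> [] \<and> hd u = a \<and> a \<noteq> Circ
    then c * contraction_sum c (?\<alpha> Circ) (tl u) else 0)"
  have shift: "(\<lambda>u. contraction_sum c \<alpha> (a # u)) = (\<lambda>u. contraction_sum c (?\<alpha> a) u + g u)"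
  proof
    fix u show "contraction_sum c \<alpha> (a # u) = contraction_sum c (?\<alpha> a) u + g u"
      by (cases u) (auto simp: g_def)
  qed
  have g: "convolution g (contraction_sum c \<beta>) (b # w) =
    (if a = b \<and> a \<noteq> Circ then c * convolution (contraction_sum c (?\<alpha> Circ)) (contraction_sum c \<beta>) w else 0)"
  proof (cases "a = b \<and> a \<noteq> Circ")
    case True
    then have "(\<lambda>u. g (b # u)) = (\<lambda>u. c * contraction_sum c (?\<alpha> Circ) u)"
      by (auto simp: g_def)
    moreover have "g [] = 0" by (simp add: g_def)
    ultimately have "convolution g (contraction_sum c \<beta>) (b # w) =
        c * convolution (contraction_sum c (?\<alpha> Circ)) (contraction_sum c \<beta>) w"
      by (simp add: convolution_Cons convolution_cmult_left)
    with True show ?thesis by auto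
  next
    case False
    then have "(\<lambda>u. g (b # u)) = (\<lambda>u. 0)"
      by (auto simp: g_def)
    moreover have "g [] = 0" by (simp add: g_def)
    ultimately have "convolution g (contraction_sum c \<beta>) (b # w) = 0"
      by (simp only: convolution_Cons) (simp add: convolution_eq)
    with False show ?thesis by auto
  qed
  have "contraction_sum c (convolution \<alpha> \<beta>) (a # b # w) =
     contraction_sum c (\<lambda>u. \<alpha> [] * \<beta> (a # u) + convolution (?\<alpha> a) \<beta> u) (b # w) +
     (if a = b \<and> a \<noteq> Circ then c * contraction_sum c (\<lambda>u. \<alpha> [] * \<beta> (Circ # u) + convolution (?\<alpha> Circ) \<beta> u) w else 0)"
    by (auto simp: convolution_Cons)
  also have "\<dots> = \<alpha> [] * contraction_sum c \<beta> (a # b # w) + convolution (contraction_sum c (?\<alpha> a)) (contraction_sum c \<beta>) (b # w) +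
     (if a = b \<and> a \<noteq> Circ then c * convolution (contraction_sum c (?\<alpha> Circ)) (contraction_sum c \<beta>) w else 0)"
    using 3 by (auto simp: contraction_sum_add contraction_sum_cmult algebra_simps)
  also have "\<dots> = convolution (contraction_sum c \<alpha>) (contraction_sum c \<beta>) (a # b # w)"
    by (subst convolution_Cons[of _ _ a]) (auto simp: shift convolution_add_left g del: contraction_sum_Cons_Cons)
  finally show ?case .
qed (auto simp: convolution_eq)

lemma contraction_sum_counit [simp]: "contraction_sum c counit = counit"
proof
  fix w :: "'a word" show "contraction_sum c counit w = counit w"
    by (cases w rule: contracted.cases) (simp_all add: counit_def)
qed

lemma convolution_inverse_contraction_sum:
  assumes "convolution_inverse \<alpha> \<beta>"
  shows "convolution_inverse (contraction_sum c \<alpha>) (contraction_sum c \<beta>)"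
proof -
  have "convolution (contraction_sum c \<alpha>) (contraction_sum c \<beta>) = counit" if "convolution \<alpha> \<beta> = counit" for \<alpha> \<beta> :: "'a dual"
  proof
    show "convolution (contraction_sum c \<alpha>) (contraction_sum c \<beta>) w = counit w" for w
      by (simp only: contraction_sum_convolution[symmetric] that contraction_sum_counit)
  qed
  with assms show ?thesis by (auto simp: convolution_inverse_def)
qed

text \<open>Since \<open>\<beta> []\<close> is nonzero, the convolution equation determines the
  value on \<open>w\<close> from those on its proper prefixes; this triangular system takes the
  place of associativity of the convolution.\<close>

lemma convolution_inverse_unique:
  assumes "convolution_inverse \<alpha> \<beta>" "convolution_inverse \<alpha>' \<beta>"
  shows "\<alpha> = \<alpha>'"
proof
  have nz: "\<beta> [] \<noteq> 0"
  proof -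
    have "\<alpha> [] * \<beta> [] = 1"
      using assms(1) by (simp add: convolution_inverse_def convolution_Nil[symmetric] counit_def)
    then show ?thesis by auto
  qed
  have rec: "\<gamma> w * \<beta> [] = counit w - (\<Sum>k<length w. \<gamma> (take k w) * \<beta> (drop k w))"
    if "convolution_inverse \<gamma> \<beta>" for \<gamma> w
  proof -
    have "convolution \<gamma> \<beta> w = counit w"
      using that by (simp add: convolution_inverse_def)
    then show ?thesis
      by (simp add: convolution_eq lessThan_Suc_atMost[symmetric])
  qed
  show "\<alpha> w = \<alpha>' w" for w
  proof (induction w rule: length_induct)
    case (1 w)
    then have "(\<Sum>k<length w. \<alpha> (take k w) * \<beta> (drop k w)) = (\<Sum>k<length w. \<alpha>' (take k w) * \<beta> (drop k w))"
      by (intro sum.cong) auto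
    then have "\<alpha> w * \<beta> [] = \<alpha>' w * \<beta> []"
      using rec[OF assms(1), of w] rec[OF assms(2), of w] by simp
    with nz show ?case by simp
  qed
qed

section \<open>Moments of Brownian increments\<close>

text \<open>Fubini for a product of functions of single coordinates. Lebesgue measure on
  \<open>real ^ 'd\<close> is the image of a product measure indexed by basis vectors, so the
  factors are reindexed along \<open>axis i 1\<close>.\<close>

lemma has_bochner_integral_prod_vec_nth:
  fixes f :: "'d::finite \<Rightarrow> real \<Rightarrow> real"
  assumes f: "\<And>i. integrable lborel (f i)"
  shows "has_bochner_integral lborel (\<lambda>x::real^'d. \<Prod>i\<in>UNIV. f i (x $ i)) (\<Prod>i\<in>UNIV. integral\<^sup>L lborel (f i))"
proof -
  let ?ax = "\<lambda>i::'d. axis i (1::real)"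
  define g where "g b = f (inv ?ax b)" for b
  have inj: "inj ?ax" by (auto simp: inj_on_def axis_eq_axis)
  have g: "g (?ax i) = f i" for i
    using inv_f_f[OF inj, of i] by (simp add: g_def)
  have Basis: "(Basis :: (real^'d) set) = range ?ax" by (auto simp: Basis_vec_def)
  have [measurable]: "f i \<in> borel_measurable borel" for i
    using f[of i] by (simp add: integrable_iff_bounded)
  interpret product_sigma_finite "\<lambda>_::real^'d. lborel :: real measure" ..
  have gi: "integrable lborel (g b)" for b by (simp add: g_def f)
  have nth: "(\<Sum>b\<in>Basis. x b *\<^sub>R b) $ i = x (?ax i)" for x :: "real^'d \<Rightarrow> real" and i
  proof -
    have ax: "?ax j $ i = (if j = i then 1 else 0)" for j by (auto simp: axis_def)
    have "(\<Sum>b\<in>Basis. x b *\<^sub>R b) $ i = (\<Sum>j\<in>UNIV. x (?ax j) * ?ax j $ i)"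
      by (simp only: Basis sum.reindex[OF inj] o_def sum_component vector_scaleR_component real_scaleR_def)
    also have "\<dots> = (\<Sum>j\<in>UNIV. if j = i then x (?ax j) else 0)"
      unfolding ax by (intro sum.cong) auto
    finally show ?thesis by simp
  qed
  have prod: "(\<Prod>i\<in>UNIV. f i ((\<Sum>b\<in>Basis. x b *\<^sub>R b) $ i)) = (\<Prod>b\<in>Basis. g b (x b))" for x :: "real^'d \<Rightarrow> real"
    by (simp only: nth) (simp add: Basis prod.reindex[OF inj] g)
  have "has_bochner_integral (Pi\<^sub>M Basis (\<lambda>_. lborel)) (\<lambda>x. \<Prod>b\<in>Basis. g b (x b))
      (\<Prod>b\<in>(Basis::(real^'d) set). integral\<^sup>L lborel (g b))"
    unfolding has_bochner_integral_iff
    by (intro conjI product_integrable_prod product_integral_prod finite_Basis gi)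
  moreover have "(\<Prod>b\<in>(Basis::(real^'d) set). integral\<^sup>L lborel (g b)) = (\<Prod>i\<in>UNIV. integral\<^sup>L lborel (f i))"
    by (simp add: Basis prod.reindex[OF inj] g)
  ultimately show ?thesis
    unfolding has_bochner_integral_iff
    by (subst (1 2) lborel_eq) (simp add: integrable_distr_eq integral_distr prod del: sum_component)
qed

definition normal_mom :: "real \<Rightarrow> nat \<Rightarrow> real" where
  "normal_mom \<sigma> n = (\<integral>x. normal_density 0 \<sigma> x * x ^ n \<partial>lborel)"

lemma normal_mom_values:
  assumes "0 < \<sigma>"
  shows "normal_mom \<sigma> 0 = 1" "normal_mom \<sigma> (Suc 0) = 0" "normal_mom \<sigma> 2 = \<sigma>\<^sup>2" "normal_mom \<sigma> 4 = 3 * \<sigma> ^ 4"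
  using integral_normal_moment_even[OF assms, of 0 0] integral_normal_moment_even[OF assms, of 0 1]
    integral_normal_moment_even[OF assms, of 0 2] integral_normal_moment_odd[OF assms, of 0 0] assms
  by (simp_all add: normal_mom_def fact_numeral power_divide)

lemma has_bochner_integral_normal_vec:
  assumes "0 < \<sigma>"
  shows "has_bochner_integral lborel
    (\<lambda>x::real^'d::finite. (\<Prod>i\<in>UNIV. normal_density 0 \<sigma> (x $ i)) * (\<Prod>i\<in>UNIV. x $ i ^ e i))
    (\<Prod>i\<in>UNIV. normal_mom \<sigma> (e i))"
  using has_bochner_integral_prod_vec_nth[of "\<lambda>i y. normal_density 0 \<sigma> y * y ^ e i"]
    integrable_normal_moment[OF assms, of 0]
  by (simp add: normal_mom_def prod.distrib)

text \<open>\<open>brownian_motion\<close> states independence with the increment first and the past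
  second, while the factorisation below has the adapted factor first; both sides also shrink to the
  sigma-algebras generated by the two factors.\<close>

lemma (in prob_space) indep_set_mono_commute:
  assumes ind: "indep_set A B" and sub: "A' \<subseteq> A" "B' \<subseteq> B"
  shows "indep_set B' A'"
  unfolding indep_sets2_eq
proof (intro conjI ballI)
  show "B' \<subseteq> events" "A' \<subseteq> events"
    using sub indep_setD_ev1[OF ind] indep_setD_ev2[OF ind] by auto
  fix b a assume "b \<in> B'" "a \<in> A'"
  then have "prob (a \<inter> b) = prob a * prob b"
    using sub by (intro indep_setD[OF ind]) auto
  then show "prob (b \<inter> a) = prob b * prob a"
    by (simp only: Int_commute mult.commute)
qed

section \<open>Adapted factors and Brownian increments\<close>

locale brownian =
  fixes M :: "'w measure" and T :: real and B :: "real \<Rightarrow> 'w \<Rightarrow> real ^ 'd::finite"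
  assumes bm: "brownian_motion M T B"
begin

sublocale prob_space M
  using bm by (simp add: brownian_motion_def)

abbreviation dB :: "'d \<Rightarrow> real \<Rightarrow> real \<Rightarrow> 'w \<Rightarrow> real" where
  "dB i s t \<omega> \<equiv> B t \<omega> $ i - B s \<omega> $ i"

lemma measurable_B: "0 \<le> t \<Longrightarrow> t \<le> T \<Longrightarrow> B t \<in> borel_measurable M"
  using bm by (simp add: brownian_motion_def)

lemma measurable_B_nth: "0 \<le> t \<Longrightarrow> t \<le> T \<Longrightarrow> (\<lambda>\<omega>. B t \<omega> $ i) \<in> borel_measurable M"
  using measurable_compose[OF measurable_B borel_measurable_nth] by simp

lemma space_past [simp]: "space (past M B s) = space M"
  unfolding past_def by (rule space_measure_of) auto

lemma sets_past: "sets (past M B s) =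
    sigma_sets (space M) {B u -` A \<inter> space M | u A. 0 \<le> u \<and> u \<le> s \<and> A \<in> sets borel}"
  unfolding past_def by (rule sets_measure_of) auto

lemma sets_past_mono: "s \<le> t \<Longrightarrow> sets (past M B s) \<subseteq> sets (past M B t)"
  unfolding sets_past by (rule sigma_sets_mono') force

lemma sets_past_subset: "s \<le> T \<Longrightarrow> sets (past M B s) \<subseteq> sets M"
  unfolding sets_past
  by (rule sets.sigma_sets_subset) (auto intro!: measurable_sets[OF measurable_B])

lemma measurable_past_mono:
  "f \<in> borel_measurable (past M B s) \<Longrightarrow> s \<le> t \<Longrightarrow> f \<in> borel_measurable (past M B t)"
  using sets_past_mono by (auto simp: measurable_def)

lemma measurable_past_M: "f \<in> borel_measurable (past M B s) \<Longrightarrow> s \<le> T \<Longrightarrow> f \<in> borel_measurable M"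
  using sets_past_subset[of s] by (auto simp: measurable_def)

lemma measurable_B_past:
  assumes "0 \<le> u" "u \<le> s"
  shows "B u \<in> borel_measurable (past M B s)"
proof (rule measurableI)
  fix A :: "(real^'d) set" assume "A \<in> sets borel"
  then show "B u -` A \<inter> space (past M B s) \<in> sets (past M B s)"
    unfolding sets_past using assms by (auto intro!: sigma_sets.Basic)
qed simp

lemma measurable_dB_past:
  "0 \<le> a \<Longrightarrow> a \<le> s \<Longrightarrow> 0 \<le> b \<Longrightarrow> b \<le> s \<Longrightarrow> dB i a b \<in> borel_measurable (past M B s)"
  using measurable_compose[OF measurable_B_past borel_measurable_nth]
  by (intro borel_measurable_diff) auto

lemma measurable_dB: "0 \<le> a \<Longrightarrow> a \<le> T \<Longrightarrow> 0 \<le> b \<Longrightarrow> b \<le> T \<Longrightarrow> dB i a b \<in> borel_measurable M"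
  by (intro borel_measurable_diff measurable_B_nth)

lemma increment_moments:
  assumes "0 \<le> s" "s < t" "t \<le> T"
  shows "has_bochner_integral M (\<lambda>\<omega>. \<Prod>i\<in>UNIV. dB i s t \<omega> ^ e i) (\<Prod>i\<in>UNIV. normal_mom (sqrt (t - s)) (e i))"
proof -
  have D: "distributed M lborel (\<lambda>\<omega>. B t \<omega> - B s \<omega>)
      (\<lambda>x. ennreal (\<Prod>i\<in>UNIV. normal_density 0 (sqrt (t - s)) (x $ i)))"
    using bm assms by (auto simp: brownian_motion_def)
  have g: "(\<lambda>x::real^'d. \<Prod>i\<in>UNIV. x $ i ^ e i) \<in> borel_measurable lborel"
    by (intro borel_measurable_prod borel_measurable_power) simp
  show ?thesis
    using has_bochner_integral_normal_vec[of "sqrt (t - s)" e] assms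
      distributed_integral[OF D g] distributed_integrable[OF D g]
    by (simp add: has_bochner_integral_iff prod_nonneg)
qed

lemma prod_power_delta:
  fixes x :: "'d \<Rightarrow> real"
  shows "(\<Prod>k\<in>UNIV. x k ^ (if k = i then n else 0)) = x i ^ n"
  by (simp add: if_distrib[of "\<lambda>n. _ ^ n"] cong: if_cong)

lemma prod_delta_pair:
  fixes f :: "nat \<Rightarrow> real" and i j :: 'd
  assumes "f 0 = 1" "i \<noteq> j"
  shows "(\<Prod>k\<in>UNIV. f (if k = i then m else if k = j then n else 0)) = f m * f n"
proof -
  have "(\<Prod>k\<in>UNIV. f (if k = i then m else if k = j then n else 0)) =
      (\<Prod>k\<in>UNIV. (if k = i then f m else 1) * (if k = j then f n else 1))"
    using assms by (intro prod.cong) auto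
  then show ?thesis by (simp add: prod.distrib)
qed

lemma prod_delta_single:
  fixes f :: "nat \<Rightarrow> real" and i :: 'd
  assumes "f 0 = 1"
  shows "(\<Prod>k\<in>UNIV. f (if k = i then n else 0)) = f n"
proof -
  have "(\<Prod>k\<in>UNIV. f (if k = i then n else 0)) = (\<Prod>k\<in>UNIV. (if k = i then f n else 1))"
    using assms by (intro prod.cong) auto
  then show ?thesis by simp
qed

lemma dB_moment:
  assumes "0 \<le> s" "s < t" "t \<le> T"
  shows "has_bochner_integral M (\<lambda>\<omega>. dB i s t \<omega> ^ n) (normal_mom (sqrt (t - s)) n)"
  using increment_moments[OF assms, of "\<lambda>k. if k = i then n else 0"] assms
  by (simp add: prod_power_delta prod_delta_single[of "normal_mom (sqrt (t - s))"] normal_mom_values)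

lemma dB_first_moment:
  assumes "0 \<le> s" "s \<le> t" "t \<le> T"
  shows "has_bochner_integral M (dB i s t) 0"
  using dB_moment[of s t i 1] assms
  by (cases "s = t") (simp_all add: normal_mom_values has_bochner_integral_zero)

lemma dB_fourth_moment:
  assumes "0 \<le> s" "s \<le> t" "t \<le> T"
  shows "has_bochner_integral M (\<lambda>\<omega>. dB i s t \<omega> ^ 4) (3 * (t - s)\<^sup>2)"
proof (cases "s = t")
  case False
  have "sqrt (t - s) ^ 4 = ((sqrt (t - s))\<^sup>2)\<^sup>2"
    by (simp only: power4_eq_xxxx power2_eq_square mult.assoc)
  then show ?thesis
    using dB_moment[of s t i 4] assms False by (simp add: normal_mom_values)
qed (simp add: has_bochner_integral_zero)

lemma dB_second_moment:
  assumes "0 \<le> s" "s \<le> t" "t \<le> T"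
  shows "has_bochner_integral M (\<lambda>\<omega>. dB i s t \<omega> * dB j s t \<omega>) (if i = j then t - s else 0)"
proof (cases "s = t")
  case False
  show ?thesis
  proof (cases "i = j")
    case True
    then show ?thesis using dB_moment[of s t i 2] assms False
      by (simp add: normal_mom_values power2_eq_square)
  next
    case ij: False
    have "(\<Prod>k\<in>UNIV. x k ^ (if k = i then 1 else if k = j then 1 else 0)) = (x i * x j :: real)" for x
    proof -
      have "(\<Prod>k\<in>UNIV. x k ^ (if k = i then 1 else if k = j then 1 else 0)) =
          (\<Prod>k\<in>UNIV. x k ^ (if k = i then 1 else 0) * x k ^ (if k = j then 1 else 0))"
        using ij by (intro prod.cong) auto
      then show ?thesis by (simp only: prod.distrib prod_power_delta) simp
    qed
    then show ?thesis
      using increment_moments[of s t "\<lambda>k. if k = i then 1 else if k = j then 1 else 0"] assms False ij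
      by (simp add: prod_delta_pair[of "normal_mom (sqrt (t - s))"] normal_mom_values)
  qed
qed (simp add: has_bochner_integral_zero)

text \<open>The increment is independent of the past of \<open>s\<close>, so the adapted \<zeta> and
  any function of the increment are independent random variables and the mean of their product
  factorises.\<close>

lemma past_indep:
  fixes f :: "real^'d \<Rightarrow> real"
  assumes "0 \<le> s" "s < t" "t \<le> T"
    and \<zeta>: "\<zeta> \<in> borel_measurable (past M B s)" "integrable M \<zeta>"
    and f: "f \<in> borel_measurable borel" "has_bochner_integral M (\<lambda>\<omega>. f (B t \<omega> - B s \<omega>)) m"
  shows "has_bochner_integral M (\<lambda>\<omega>. \<zeta> \<omega> * f (B t \<omega> - B s \<omega>)) (expectation \<zeta> * m)"
proof -
  let ?D = "\<lambda>\<omega>. B t \<omega> - B s \<omega>" and ?X = "\<lambda>\<omega>. f (B t \<omega> - B s \<omega>)"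
  have D: "?D \<in> borel_measurable M"
    using assms by (intro borel_measurable_diff measurable_B) auto
  have ind: "indep_set {?D -` A \<inter> space M | A. A \<in> sets borel} (sets (past M B s))"
    using bm assms by (auto simp: brownian_motion_def)
  have "sigma_sets (space M) {?X -` A \<inter> space M |A. A \<in> sets borel}
      \<subseteq> {?D -` A \<inter> space M | A. A \<in> sets borel}"
  proof -
    have "sigma_sets (space M) {?X -` A \<inter> space M |A. A \<in> sets borel} =
        sets (vimage_algebra (space M) ?X borel)"
      by (simp add: sets_vimage_algebra)
    also have "\<dots> \<subseteq> {?D -` A \<inter> space M | A. A \<in> sets borel}"
      using measurable_sets[OF f(1)]
      by (auto simp: sets_vimage_algebra2 vimage_def)
    finally show ?thesis .
  qed
  moreover have "sigma_sets (space M) {\<zeta> -` A \<inter> space M |A. A \<in> sets borel} \<subseteq> sets (past M B s)"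
    using sets.sigma_sets_subset[of "{\<zeta> -` A \<inter> space M |A. A \<in> sets borel}" "past M B s"]
      measurable_sets[OF \<zeta>(1)] by auto
  ultimately have "indep_set (sigma_sets (space M) {\<zeta> -` A \<inter> space M |A. A \<in> sets borel})
      (sigma_sets (space M) {?X -` A \<inter> space M |A. A \<in> sets borel})"
    using indep_set_mono_commute[OF ind] by blast
  then have "indep_var borel \<zeta> borel ?X"
    unfolding indep_var_eq using \<zeta>(2) f D by (auto simp: has_bochner_integral_iff)
  then show ?thesis
    using indep_var_lebesgue_integral[of \<zeta> ?X] indep_var_integrable[of \<zeta> ?X] \<zeta>(2) f(2)
    by (simp add: has_bochner_integral_iff)
qed

text \<open>The martingale property of the increments after \<open>s\<close>, the source of the
  vanishing cross terms in the isometry.\<close>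

lemma past_dB:
  assumes "0 \<le> s" "s \<le> t" "t \<le> T"
    and \<zeta>: "\<zeta> \<in> borel_measurable (past M B s)" "integrable M \<zeta>"
  shows "has_bochner_integral M (\<lambda>\<omega>. \<zeta> \<omega> * dB i s t \<omega>) 0"
  using past_indep[OF _ _ _ \<zeta>, of t "\<lambda>x. x $ i" 0] dB_first_moment[of s t i] assms
  by (cases "s = t") auto

lemma past_dB_dB:
  assumes "0 \<le> s" "s \<le> t" "t \<le> T"
    and \<zeta>: "\<zeta> \<in> borel_measurable (past M B s)" "integrable M \<zeta>"
  shows "has_bochner_integral M (\<lambda>\<omega>. \<zeta> \<omega> * (dB i s t \<omega> * dB j s t \<omega>))
    (expectation \<zeta> * (if i = j then t - s else 0))"
  using past_indep[OF _ _ _ \<zeta>, of t "\<lambda>x. x $ i * x $ j" "if i = j then t - s else 0"]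
    dB_second_moment[of s t i j] assms
  by (cases "s = t") auto

text \<open>The outer interval is split at \<open>a\<close> and \<open>b\<close>; only the middle part contributes.\<close>

lemma past_dB_dB_nested:
  assumes "0 \<le> c" "c \<le> a" "a \<le> b" "b \<le> d" "d \<le> T"
    and \<zeta>: "\<zeta> \<in> borel_measurable (past M B c)" "integrable M \<zeta>"
  shows "has_bochner_integral M (\<lambda>\<omega>. \<zeta> \<omega> * (dB j a b \<omega> * dB i c d \<omega>))
    (expectation \<zeta> * (if i = j then b - a else 0))"
proof -
  have \<zeta>': "\<zeta> \<in> borel_measurable (past M B a)" "\<zeta> \<in> borel_measurable (past M B b)"
    using measurable_past_mono[OF \<zeta>(1)] assms by auto
  have left: "has_bochner_integral M (\<lambda>\<omega>. (\<zeta> \<omega> * dB i c a \<omega>) * dB j a b \<omega>) 0"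
    using assms past_dB[of c a \<zeta> i] \<zeta>' measurable_dB_past[of c a a i]
    by (intro past_dB) (auto simp: has_bochner_integral_iff)
  have mid: "has_bochner_integral M (\<lambda>\<omega>. \<zeta> \<omega> * (dB j a b \<omega> * dB i a b \<omega>))
      (expectation \<zeta> * (if i = j then b - a else 0))"
    using past_dB_dB[of a b \<zeta> j i] assms \<zeta>' by (cases "i = j") auto
  have right: "has_bochner_integral M (\<lambda>\<omega>. (\<zeta> \<omega> * dB j a b \<omega>) * dB i b d \<omega>) 0"
    using assms past_dB[of a b \<zeta> j] \<zeta>' measurable_dB_past[of a b b j]
    by (intro past_dB) (auto simp: has_bochner_integral_iff)
  show ?thesis
    using has_bochner_integral_add[OF has_bochner_integral_add[OF left mid] right]
    by (simp add: algebra_simps)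
qed

end

section \<open>The isometry for step integrands\<close>

lemma has_bochner_integral_indicator_Ioc_Ioc:
  "has_bochner_integral lborel (\<lambda>u::real. indicator {a<..b} u * indicator {c<..d} u)
     (max 0 (min b d - max a c))"
proof -
  have "(\<lambda>u::real. indicator {a<..b} u * indicator {c<..d} u :: real) = indicator {max a c<..min b d}"
    by (auto simp: indicator_def fun_eq_iff)
  moreover have "measure lborel {max a c<..min b d} = max 0 (min b d - max a c)"
    by (cases "max a c \<le> min b d") (auto simp: max_def)
  moreover have "emeasure lborel {max a c<..min b d} < \<infinity>"
    by (cases "max a c \<le> min b d") auto
  ultimately show ?thesis
    using has_bochner_integral_real_indicator[of "{max a c<..min b d}" lborel] by simp
qed

lemma integrable_bounded_mult:
  fixes f g :: "'a \<Rightarrow> real"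
  assumes "integrable M f" "g \<in> borel_measurable M" "\<forall>x\<in>space M. \<bar>g x\<bar> \<le> C"
  shows "integrable M (\<lambda>x. g x * f x)"
proof (rule Bochner_Integration.integrable_bound)
  show "integrable M (\<lambda>x. C * f x)" using assms(1) by simp
  show "AE x in M. norm (g x * f x) \<le> norm (C * f x)"
  proof (rule AE_I2)
    fix x assume "x \<in> space M"
    then have "\<bar>g x\<bar> \<le> \<bar>C\<bar>" using assms(3) by force
    then show "norm (g x * f x) \<le> norm (C * f x)" by (simp add: abs_mult mult_right_mono)
  qed
qed (use assms in auto)

lemma is_partition_mono:
  assumes "is_partition s t n r" "j \<le> k" "k \<le> n"
  shows "r j \<le> r k"
  using assms(2,3)
proof (induction rule: dec_induct)
  case (step m)
  then have "r m \<le> r (Suc m)" using assms(1) by (simp add: is_partition_def)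
  with step show ?case by simp
qed simp

lemma is_partition_bounds:
  assumes "is_partition s t n r" "k \<le> n"
  shows "s \<le> r k" "r k \<le> t"
  using is_partition_mono[OF assms(1), of 0 k] is_partition_mono[OF assms(1), of k n] assms
  by (auto simp: is_partition_def)

text \<open>The intervals in the list may overlap. Concatenation then adds step integrands and
  truncation acts entrywise, with no common refinement of partitions.\<close>

type_synonym 'w step_data = "(real \<times> real \<times> ('w \<Rightarrow> real)) list"

definition step :: "'w step_data \<Rightarrow> real \<Rightarrow> 'w \<Rightarrow> real" where
  "step L u \<omega> = (\<Sum>(a, b, \<xi>)\<leftarrow>L. \<xi> \<omega> * indicator {a<..b} u)"

lemma step_Nil [simp]: "step [] u \<omega> = 0"
  and step_Cons: "step ((a, b, \<xi>) # L) u \<omega> = \<xi> \<omega> * indicator {a<..b} u + step L u \<omega>"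
  and step_append: "step (L @ K) u \<omega> = step L u \<omega> + step K u \<omega>"
  by (simp_all add: step_def)

definition scale_step :: "real \<Rightarrow> 'w step_data \<Rightarrow> 'w step_data" where
  "scale_step c = map (\<lambda>(a, b, \<xi>). (a, b, \<lambda>\<omega>. c * \<xi> \<omega>))"

lemma step_scale: "step (scale_step c L) u \<omega> = c * step L u \<omega>"
  by (induction L) (auto simp: scale_step_def step_Cons algebra_simps)

definition clip :: "real \<Rightarrow> real \<Rightarrow> real \<Rightarrow> real" where
  "clip p q x = max p (min q x)"

text \<open>Clipping both endpoints intersects \<open>(a, b]\<close> with \<open>(p, q]\<close>; an
  interval disjoint from it collapses to a point, whose half-open indicator is zero.\<close>

definition restrict_step :: "real \<Rightarrow> real \<Rightarrow> 'w step_data \<Rightarrow> 'w step_data" where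
  "restrict_step p q = map (\<lambda>(a, b, \<xi>). (clip p q a, clip p q b, \<xi>))"

lemma step_restrict:
  "p \<le> q \<Longrightarrow> step (restrict_step p q L) u \<omega> = indicator {p<..q} u * step L u \<omega>"
proof (induction L)
  case (Cons x L)
  moreover obtain a b \<xi> where "x = (a, b, \<xi>)" by (cases x)
  moreover have "indicator {clip p q a<..clip p q b} u = (indicator {p<..q} u * indicator {a<..b} u :: real)"
    using Cons(2) by (auto simp: indicator_def clip_def)
  ultimately show ?case by (simp add: restrict_step_def step_Cons algebra_simps)
qed (simp add: restrict_step_def)

context brownian
begin

text \<open>
  Degenerate intervals carry no adaptedness requirement, so that truncation to a subinterval
  preserves \<open>elem_ok\<close>.
\<close>

definition elem_ok :: "real \<times> real \<times> ('w \<Rightarrow> real) \<Rightarrow> bool" where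
  "elem_ok = (\<lambda>(a, b, \<xi>). 0 \<le> a \<and> a \<le> b \<and> b \<le> T \<and> \<xi> \<in> borel_measurable M \<and>
     (\<exists>C. \<forall>\<omega>\<in>space M. \<bar>\<xi> \<omega>\<bar> \<le> C) \<and> (a < b \<longrightarrow> \<xi> \<in> borel_measurable (past M B a)))"

definition step_int :: "'d \<Rightarrow> 'w step_data \<Rightarrow> 'w \<Rightarrow> real" where
  "step_int i L \<omega> = (\<Sum>(a, b, \<xi>)\<leftarrow>L. \<xi> \<omega> * dB i a b \<omega>)"

lemma step_int_Nil [simp]: "step_int i [] \<omega> = 0"
  and step_int_Cons: "step_int i ((a, b, \<xi>) # L) \<omega> = \<xi> \<omega> * dB i a b \<omega> + step_int i L \<omega>"
  and step_int_append: "step_int i (L @ K) \<omega> = step_int i L \<omega> + step_int i K \<omega>"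
  by (simp_all add: step_int_def)

lemma step_int_scale: "step_int i (scale_step c L) \<omega> = c * step_int i L \<omega>"
  by (induction L) (auto simp: scale_step_def step_int_Cons algebra_simps)

lemma elem_ok_scale: "list_all elem_ok L \<Longrightarrow> list_all elem_ok (scale_step c L)"
proof (induction L)
  case (Cons x L)
  obtain a b \<xi> where x: "x = (a, b, \<xi>)" by (cases x)
  with Cons obtain C where C: "\<forall>\<omega>\<in>space M. \<bar>\<xi> \<omega>\<bar> \<le> C" by (auto simp: elem_ok_def)
  then have "\<forall>\<omega>\<in>space M. \<bar>c * \<xi> \<omega>\<bar> \<le> \<bar>c\<bar> * C"
    by (simp add: abs_mult mult_left_mono)
  with Cons x show ?case by (auto simp: scale_step_def elem_ok_def)
qed (simp add: scale_step_def)

lemma elem_ok_restrict: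
  assumes "list_all elem_ok L" "0 \<le> p" "p \<le> q" "q \<le> T"
  shows "list_all elem_ok (restrict_step p q L)"
  using assms(1)
proof (induction L)
  case (Cons x L)
  obtain a b \<xi> where x: "x = (a, b, \<xi>)" by (cases x)
  have "elem_ok (clip p q a, clip p q b, \<xi>)"
  proof -
    have ok: "0 \<le> a" "a \<le> b" "b \<le> T" "\<xi> \<in> borel_measurable M" "\<exists>C. \<forall>\<omega>\<in>space M. \<bar>\<xi> \<omega>\<bar> \<le> C"
      "a < b \<longrightarrow> \<xi> \<in> borel_measurable (past M B a)"
      using Cons x by (auto simp: elem_ok_def)
    \<comment> \<open>A truncated interval that stays nondegenerate starts at the later of
      \<open>p\<close> and \<open>a\<close>, so \<xi> is still measurable in the past of its left
      end.\<close>
    have "\<xi> \<in> borel_measurable (past M B (clip p q a))" if "clip p q a < clip p q b"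
    proof -
      have "a < b" "a \<le> clip p q a"
        using that ok(2) assms(3) by (simp_all add: clip_def min_def max_def split: if_splits)
      with ok(6) show ?thesis using measurable_past_mono by blast
    qed
    moreover have "0 \<le> clip p q a" "clip p q a \<le> clip p q b" "clip p q b \<le> T"
      using ok(2) assms(2-4) by (simp_all add: clip_def min_def max_def)
    ultimately show ?thesis using ok(4,5) by (simp add: elem_ok_def)
  qed
  with Cons x show ?case by (auto simp: restrict_step_def)
qed (simp add: restrict_step_def)

lemma measurable_step_int:
  "list_all elem_ok L \<Longrightarrow> step_int i L \<in> borel_measurable M"
proof (induction L)
  case (Cons x L)
  obtain a b \<xi> where x: "x = (a, b, \<xi>)" by (cases x)
  have "(\<lambda>\<omega>. \<xi> \<omega> * dB i a b \<omega> + step_int i L \<omega>) \<in> borel_measurable M"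
    using Cons x by (intro borel_measurable_add borel_measurable_times measurable_dB) (auto simp: elem_ok_def)
  then show ?case using x by (simp add: step_int_Cons[abs_def])
qed (simp add: step_int_def[abs_def])

text \<open>Integrability of both sides is part of the relation, so it can be summed over lists
  without computing the means.\<close>

definition same_mean :: "('w \<Rightarrow> real) \<Rightarrow> ('w \<Rightarrow> real) \<Rightarrow> bool" where
  "same_mean F G \<longleftrightarrow> (\<exists>m. has_bochner_integral M F m \<and> has_bochner_integral M G m)"

lemma same_mean_add:
  "same_mean F G \<Longrightarrow> same_mean F' G' \<Longrightarrow> same_mean (\<lambda>\<omega>. F \<omega> + F' \<omega>) (\<lambda>\<omega>. G \<omega> + G' \<omega>)"
  unfolding same_mean_def using has_bochner_integral_add by blast

lemma same_mean_zero: "same_mean (\<lambda>_. 0) (\<lambda>_. 0)"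
  unfolding same_mean_def using has_bochner_integral_zero by blast

text \<open>If the first interval ends before the second begins, everything but
  \<open>dB i c d\<close> is known at time \<open>c\<close> and the mean vanishes. Otherwise the
  first interval is split at \<open>c\<close>: the part before \<open>c\<close> is again known, and
  the rest shares its left end with the second interval, so the nested product rule gives the length
  of the overlap.\<close>

lemma elem_isometry_ordered:
  assumes x: "elem_ok (a, b, \<xi>)" and y: "elem_ok (c, d, \<eta>)" and ac: "a \<le> c"
  shows "same_mean (\<lambda>\<omega>. (\<xi> \<omega> * dB i a b \<omega>) * (\<eta> \<omega> * dB i c d \<omega>))
    (\<lambda>\<omega>. \<xi> \<omega> * \<eta> \<omega> * max 0 (min b d - max a c))"
proof (cases "a < b \<and> c < d")
  case False
  then have "a = b \<or> c = d"
    using x y by (auto simp: elem_ok_def)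
  then have "max 0 (min b d - max a c) = 0" "(\<lambda>\<omega>. (\<xi> \<omega> * dB i a b \<omega>) * (\<eta> \<omega> * dB i c d \<omega>)) = (\<lambda>_. 0)"
    by auto
  then show ?thesis by (simp only: same_mean_zero mult_zero_right)
next
  case True
  obtain C D where CD: "\<forall>\<omega>\<in>space M. \<bar>\<xi> \<omega>\<bar> \<le> C" "\<forall>\<omega>\<in>space M. \<bar>\<eta> \<omega>\<bar> \<le> D"
    using x y by (auto simp: elem_ok_def)
  have bnd: "0 \<le> a" "b \<le> T" "0 \<le> c" "d \<le> T" using x y by (auto simp: elem_ok_def)
  have m: "\<xi> \<in> borel_measurable (past M B a)" "\<eta> \<in> borel_measurable (past M B c)"
    using x y True by (auto simp: elem_ok_def)
  then have mc [measurable]: "\<xi> \<in> borel_measurable (past M B c)" "\<eta> \<in> borel_measurable (past M B c)"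
    using ac measurable_past_mono by auto
  have mM: "\<xi> \<in> borel_measurable M" "\<eta> \<in> borel_measurable M"
    using x y by (auto simp: elem_ok_def)
  have prod_int: "integrable M (\<lambda>\<omega>. \<xi> \<omega> * (\<eta> \<omega> * f \<omega>))" if "integrable M f" for f
    using integrable_bounded_mult[OF integrable_bounded_mult[OF that mM(2) CD(2)] mM(1) CD(1)] .
  have int1: "integrable M (\<lambda>\<omega>. \<xi> \<omega> * \<eta> \<omega>)" using prod_int[of "\<lambda>_. 1"] by simp
  show ?thesis
  proof (cases "b \<le> c")
    case bc: True
    have dBi: "integrable M (dB i a b)"
      using dB_first_moment[of a b i] bnd True by (auto simp: has_bochner_integral_iff)
    have "has_bochner_integral M (\<lambda>\<omega>. (\<xi> \<omega> * (\<eta> \<omega> * dB i a b \<omega>)) * dB i c d \<omega>) 0"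
      using bnd True bc prod_int[OF dBi] measurable_dB_past[of a c b i]
      by (intro past_dB) auto
    moreover have "max 0 (min b d - max a c) = 0" using bc by auto
    ultimately show ?thesis
      unfolding same_mean_def by (intro exI[of _ 0]) (simp add: algebra_simps has_bochner_integral_zero)
  next
    case cb: False
    have dBi: "integrable M (dB i a c)"
      using dB_first_moment[of a c i] bnd True ac cb by (auto simp: has_bochner_integral_iff)
    have left: "has_bochner_integral M (\<lambda>\<omega>. (\<xi> \<omega> * (\<eta> \<omega> * dB i a c \<omega>)) * dB i c d \<omega>) 0"
      using bnd True cb ac prod_int[OF dBi] measurable_dB_past[of a c c i]
      by (intro past_dB) auto
    have right: "has_bochner_integral M (\<lambda>\<omega>. (\<xi> \<omega> * \<eta> \<omega>) * (dB i c b \<omega> * dB i c d \<omega>))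
        (expectation (\<lambda>\<omega>. \<xi> \<omega> * \<eta> \<omega>) * (min b d - c))"
    proof (cases "b \<le> d")
      case bd: True
      show ?thesis
        using past_dB_dB_nested[of c c b d "\<lambda>\<omega>. \<xi> \<omega> * \<eta> \<omega>" i i] bd cb bnd int1 by simp
    next
      case bd: False
      show ?thesis
        using past_dB_dB_nested[of c c d b "\<lambda>\<omega>. \<xi> \<omega> * \<eta> \<omega>" i i] bd cb bnd int1 True
        by (simp add: mult.commute[of "dB i c d _"])
    qed
    have "has_bochner_integral M (\<lambda>\<omega>. \<xi> \<omega> * \<eta> \<omega> * max 0 (min b d - max a c))
        (expectation (\<lambda>\<omega>. \<xi> \<omega> * \<eta> \<omega>) * (min b d - c))"
      using int1 cb True ac by (auto simp: has_bochner_integral_iff max_def)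
    moreover have "(\<lambda>\<omega>. (\<xi> \<omega> * dB i a b \<omega>) * (\<eta> \<omega> * dB i c d \<omega>)) =
        (\<lambda>\<omega>. (\<xi> \<omega> * (\<eta> \<omega> * dB i a c \<omega>)) * dB i c d \<omega> + (\<xi> \<omega> * \<eta> \<omega>) * (dB i c b \<omega> * dB i c d \<omega>))"
      by (simp add: fun_eq_iff algebra_simps)
    ultimately show ?thesis
      using has_bochner_integral_add[OF left right] unfolding same_mean_def by auto
  qed
qed

lemma elem_isometry:
  assumes "elem_ok (a, b, \<xi>)" "elem_ok (c, d, \<eta>)"
  shows "same_mean (\<lambda>\<omega>. (\<xi> \<omega> * dB i a b \<omega>) * (\<eta> \<omega> * dB i c d \<omega>))
    (\<lambda>\<omega>. \<xi> \<omega> * \<eta> \<omega> * max 0 (min b d - max a c))"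
proof (cases "a \<le> c")
  case False
  then show ?thesis
    using elem_isometry_ordered[OF assms(2,1), of i]
    by (simp add: mult.commute min.commute max.commute)
qed (use elem_isometry_ordered assms in auto)

text \<open>For fixed \<omega> this is the inner product in \<open>L^2(du)\<close> of the two step
  functions as a finite sum. It links the two sides of the isometry, having the same mean as the
  product of the step integrals.\<close>

definition overlap :: "'w step_data \<Rightarrow> 'w step_data \<Rightarrow> 'w \<Rightarrow> real" where
  "overlap L K \<omega> = (\<Sum>(a, b, \<xi>)\<leftarrow>L. \<Sum>(c, d, \<eta>)\<leftarrow>K. \<xi> \<omega> * \<eta> \<omega> * max 0 (min b d - max a c))"

lemma has_bochner_integral_overlap:
  "has_bochner_integral lborel (\<lambda>u. step L u \<omega> * step K u \<omega>) (overlap L K \<omega>)"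
proof (induction L)
  case (Cons x L)
  obtain a b \<xi> where x: "x = (a, b, \<xi>)" by (cases x)
  have "has_bochner_integral lborel (\<lambda>u. \<xi> \<omega> * indicator {a<..b} u * step K u \<omega>)
      (\<Sum>(c, d, \<eta>)\<leftarrow>K. \<xi> \<omega> * \<eta> \<omega> * max 0 (min b d - max a c))"
  proof (induction K)
    case (Cons y K)
    obtain c d \<eta> where y: "y = (c, d, \<eta>)" by (cases y)
    from has_bochner_integral_mult_right[OF has_bochner_integral_indicator_Ioc_Ioc, of "\<xi> \<omega> * \<eta> \<omega>"]
    have "has_bochner_integral lborel
      (\<lambda>u. \<xi> \<omega> * \<eta> \<omega> * (indicator {a<..b} u * indicator {c<..d} u)) (\<xi> \<omega> * \<eta> \<omega> * max 0 (min b d - max a c))"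
      by simp
    from has_bochner_integral_add[OF this Cons] show ?case
      by (simp add: y step_Cons algebra_simps)
  qed (simp add: has_bochner_integral_zero)
  from has_bochner_integral_add[OF this Cons] show ?case
    by (simp add: x step_Cons overlap_def algebra_simps)
qed (simp add: has_bochner_integral_zero overlap_def)

lemma step_int_overlap:
  assumes "list_all elem_ok L" "list_all elem_ok K"
  shows "same_mean (\<lambda>\<omega>. step_int i L \<omega> * step_int i K \<omega>) (overlap L K)"
  using assms(1)
proof (induction L)
  case Nil
  then show ?case by (simp add: overlap_def[abs_def] same_mean_zero)
next
  case (Cons x L)
  obtain a b \<xi> where x: "x = (a, b, \<xi>)" by (cases x)
  with Cons have ok: "elem_ok (a, b, \<xi>)" by simp
  have "same_mean (\<lambda>\<omega>. \<xi> \<omega> * dB i a b \<omega> * step_int i K \<omega>)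
      (\<lambda>\<omega>. \<Sum>(c, d, \<eta>)\<leftarrow>K. \<xi> \<omega> * \<eta> \<omega> * max 0 (min b d - max a c))"
    using assms(2)
  proof (induction K)
    case (Cons y K)
    obtain c d \<eta> where y: "y = (c, d, \<eta>)" by (cases y)
    from Cons y have "elem_ok (c, d, \<eta>)" by simp
    from same_mean_add[OF elem_isometry[OF ok this, of i]] Cons show ?case
      by (simp add: y step_int_Cons distrib_left)
  qed (simp add: same_mean_zero)
  from same_mean_add[OF this] Cons show ?case
    by (simp add: x step_int_Cons overlap_def[abs_def] distrib_right)
qed

text \<open>The squared norm in \<open>L^2(du \<otimes> P)\<close> over the whole line, with values
  in \<open>ennreal\<close> so that inequalities need no integrability.\<close>

definition sqnorm :: "(real \<Rightarrow> 'w \<Rightarrow> real) \<Rightarrow> ennreal" where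
  "sqnorm F = (\<integral>\<^sup>+\<omega>. \<integral>\<^sup>+u. ennreal ((F u \<omega>)\<^sup>2) \<partial>lborel \<partial>M)"

lemma step_int_isometry:
  assumes "list_all elem_ok L"
  shows "(\<integral>\<^sup>+\<omega>. ennreal ((step_int i L \<omega>)\<^sup>2) \<partial>M) = sqnorm (step L)"
proof -
  obtain m where m: "has_bochner_integral M (\<lambda>\<omega>. (step_int i L \<omega>)\<^sup>2) m"
      "has_bochner_integral M (overlap L L) m"
    using step_int_overlap[OF assms assms, of i] by (auto simp: same_mean_def power2_eq_square)
  have inner: "(\<integral>\<^sup>+u. ennreal ((step L u \<omega>)\<^sup>2) \<partial>lborel) = ennreal (overlap L L \<omega>)"
    and pos: "0 \<le> overlap L L \<omega>" for \<omega>
  proof -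
    note * = has_bochner_integral_overlap[of L \<omega> L, folded power2_eq_square]
    show "(\<integral>\<^sup>+u. ennreal ((step L u \<omega>)\<^sup>2) \<partial>lborel) = ennreal (overlap L L \<omega>)"
      using * by (subst nn_integral_eq_integral) (auto simp: has_bochner_integral_iff)
    show "0 \<le> overlap L L \<omega>"
      unfolding has_bochner_integral_integral_eq[OF *, symmetric]
      by (intro Bochner_Integration.integral_nonneg) simp
  qed
  have "(\<integral>\<^sup>+\<omega>. ennreal ((step_int i L \<omega>)\<^sup>2) \<partial>M) = ennreal m"
    using m by (subst nn_integral_eq_integral) (auto simp: has_bochner_integral_iff)
  moreover have "sqnorm (step L) = ennreal m"
    unfolding sqnorm_def inner using m pos
    by (subst nn_integral_eq_integral) (auto simp: has_bochner_integral_iff)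
  ultimately show ?thesis by simp
qed

end

section \<open>The Ito integral\<close>

lemma ennreal_sq_add: "ennreal ((x + y)\<^sup>2) \<le> 2 * ennreal (x\<^sup>2) + 2 * ennreal (y\<^sup>2)"
proof -
  have "(x + y)\<^sup>2 \<le> 2 * x\<^sup>2 + 2 * y\<^sup>2"
    using sum_squares_bound[of x y] by (simp add: power2_sum)
  then have "ennreal ((x + y)\<^sup>2) \<le> ennreal (2 * x\<^sup>2 + 2 * y\<^sup>2)" by (rule ennreal_leI)
  also have "\<dots> = 2 * ennreal (x\<^sup>2) + 2 * ennreal (y\<^sup>2)"
    by (simp add: ennreal_mult' ennreal_plus)
  finally show ?thesis .
qed

section \<open>Jointly measurable integrands and the extension by the isometry\<close>

context brownian
begin

definition joint :: "(real \<Rightarrow> 'w \<Rightarrow> real) \<Rightarrow> bool" where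
  "joint F \<longleftrightarrow> (\<lambda>(u, \<omega>). F u \<omega>) \<in> borel_measurable (borel \<Otimes>\<^sub>M M)"

lemma joint_swap: "joint F \<Longrightarrow> (\<lambda>(\<omega>, u). F u \<omega>) \<in> borel_measurable (M \<Otimes>\<^sub>M lborel)"
proof -
  assume "joint F"
  then have "(\<lambda>x. (\<lambda>(u, \<omega>). F u \<omega>) (snd x, fst x)) \<in> borel_measurable (M \<Otimes>\<^sub>M lborel)"
    unfolding joint_def by (rule measurable_compose[rotated]) measurable
  then show ?thesis by (simp add: case_prod_beta')
qed

lemma joint_slice: "joint F \<Longrightarrow> \<omega> \<in> space M \<Longrightarrow> (\<lambda>u. F u \<omega>) \<in> borel_measurable borel"
  unfolding joint_def by (drule measurable_compose[rotated, of _ _ _ "\<lambda>u. (u, \<omega>)" borel]) auto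

lemma joint_add: "joint F \<Longrightarrow> joint G \<Longrightarrow> joint (\<lambda>u \<omega>. F u \<omega> + G u \<omega>)"
  and joint_diff: "joint F \<Longrightarrow> joint G \<Longrightarrow> joint (\<lambda>u \<omega>. F u \<omega> - G u \<omega>)"
  and joint_cmult: "joint F \<Longrightarrow> joint (\<lambda>u \<omega>. c * F u \<omega>)"
  by (simp_all add: joint_def case_prod_beta')

lemma joint_indicator:
  "joint F \<Longrightarrow> joint (\<lambda>u \<omega>. indicator {p<..q} u * F u \<omega>)"
  unfolding joint_def case_prod_beta' by measurable

lemma joint_step: "list_all elem_ok L \<Longrightarrow> joint (step L)"
proof (induction L)
  case (Cons x L)
  obtain a b \<xi> where x: "x = (a, b, \<xi>)" by (cases x)
  with Cons have [measurable]: "\<xi> \<in> borel_measurable M" by (simp add: elem_ok_def)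
  have "joint (\<lambda>u \<omega>. \<xi> \<omega> * indicator {a<..b} u)"
    unfolding joint_def case_prod_beta' by measurable
  then have "joint (\<lambda>u \<omega>. \<xi> \<omega> * indicator {a<..b} u + step L u \<omega>)"
    using Cons by (intro joint_add) auto
  then show ?case by (simp add: x step_Cons[abs_def])
qed (simp add: joint_def)

lemma measurable_inner:
  assumes "joint F"
  shows "(\<lambda>\<omega>. \<integral>\<^sup>+u. ennreal ((F u \<omega>)\<^sup>2) \<partial>lborel) \<in> borel_measurable M"
proof -
  note [measurable] = joint_swap[OF assms]
  show ?thesis by measurable
qed

lemma sqnorm_mono: "(\<And>u \<omega>. \<bar>F u \<omega>\<bar> \<le> \<bar>G u \<omega>\<bar>) \<Longrightarrow> sqnorm F \<le> sqnorm G"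
  unfolding sqnorm_def by (intro nn_integral_mono ennreal_leI) (simp add: abs_le_square_iff)

lemma sqnorm_add:
  assumes "joint F" "joint G"
  shows "sqnorm (\<lambda>u \<omega>. F u \<omega> + G u \<omega>) \<le> 2 * sqnorm F + 2 * sqnorm G"
proof -
  let ?f = "\<lambda>F \<omega>. \<integral>\<^sup>+u. ennreal ((F u \<omega>)\<^sup>2) \<partial>lborel"
  note [measurable] = measurable_inner[OF assms(1)] measurable_inner[OF assms(2)]
  have "sqnorm (\<lambda>u \<omega>. F u \<omega> + G u \<omega>) \<le> (\<integral>\<^sup>+\<omega>. 2 * ?f F \<omega> + 2 * ?f G \<omega> \<partial>M)"
    unfolding sqnorm_def
  proof (rule nn_integral_mono)
    fix \<omega> assume "\<omega> \<in> space M"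
    then have [measurable]: "(\<lambda>u. F u \<omega>) \<in> borel_measurable borel" "(\<lambda>u. G u \<omega>) \<in> borel_measurable borel"
      using joint_slice assms by auto
    have "?f (\<lambda>u \<omega>. F u \<omega> + G u \<omega>) \<omega> \<le>
        (\<integral>\<^sup>+u. 2 * ennreal ((F u \<omega>)\<^sup>2) + 2 * ennreal ((G u \<omega>)\<^sup>2) \<partial>lborel)"
      by (intro nn_integral_mono ennreal_sq_add)
    also have "\<dots> = 2 * ?f F \<omega> + 2 * ?f G \<omega>"
      by (simp add: nn_integral_add nn_integral_cmult)
    finally show "?f (\<lambda>u \<omega>. F u \<omega> + G u \<omega>) \<omega> \<le> 2 * ?f F \<omega> + 2 * ?f G \<omega>" .
  qed
  also have "\<dots> = 2 * sqnorm F + 2 * sqnorm G"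
    by (simp add: nn_integral_add nn_integral_cmult sqnorm_def)
  finally show ?thesis .
qed

lemma sqnorm_cmult:
  assumes "joint F"
  shows "sqnorm (\<lambda>u \<omega>. c * F u \<omega>) = ennreal (c\<^sup>2) * sqnorm F"
proof -
  note [measurable] = measurable_inner[OF assms]
  have "(\<integral>\<^sup>+u. ennreal ((c * F u \<omega>)\<^sup>2) \<partial>lborel) = ennreal (c\<^sup>2) * (\<integral>\<^sup>+u. ennreal ((F u \<omega>)\<^sup>2) \<partial>lborel)"
    if "\<omega> \<in> space M" for \<omega>
    using joint_slice[OF assms that]
    by (subst nn_integral_cmult[symmetric]) (auto simp: power_mult_distrib ennreal_mult')
  then show ?thesis
    unfolding sqnorm_def by (subst nn_integral_cmult[symmetric]) (auto intro!: nn_integral_cong)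
qed

text \<open>
  Integrands live on the whole line, so that integrals over different intervals can be subtracted.
\<close>

definition ito :: "'d \<Rightarrow> (real \<Rightarrow> 'w \<Rightarrow> real) \<Rightarrow> ('w \<Rightarrow> real) \<Rightarrow> bool" where
  "ito i F X \<longleftrightarrow> joint F \<and> X \<in> borel_measurable M \<and>
     (\<exists>L. (\<forall>m. list_all elem_ok (L m)) \<and>
        ((\<lambda>m. sqnorm (\<lambda>u \<omega>. F u \<omega> - step (L m) u \<omega>)) \<longlonglongrightarrow> 0) \<and>
        ((\<lambda>m. \<integral>\<^sup>+\<omega>. ennreal ((X \<omega> - step_int i (L m) \<omega>)\<^sup>2) \<partial>M) \<longlonglongrightarrow> 0))"

lemma ito_step: "list_all elem_ok L \<Longrightarrow> ito i (step L) (step_int i L)"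
  unfolding ito_def using joint_step measurable_step_int
  by (auto intro!: exI[of _ "\<lambda>_. L"] simp: sqnorm_def)

lemma ito_zero: "ito i (\<lambda>_ _. 0) (\<lambda>_. 0)"
  using ito_step[of "[]" i] by (simp add: step_def[abs_def] step_int_def[abs_def])

lemma ito_measurable: "ito i F X \<Longrightarrow> X \<in> borel_measurable M" and ito_joint: "ito i F X \<Longrightarrow> joint F"
  by (simp_all add: ito_def)

lemma nn_sq_add:
  assumes [measurable]: "X \<in> borel_measurable M" "Y \<in> borel_measurable M"
  shows "(\<integral>\<^sup>+\<omega>. ennreal ((X \<omega> + Y \<omega>)\<^sup>2) \<partial>M) \<le>
    2 * (\<integral>\<^sup>+\<omega>. ennreal ((X \<omega>)\<^sup>2) \<partial>M) + 2 * (\<integral>\<^sup>+\<omega>. ennreal ((Y \<omega>)\<^sup>2) \<partial>M)"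
proof -
  have "(\<integral>\<^sup>+\<omega>. ennreal ((X \<omega> + Y \<omega>)\<^sup>2) \<partial>M) \<le> (\<integral>\<^sup>+\<omega>. 2 * ennreal ((X \<omega>)\<^sup>2) + 2 * ennreal ((Y \<omega>)\<^sup>2) \<partial>M)"
    by (intro nn_integral_mono ennreal_sq_add)
  then show ?thesis by (simp add: nn_integral_add nn_integral_cmult)
qed

text \<open>A combination with one scalar covers sums, differences and multiples at once. The
  approximating steps are scaled and concatenated, and the factor 2 of the quadratic inequality is
  harmless in the limit.\<close>

lemma ito_add_cmult:
  assumes F: "ito i F X" and G: "ito i G Y"
  shows "ito i (\<lambda>u \<omega>. c * F u \<omega> + G u \<omega>) (\<lambda>\<omega>. c * X \<omega> + Y \<omega>)"
proof -
  have jF: "joint F" and jG: "joint G" and [measurable]: "X \<in> borel_measurable M" "Y \<in> borel_measurable M"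
    using F G by (auto simp: ito_def)
  from F obtain L where L: "\<And>m. list_all elem_ok (L m)"
      "(\<lambda>m. sqnorm (\<lambda>u \<omega>. F u \<omega> - step (L m) u \<omega>)) \<longlonglongrightarrow> 0"
      "(\<lambda>m. \<integral>\<^sup>+\<omega>. ennreal ((X \<omega> - step_int i (L m) \<omega>)\<^sup>2) \<partial>M) \<longlonglongrightarrow> 0"
    by (auto simp: ito_def)
  from G obtain K where K: "\<And>m. list_all elem_ok (K m)"
      "(\<lambda>m. sqnorm (\<lambda>u \<omega>. G u \<omega> - step (K m) u \<omega>)) \<longlonglongrightarrow> 0"
      "(\<lambda>m. \<integral>\<^sup>+\<omega>. ennreal ((Y \<omega> - step_int i (K m) \<omega>)\<^sup>2) \<partial>M) \<longlonglongrightarrow> 0"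
    by (auto simp: ito_def)
  note [measurable] = measurable_step_int[OF L(1)] measurable_step_int[OF K(1)]
  define N where "N m = scale_step c (L m) @ K m" for m
  have ok: "list_all elem_ok (N m)" for m
    using L(1) K(1) by (simp add: N_def elem_ok_scale)
  have to0: "(\<lambda>m. 2 * (ennreal (c\<^sup>2) * f m) + 2 * g m) \<longlonglongrightarrow> 0" if "f \<longlonglongrightarrow> 0" "g \<longlonglongrightarrow> 0"
    for f g :: "nat \<Rightarrow> ennreal"
  proof -
    have "(\<lambda>m. 2 * (ennreal (c\<^sup>2) * f m) + 2 * g m) \<longlonglongrightarrow> 2 * (ennreal (c\<^sup>2) * 0) + 2 * 0"
      by (intro tendsto_add ennreal_tendsto_cmult that) auto
    then show ?thesis by simp
  qed
  have 1: "sqnorm (\<lambda>u \<omega>. c * F u \<omega> + G u \<omega> - step (N m) u \<omega>) \<le>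
      2 * (ennreal (c\<^sup>2) * sqnorm (\<lambda>u \<omega>. F u \<omega> - step (L m) u \<omega>)) + 2 * sqnorm (\<lambda>u \<omega>. G u \<omega> - step (K m) u \<omega>)" for m
  proof -
    have "(\<lambda>u \<omega>. c * F u \<omega> + G u \<omega> - step (N m) u \<omega>) =
        (\<lambda>u \<omega>. c * (F u \<omega> - step (L m) u \<omega>) + (G u \<omega> - step (K m) u \<omega>))"
      by (simp add: N_def step_append step_scale algebra_simps)
    moreover have "joint (\<lambda>u \<omega>. F u \<omega> - step (L m) u \<omega>)" "joint (\<lambda>u \<omega>. G u \<omega> - step (K m) u \<omega>)"
      using jF jG joint_step L(1) K(1) by (auto intro: joint_diff)
    ultimately show ?thesis
      using sqnorm_add[OF joint_cmult, of "\<lambda>u \<omega>. F u \<omega> - step (L m) u \<omega>" "\<lambda>u \<omega>. G u \<omega> - step (K m) u \<omega>" c]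
      by (simp add: sqnorm_cmult)
  qed
  have 2: "(\<integral>\<^sup>+\<omega>. ennreal ((c * X \<omega> + Y \<omega> - step_int i (N m) \<omega>)\<^sup>2) \<partial>M) \<le>
      2 * (ennreal (c\<^sup>2) * (\<integral>\<^sup>+\<omega>. ennreal ((X \<omega> - step_int i (L m) \<omega>)\<^sup>2) \<partial>M)) +
      2 * (\<integral>\<^sup>+\<omega>. ennreal ((Y \<omega> - step_int i (K m) \<omega>)\<^sup>2) \<partial>M)" for m
  proof -
    have "(\<integral>\<^sup>+\<omega>. ennreal ((c * X \<omega> + Y \<omega> - step_int i (N m) \<omega>)\<^sup>2) \<partial>M) =
      (\<integral>\<^sup>+\<omega>. ennreal ((c * (X \<omega> - step_int i (L m) \<omega>) + (Y \<omega> - step_int i (K m) \<omega>))\<^sup>2) \<partial>M)"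
      by (simp add: N_def step_int_append step_int_scale algebra_simps)
    also have "\<dots> \<le> 2 * (\<integral>\<^sup>+\<omega>. ennreal ((c * (X \<omega> - step_int i (L m) \<omega>))\<^sup>2) \<partial>M) +
      2 * (\<integral>\<^sup>+\<omega>. ennreal ((Y \<omega> - step_int i (K m) \<omega>)\<^sup>2) \<partial>M)"
      by (rule nn_sq_add) measurable
    finally show ?thesis
      by (simp add: power_mult_distrib ennreal_mult' nn_integral_cmult)
  qed
  have "(\<lambda>m. sqnorm (\<lambda>u \<omega>. c * F u \<omega> + G u \<omega> - step (N m) u \<omega>)) \<longlonglongrightarrow> 0"
    by (rule tendsto_sandwich[OF _ _ tendsto_const to0[OF L(2) K(2)]]) (use 1 in auto)
  moreover have "(\<lambda>m. \<integral>\<^sup>+\<omega>. ennreal ((c * X \<omega> + Y \<omega> - step_int i (N m) \<omega>)\<^sup>2) \<partial>M) \<longlonglongrightarrow> 0"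
    by (rule tendsto_sandwich[OF _ _ tendsto_const to0[OF L(3) K(3)]]) (use 2 in auto)
  ultimately show ?thesis
    unfolding ito_def using ok jF jG by (auto intro!: joint_add joint_cmult)
qed

lemma ito_diff: "ito i F X \<Longrightarrow> ito i G Y \<Longrightarrow> ito i (\<lambda>u \<omega>. F u \<omega> - G u \<omega>) (\<lambda>\<omega>. X \<omega> - Y \<omega>)"
  using ito_add_cmult[of i G Y F X "-1"] by simp

lemma ito_sum:
  "finite A \<Longrightarrow> (\<And>k. k \<in> A \<Longrightarrow> ito i (F k) (X k)) \<Longrightarrow>
    ito i (\<lambda>u \<omega>. \<Sum>k\<in>A. c k * F k u \<omega>) (\<lambda>\<omega>. \<Sum>k\<in>A. c k * X k \<omega>)"
  by (induction A rule: finite_induct) (simp_all add: ito_zero ito_add_cmult)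

text \<open>The constant 4 instead of the sharp 1 spares the triangle inequality in \<open>L\<^sup>2\<close>.\<close>

lemma ito_bound:
  assumes "ito i F X"
  shows "(\<integral>\<^sup>+\<omega>. ennreal ((X \<omega>)\<^sup>2) \<partial>M) \<le> 4 * sqnorm F"
proof -
  have jF: "joint F" and [measurable]: "X \<in> borel_measurable M"
    using assms by (auto simp: ito_def)
  from assms obtain L where L: "\<And>m. list_all elem_ok (L m)"
      "(\<lambda>m. sqnorm (\<lambda>u \<omega>. F u \<omega> - step (L m) u \<omega>)) \<longlonglongrightarrow> 0"
      "(\<lambda>m. \<integral>\<^sup>+\<omega>. ennreal ((X \<omega> - step_int i (L m) \<omega>)\<^sup>2) \<partial>M) \<longlonglongrightarrow> 0"
    by (auto simp: ito_def)
  note [measurable] = measurable_step_int[OF L(1)]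
  let ?e = "\<lambda>m. sqnorm (\<lambda>u \<omega>. F u \<omega> - step (L m) u \<omega>)"
  let ?d = "\<lambda>m. \<integral>\<^sup>+\<omega>. ennreal ((X \<omega> - step_int i (L m) \<omega>)\<^sup>2) \<partial>M"
  have "(\<integral>\<^sup>+\<omega>. ennreal ((X \<omega>)\<^sup>2) \<partial>M) \<le> 2 * ?d m + 2 * (2 * ?e m + 2 * sqnorm F)" for m
  proof -
    have "(\<integral>\<^sup>+\<omega>. ennreal ((X \<omega>)\<^sup>2) \<partial>M) \<le> 2 * ?d m + 2 * (\<integral>\<^sup>+\<omega>. ennreal ((step_int i (L m) \<omega>)\<^sup>2) \<partial>M)"
      using nn_sq_add[of "\<lambda>\<omega>. X \<omega> - step_int i (L m) \<omega>" "step_int i (L m)"] by simp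
    also have "(\<integral>\<^sup>+\<omega>. ennreal ((step_int i (L m) \<omega>)\<^sup>2) \<partial>M) = sqnorm (\<lambda>u \<omega>. -1 * (F u \<omega> - step (L m) u \<omega>) + F u \<omega>)"
      by (simp add: step_int_isometry L(1))
    also have "\<dots> \<le> 2 * ?e m + 2 * sqnorm F"
      using sqnorm_add[OF joint_cmult jF, of "\<lambda>u \<omega>. F u \<omega> - step (L m) u \<omega>" "-1"]
        sqnorm_cmult[of "\<lambda>u \<omega>. F u \<omega> - step (L m) u \<omega>" "-1"] joint_diff[OF jF joint_step[OF L(1)]]
      by simp
    finally show ?thesis by (simp add: mult_left_mono)
  qed
  moreover have "(\<lambda>m. 2 * ?d m + 2 * (2 * ?e m + 2 * sqnorm F)) \<longlonglongrightarrow> 2 * 0 + 2 * (2 * 0 + 2 * sqnorm F)"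
    by (intro tendsto_add ennreal_tendsto_cmult L tendsto_const) auto
  ultimately have "(\<integral>\<^sup>+\<omega>. ennreal ((X \<omega>)\<^sup>2) \<partial>M) \<le> 2 * 0 + 2 * (2 * 0 + 2 * sqnorm F)"
    by (intro LIMSEQ_le_const) auto
  also have "\<dots> = 4 * sqnorm F"
    by (simp add: mult.assoc[symmetric])
  finally show ?thesis .
qed

text \<open>Applied to a difference of two integrals, this gives their almost sure equality as soon
  as the integrands agree almost everywhere.\<close>

lemma ito_zero_AE:
  assumes "ito i F X" "sqnorm F = 0"
  shows "AE \<omega> in M. X \<omega> = 0"
proof -
  have [measurable]: "X \<in> borel_measurable M" using assms by (simp add: ito_def)
  have "(\<integral>\<^sup>+\<omega>. ennreal ((X \<omega>)\<^sup>2) \<partial>M) = 0" using ito_bound[OF assms(1)] assms(2) by simp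
  then have "AE \<omega> in M. ennreal ((X \<omega>)\<^sup>2) = 0" by (subst (asm) nn_integral_0_iff_AE) auto
  then show ?thesis by eventually_elim (simp add: ennreal_eq_0_iff)
qed

text \<open>\<open>H\<close> is jointly measurable only for times in \<open>[s,t]\<close>. Composing
  with the projection \<open>clip s t\<close> extends it to all times, and the indicator then
  removes the added values.\<close>

lemma joint_extend:
  assumes "s \<le> t" "(\<lambda>(u, \<omega>). H u \<omega>) \<in> borel_measurable (restrict_space borel {s..t} \<Otimes>\<^sub>M M)"
  shows "joint (\<lambda>u \<omega>. indicator {s<..t} u * H u \<omega>)"
proof -
  have "clip s t \<in> borel_measurable borel" unfolding clip_def[abs_def] by measurable
  then have [measurable]: "clip s t \<in> measurable borel (restrict_space borel {s..t})"
    using assms(1) by (intro measurable_restrict_space2) (auto simp: clip_def)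
  have "(\<lambda>x. (\<lambda>(u, \<omega>). H u \<omega>) (clip s t (fst x), snd x)) \<in> borel_measurable (borel \<Otimes>\<^sub>M M)"
    by (rule measurable_compose[OF _ assms(2)]) measurable
  then have "joint (\<lambda>u \<omega>. H (clip s t u) \<omega>)" by (simp add: joint_def case_prod_beta')
  then have "joint (\<lambda>u \<omega>. indicator {s<..t} u * H (clip s t u) \<omega>)" by (rule joint_indicator)
  also have "(\<lambda>u \<omega>. indicator {s<..t} u * H (clip s t u) \<omega>) = (\<lambda>u \<omega>. indicator {s<..t} u * H u \<omega>)"
  proof (intro ext)
    fix u \<omega> show "indicator {s<..t} u * H (clip s t u) \<omega> = indicator {s<..t} u * H u \<omega>"
      by (cases "u \<in> {s<..t}") (simp_all add: clip_def)
  qed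
  finally show ?thesis .
qed

lemma ito_of_has_ito_integral:
  assumes st: "0 \<le> s" "s \<le> t" "t \<le> T" and has: "has_ito_integral M B i s t H X"
  shows "ito i (\<lambda>u \<omega>. indicator {s<..t} u * H u \<omega>) X"
proof -
  from has obtain n r \<xi> where si: "\<And>m. simple_integrand M B s t (n m) (r m) (\<xi> m)"
    and 1: "(\<lambda>m. \<integral>\<^sup>+ \<omega>. (\<integral>\<^sup>+ u\<in>{s..t}.
            ennreal ((H u \<omega> - simple_value (n m) (r m) (\<xi> m) u \<omega>)\<^sup>2) \<partial>lborel) \<partial>M) \<longlonglongrightarrow> 0"
    and 2: "(\<lambda>m. \<integral>\<^sup>+ \<omega>. ennreal
            ((X \<omega> - simple_integral (\<lambda>u \<omega>. B u \<omega> $ i) (n m) (r m) (\<xi> m) \<omega>)\<^sup>2) \<partial>M) \<longlonglongrightarrow> 0"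
    by (auto simp: has_ito_integral_def)
  define L where "L m = map (\<lambda>k. (r m k, r m (Suc k), \<xi> m k)) [0..<n m]" for m
  have ok: "list_all elem_ok (L m)" for m
  proof -
    have part: "is_partition s t (n m) (r m)" using si[of m] by (simp add: simple_integrand_def)
    have "elem_ok (r m k, r m (Suc k), \<xi> m k)" if "k < n m" for k
    proof -
      have \<xi>: "\<xi> m k \<in> borel_measurable (past M B (r m k))" "\<exists>C. \<forall>\<omega>\<in>space M. \<bar>\<xi> m k \<omega>\<bar> \<le> C"
        using si[of m] that by (auto simp: simple_integrand_def)
      have "s \<le> r m k" "r m k \<le> r m (Suc k)" "r m (Suc k) \<le> t"
        using is_partition_bounds[OF part, of k] is_partition_bounds[OF part, of "Suc k"]
          is_partition_mono[OF part, of k "Suc k"] that by auto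
      then have "0 \<le> r m k" "r m k \<le> r m (Suc k)" "r m (Suc k) \<le> T" "r m k \<le> T"
        using st by linarith+
      then show ?thesis
        using measurable_past_M[OF \<xi>(1)] \<xi> by (simp add: elem_ok_def)
    qed
    then show ?thesis by (auto simp: L_def list_all_iff)
  qed
  have step: "step (L m) u \<omega> = simple_value (n m) (r m) (\<xi> m) u \<omega>" for m u \<omega>
    by (simp add: step_def L_def simple_value_def o_def interv_sum_list_conv_sum_set_nat atLeast0LessThan)
  have int: "step_int i (L m) \<omega> = simple_integral (\<lambda>u \<omega>. B u \<omega> $ i) (n m) (r m) (\<xi> m) \<omega>" for m \<omega>
    by (simp add: step_int_def L_def simple_integral_def o_def interv_sum_list_conv_sum_set_nat atLeast0LessThan)
  have out: "simple_value (n m) (r m) (\<xi> m) u \<omega> = 0" if "u \<notin> {s<..t}" for m u \<omega>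
    unfolding simple_value_def
  proof (rule sum.neutral, rule ballI)
    fix k assume k: "k \<in> {..<n m}"
    have part: "is_partition s t (n m) (r m)" using si[of m] by (simp add: simple_integrand_def)
    have "u \<notin> {r m k<..r m (Suc k)}"
      using is_partition_bounds[OF part, of k] is_partition_bounds[OF part, of "Suc k"] k that by auto
    then show "\<xi> m k \<omega> * indicator {r m k<..r m (Suc k)} u = 0" by simp
  qed
  \<comment> \<open>The pointwise bound holds also at \<open>u = s\<close>, where the cut-off
    integrand and the step value are both zero.\<close>
  have "sqnorm (\<lambda>u \<omega>. indicator {s<..t} u * H u \<omega> - step (L m) u \<omega>) \<le>
     (\<integral>\<^sup>+ \<omega>. (\<integral>\<^sup>+ u\<in>{s..t}. ennreal ((H u \<omega> - simple_value (n m) (r m) (\<xi> m) u \<omega>)\<^sup>2) \<partial>lborel) \<partial>M)" for m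
    unfolding sqnorm_def step
    by (intro nn_integral_mono) (auto simp: indicator_def out)
  then have "(\<lambda>m. sqnorm (\<lambda>u \<omega>. indicator {s<..t} u * H u \<omega> - step (L m) u \<omega>)) \<longlonglongrightarrow> 0"
    by (intro tendsto_sandwich[OF _ _ tendsto_const 1]) auto
  moreover have "joint (\<lambda>u \<omega>. indicator {s<..t} u * H u \<omega>)" "X \<in> borel_measurable M"
    using has st joint_extend by (auto simp: has_ito_integral_def)
  ultimately show ?thesis
    unfolding ito_def using ok 2 by (auto simp: int intro!: exI[of _ L])
qed

end

section \<open>Covariation of Ito integrals\<close>

text \<open>Stands in for the Cauchy-Schwarz inequality: if the squares of \<open>x\<close> have
  total mass of order \<open>e^2\<close> and those of \<open>y\<close> bounded mass, the weighted
  sum is of order \<open>e\<close>.\<close>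

lemma young_ennreal:
  assumes "0 < (e::real)"
  shows "ennreal \<bar>x * y\<bar> \<le> ennreal (1 / e) * ennreal (x\<^sup>2) + ennreal e * ennreal (y\<^sup>2)"
proof -
  have "2 * \<bar>x\<bar> * (e * \<bar>y\<bar>) \<le> x\<^sup>2 + (e * y)\<^sup>2"
    using sum_squares_bound[of "\<bar>x\<bar>" "e * \<bar>y\<bar>"] by (simp add: power_mult_distrib)
  moreover have "0 \<le> \<bar>x\<bar> * (e * \<bar>y\<bar>)" using assms by simp
  ultimately have "\<bar>x\<bar> * (e * \<bar>y\<bar>) \<le> x\<^sup>2 + (e * y)\<^sup>2" by linarith
  then have "\<bar>x * y\<bar> \<le> 1 / e * x\<^sup>2 + e * y\<^sup>2"
    using assms by (simp add: field_simps abs_mult power2_eq_square)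
  then have "ennreal \<bar>x * y\<bar> \<le> ennreal (1 / e * x\<^sup>2 + e * y\<^sup>2)" by (rule ennreal_leI)
  also have "\<dots> = ennreal (1 / e) * ennreal (x\<^sup>2) + ennreal e * ennreal (y\<^sup>2)"
    using assms by (simp only: ennreal_plus ennreal_mult[symmetric] zero_le_power2
        mult_nonneg_nonneg less_imp_le zero_less_divide_1_iff)
  finally show ?thesis .
qed

lemma ennreal_tendsto_0I:
  fixes f :: "'a \<Rightarrow> ennreal"
  assumes "\<And>e. 0 < e \<Longrightarrow> eventually (\<lambda>n. f n \<le> ennreal e) F"
  shows "(f \<longlongrightarrow> 0) F"
proof (rule order_tendstoI)
  fix a :: ennreal assume "0 < a"
  then obtain y where y: "0 < y" "y < a" using dense by blast
  then have "y \<noteq> top" by auto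
  then obtain e where e: "0 \<le> e" "y = ennreal e" by (cases y) auto
  with y have "0 < e" by auto
  from assms[OF this] show "eventually (\<lambda>n. f n < a) F"
    by eventually_elim (use y e in auto)
qed auto

lemma ennreal_tendsto_0D:
  fixes f :: "'a \<Rightarrow> ennreal"
  assumes "(f \<longlongrightarrow> 0) F" "0 < e"
  shows "eventually (\<lambda>n. f n \<le> ennreal e) F"
  using order_tendstoD(2)[OF assms(1), of "ennreal e"] assms(2)
  by (auto elim: eventually_mono)

text \<open>The uniform partition into \<open>Suc n\<close> pieces; the successor keeps the mesh
  meaningful at \<open>n = 0\<close>.\<close>

definition upart :: "real \<Rightarrow> real \<Rightarrow> nat \<Rightarrow> nat \<Rightarrow> real" where
  "upart s t n k = s + real k * ((t - s) / real (Suc n))"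

lemma upart_step: "upart s t n (Suc k) - upart s t n k = (t - s) / real (Suc n)"
proof -
  have "(s + real (Suc k) * c) - (s + real k * c) = c" for c
    by (simp add: algebra_simps)
  then show ?thesis unfolding upart_def .
qed

lemma is_partition_upart:
  assumes "s \<le> t"
  shows "is_partition s t (Suc n) (upart s t n)"
proof -
  have "upart s t n k \<le> upart s t n (Suc k)" for k
    using upart_step[of s t n k] assms divide_nonneg_nonneg[of "t - s" "real (Suc n)"] by linarith
  then show ?thesis by (simp add: is_partition_def) (simp add: upart_def)
qed

text \<open>For fixed \<open>a\<close> and \<open>b\<close> the length cut out of
  \<open>(a, b]\<close> by \<open>(p, q]\<close> is the increment of
  \<open>\<lambda>x. min x b - min x a\<close> from \<open>p\<close> to \<open>q\<close>, so these
  lengths telescope along a partition.\<close>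

lemma clip_length:
  "p \<le> q \<Longrightarrow> clip p q b - clip p q a = (min q b - min q a) - (min p b - min p a)"
  by (simp add: clip_def min_def max_def)

lemma sum_clip:
  assumes "is_partition s t n r" "s \<le> a" "a \<le> b" "b \<le> t"
  shows "(\<Sum>k<n. clip (r k) (r (Suc k)) b - clip (r k) (r (Suc k)) a) = b - a"
proof -
  have "(\<Sum>k<n. clip (r k) (r (Suc k)) b - clip (r k) (r (Suc k)) a) =
      (\<Sum>k<n. (min (r (Suc k)) b - min (r (Suc k)) a) - (min (r k) b - min (r k) a))"
    using assms(1) by (intro sum.cong refl clip_length) (auto simp: is_partition_def)
  also have "\<dots> = (min (r n) b - min (r n) a) - (min (r 0) b - min (r 0) a)"
    by (rule sum_lessThan_telescope)
  finally show ?thesis using assms by (simp add: is_partition_def)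
qed

lemma sum_indicator_partition:
  assumes "is_partition s t n r"
  shows "(\<Sum>k<n. indicator {r k<..r (Suc k)} u :: real) = indicator {s<..t} u"
proof -
  have "(\<Sum>k<m. indicator {r k<..r (Suc k)} u :: real) = indicator {r 0<..r m} u" if "m \<le> n" for m
    using that
  proof (induction m)
    case (Suc m)
    have "r 0 \<le> r m" "r m \<le> r (Suc m)"
      using is_partition_mono[OF assms] Suc by auto
    with Suc show ?case by (auto simp: indicator_def)
  qed simp
  from this[of n] assms show ?thesis by (simp add: is_partition_def)
qed

section \<open>Convergence in probability\<close>

context brownian
begin

text \<open>\<open>psize\<close> metrises convergence in probability.\<close>

definition psize :: "('w \<Rightarrow> real) \<Rightarrow> ennreal" where
  "psize X = (\<integral>\<^sup>+\<omega>. ennreal (min 1 \<bar>X \<omega>\<bar>) \<partial>M)"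

lemma psize_add:
  assumes [measurable]: "X \<in> borel_measurable M" "Y \<in> borel_measurable M"
  shows "psize (\<lambda>\<omega>. X \<omega> + Y \<omega>) \<le> psize X + psize Y"
proof -
  have "psize (\<lambda>\<omega>. X \<omega> + Y \<omega>) \<le> (\<integral>\<^sup>+\<omega>. ennreal (min 1 \<bar>X \<omega>\<bar>) + ennreal (min 1 \<bar>Y \<omega>\<bar>) \<partial>M)"
    unfolding psize_def
    by (intro nn_integral_mono) (auto simp: ennreal_plus[symmetric] simp del: ennreal_plus intro!: ennreal_leI)
  then show ?thesis by (simp add: nn_integral_add psize_def)
qed

lemma psize_cong_AE: "AE \<omega> in M. X \<omega> = Y \<omega> \<Longrightarrow> psize X = psize Y"
  unfolding psize_def by (intro nn_integral_cong_AE) auto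

lemma psize_le_L1: "psize X \<le> (\<integral>\<^sup>+\<omega>. ennreal \<bar>X \<omega>\<bar> \<partial>M)"
  unfolding psize_def by (intro nn_integral_mono ennreal_leI) auto

lemma psize_zero_AE:
  assumes [measurable]: "X \<in> borel_measurable M" and "psize X = 0"
  shows "AE \<omega> in M. X \<omega> = 0"
proof -
  have "AE \<omega> in M. ennreal (min 1 \<bar>X \<omega>\<bar>) = 0"
    using assms(2) unfolding psize_def by (subst (asm) nn_integral_0_iff_AE) auto
  then show ?thesis by eventually_elim (auto simp: ennreal_eq_0_iff min_def split: if_splits)
qed

text \<open>Truncation at 1 breaks homogeneity, hence the factor
  \<open>max 1 \<bar>c\<bar>\<close>.\<close>

lemma psize_cmult:
  assumes [measurable]: "X \<in> borel_measurable M"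
  shows "psize (\<lambda>\<omega>. c * X \<omega>) \<le> ennreal (max 1 \<bar>c\<bar>) * psize X"
proof -
  have "min 1 \<bar>c * x\<bar> \<le> max 1 \<bar>c\<bar> * min 1 \<bar>x\<bar>" for x
  proof (cases "\<bar>x\<bar> \<le> 1")
    case True
    have "\<bar>c * x\<bar> \<le> max 1 \<bar>c\<bar> * \<bar>x\<bar>" unfolding abs_mult by (rule mult_right_mono) auto
    with True show ?thesis by (simp add: min.coboundedI2)
  next
    case False
    moreover have "min 1 \<bar>c * x\<bar> \<le> 1" "1 \<le> max 1 \<bar>c\<bar>" by simp_all
    ultimately show ?thesis by (simp del: min_le_iff_disj)
  qed
  then have "psize (\<lambda>\<omega>. c * X \<omega>) \<le> (\<integral>\<^sup>+\<omega>. ennreal (max 1 \<bar>c\<bar>) * ennreal (min 1 \<bar>X \<omega>\<bar>) \<partial>M)"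
    unfolding psize_def by (intro nn_integral_mono) (auto simp: ennreal_mult[symmetric] intro!: ennreal_leI)
  then show ?thesis by (simp add: nn_integral_cmult psize_def)
qed

lemma psize_tendsto_add:
  assumes "\<And>n. X n \<in> borel_measurable M" "\<And>n. Y n \<in> borel_measurable M"
    and "(\<lambda>n. psize (X n)) \<longlonglongrightarrow> 0" "(\<lambda>n. psize (Y n)) \<longlonglongrightarrow> 0"
  shows "(\<lambda>n. psize (\<lambda>\<omega>. X n \<omega> + Y n \<omega>)) \<longlonglongrightarrow> 0"
proof (rule tendsto_sandwich[OF _ _ tendsto_const])
  show "(\<lambda>n. psize (X n) + psize (Y n)) \<longlonglongrightarrow> 0"
    using tendsto_add[OF assms(3,4)] by simp
qed (use psize_add assms in auto)

lemma psize_tendsto_cmult: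
  assumes "\<And>n. X n \<in> borel_measurable M" "(\<lambda>n. psize (X n)) \<longlonglongrightarrow> 0"
  shows "(\<lambda>n. psize (\<lambda>\<omega>. c * X n \<omega>)) \<longlonglongrightarrow> 0"
proof (rule tendsto_sandwich[OF _ _ tendsto_const])
  show "(\<lambda>n. ennreal (max 1 \<bar>c\<bar>) * psize (X n)) \<longlonglongrightarrow> 0"
    using ennreal_tendsto_cmult[OF _ assms(2), of "ennreal (max 1 \<bar>c\<bar>)"] by simp
qed (use psize_cmult assms in auto)

lemma psize_tendsto_sum:
  assumes "finite A" "\<And>k n. k \<in> A \<Longrightarrow> X k n \<in> borel_measurable M"
    "\<And>k. k \<in> A \<Longrightarrow> (\<lambda>n. psize (X k n)) \<longlonglongrightarrow> 0"
  shows "(\<lambda>n. psize (\<lambda>\<omega>. \<Sum>k\<in>A. c k * X k n \<omega>)) \<longlonglongrightarrow> 0"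
  using assms
proof (induction A rule: finite_induct)
  case (insert k A)
  have "(\<lambda>n. psize (\<lambda>\<omega>. c k * X k n \<omega> + (\<Sum>k\<in>A. c k * X k n \<omega>))) \<longlonglongrightarrow> 0"
    using insert by (intro psize_tendsto_add psize_tendsto_cmult borel_measurable_sum borel_measurable_times) auto
  then show ?case using insert by simp
qed (simp add: psize_def)

lemma psize_tendsto_AE:
  assumes [measurable]: "\<And>n. X n \<in> borel_measurable M"
    and "AE \<omega> in M. (\<lambda>n. X n \<omega>) \<longlonglongrightarrow> 0"
  shows "(\<lambda>n. psize (X n)) \<longlonglongrightarrow> 0"
proof -
  have "(\<lambda>n. \<integral>\<^sup>+\<omega>. ennreal (min 1 \<bar>X n \<omega>\<bar>) \<partial>M) \<longlonglongrightarrow> (\<integral>\<^sup>+\<omega>. 0 \<partial>M)"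
  proof (rule nn_integral_dominated_convergence[where w = "\<lambda>_. 1"])
    show "AE \<omega> in M. (\<lambda>n. ennreal (min 1 \<bar>X n \<omega>\<bar>)) \<longlonglongrightarrow> 0"
      using assms(2)
    proof eventually_elim
      case (elim \<omega>)
      have "(\<lambda>n. ennreal (min 1 \<bar>X n \<omega>\<bar>)) \<longlonglongrightarrow> ennreal (min 1 \<bar>0\<bar>)"
        by (intro tendsto_ennrealI tendsto_min tendsto_rabs tendsto_const elim)
      then show ?case by simp
    qed
  qed (auto simp: emeasure_space_1)
  then show ?thesis by (simp add: psize_def)
qed

text \<open>Splitting at the level \<open>e / 2\<close>: below it the truncated value is at most
  \<open>e / 2\<close>, above it at most 1 on an event of probability at most
  \<open>e / 2\<close>.\<close>

lemma psize_tendsto_prob: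
  assumes [measurable]: "\<And>n. X n \<in> borel_measurable M"
    and conv: "\<And>e. 0 < e \<Longrightarrow> eventually (\<lambda>n. prob {\<omega>\<in>space M. \<bar>X n \<omega>\<bar> > e} \<le> e) sequentially"
  shows "(\<lambda>n. psize (X n)) \<longlonglongrightarrow> 0"
proof (rule ennreal_tendsto_0I)
  fix e :: real assume e: "0 < e"
  then have "eventually (\<lambda>n. prob {\<omega>\<in>space M. \<bar>X n \<omega>\<bar> > e / 2} \<le> e / 2) sequentially"
    by (intro conv) simp
  then show "eventually (\<lambda>n. psize (X n) \<le> ennreal e) sequentially"
  proof eventually_elim
    case (elim n)
    let ?A = "{\<omega>\<in>space M. \<bar>X n \<omega>\<bar> > e / 2}"
    have "psize (X n) \<le> (\<integral>\<^sup>+\<omega>. ennreal (e / 2) + indicator ?A \<omega> \<partial>M)"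
      unfolding psize_def
    proof (rule nn_integral_mono)
      fix \<omega> assume \<omega>: "\<omega> \<in> space M"
      show "ennreal (min 1 \<bar>X n \<omega>\<bar>) \<le> ennreal (e / 2) + indicator ?A \<omega>"
      proof (cases "\<bar>X n \<omega>\<bar> > e / 2")
        case True
        have "ennreal (min 1 \<bar>X n \<omega>\<bar>) \<le> 0 + 1" by (simp add: ennreal_le_1)
        also have "\<dots> \<le> ennreal (e / 2) + 1" by (rule add_right_mono) simp
        finally show ?thesis using True \<omega> by simp
      next
        case False
        then have "ennreal (min 1 \<bar>X n \<omega>\<bar>) \<le> ennreal (e / 2)" by (intro ennreal_leI) auto
        with False show ?thesis by simp
      qed
    qed
    also have "\<dots> = ennreal (e / 2) + ennreal (prob ?A)"
      by (simp add: nn_integral_add emeasure_eq_measure prob_space)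
    also have "\<dots> \<le> ennreal (e / 2) + ennreal (e / 2)"
      using elim by (intro add_left_mono ennreal_leI)
    also have "\<dots> = ennreal e" using e by (simp add: ennreal_plus[symmetric] del: ennreal_plus)
    finally show ?case .
  qed
qed

text \<open>\<open>D k\<close> is the covariation error of the indicator of \<open>(a, b]\<close> on
  the \<open>k\<close>-th piece: an increment product minus its mean, centred given the past of
  \<open>r k\<close>. The partial sums thus form a martingale and the second moments of the
  \<open>D k\<close> add up. Measurability and integrability are carried along because each
  induction step uses the partial sum as the adapted factor.\<close>

lemma nested_increments:
  fixes i j :: 'd and a b s t :: real and r :: "nat \<Rightarrow> real"
  assumes "0 \<le> s" "t \<le> T" "is_partition s t n r" "m \<le> n"
  defines "\<delta> \<equiv> if i = j then 1 else 0"
  defines "\<alpha> \<equiv> \<lambda>k. clip (r k) (r (Suc k)) a" and "\<beta> \<equiv> \<lambda>k. clip (r k) (r (Suc k)) b"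
  defines "D k \<omega> \<equiv> dB j (\<alpha> k) (\<beta> k) \<omega> * dB i (r k) (r (Suc k)) \<omega> - \<delta> * (\<beta> k - \<alpha> k)"
  assumes ab: "a \<le> b"
  shows "(\<lambda>\<omega>. \<Sum>k<m. D k \<omega>) \<in> borel_measurable (past M B (r m)) \<and> integrable M (\<lambda>\<omega>. \<Sum>k<m. D k \<omega>) \<and>
    integrable M (\<lambda>\<omega>. (\<Sum>k<m. D k \<omega>)\<^sup>2) \<and>
    expectation (\<lambda>\<omega>. (\<Sum>k<m. D k \<omega>)\<^sup>2) \<le> 8 * (\<Sum>k<m. (r (Suc k) - r k)\<^sup>2)"
  using assms(4)
proof (induction m)
  case (Suc m)
  let ?S = "\<lambda>\<omega>. \<Sum>k<m. D k \<omega>"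
  let ?x = "dB j (\<alpha> m) (\<beta> m)" and ?y = "dB i (r m) (r (Suc m))"
  have S: "?S \<in> borel_measurable (past M B (r m))" "integrable M ?S" "integrable M (\<lambda>\<omega>. (?S \<omega>)\<^sup>2)"
    "expectation (\<lambda>\<omega>. (?S \<omega>)\<^sup>2) \<le> 8 * (\<Sum>k<m. (r (Suc k) - r k)\<^sup>2)"
    using Suc by auto
  have r: "0 \<le> r m" "r m \<le> r (Suc m)" "r (Suc m) \<le> T"
    using is_partition_bounds[OF assms(3), of m] is_partition_bounds[OF assms(3), of "Suc m"]
      is_partition_mono[OF assms(3), of m "Suc m"] assms(1,2) Suc(2) by linarith+
  have c: "r m \<le> \<alpha> m" "\<alpha> m \<le> \<beta> m" "\<beta> m \<le> r (Suc m)"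
    using r ab by (simp_all add: \<alpha>_def \<beta>_def clip_def min_def max_def)
  have nest: "has_bochner_integral M (\<lambda>\<omega>. \<zeta> \<omega> * (?x \<omega> * ?y \<omega>)) (expectation \<zeta> * (\<delta> * (\<beta> m - \<alpha> m)))"
    if "\<zeta> \<in> borel_measurable (past M B (r m))" "integrable M \<zeta>" for \<zeta>
  proof -
    have "(if i = j then \<beta> m - \<alpha> m else 0) = \<delta> * (\<beta> m - \<alpha> m)" by (simp add: \<delta>_def)
    then show ?thesis
      using past_dB_dB_nested[OF r(1) c r(3) that, of j i] by (simp only:)
  qed
  have xy: "integrable M (\<lambda>\<omega>. ?x \<omega> * ?y \<omega>)"
    using integrable.intros[OF nest[of "\<lambda>_. 1", OF borel_measurable_const integrable_const]]
    by (simp only: mult_1_left)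
  have D_int: "integrable M (D m)"
    unfolding D_def using xy by (rule Bochner_Integration.integrable_diff[OF _ integrable_const])
  \<comment> \<open>The partial sum is known at \<open>r m\<close>, so its product with the
    increment product has mean \<open>expectation ?S\<close> times the compensator, which the
    subtracted constant removes.\<close>
  have SD: "has_bochner_integral M (\<lambda>\<omega>. ?S \<omega> * D m \<omega>) 0"
  proof -
    have "has_bochner_integral M (\<lambda>\<omega>. ?S \<omega> * (\<delta> * (\<beta> m - \<alpha> m))) (expectation ?S * (\<delta> * (\<beta> m - \<alpha> m)))"
      using S(2) by (intro has_bochner_integral_mult_left) (simp add: has_bochner_integral_iff)
    from has_bochner_integral_diff[OF nest[OF S(1,2)] this] show ?thesis
      unfolding D_def[of m] right_diff_distrib by (simp only: diff_self)
  qed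
  have x4: "has_bochner_integral M (\<lambda>\<omega>. ?x \<omega> ^ 4) (3 * (\<beta> m - \<alpha> m)\<^sup>2)"
    using r c by (intro dB_fourth_moment) auto
  have y4: "has_bochner_integral M (\<lambda>\<omega>. ?y \<omega> ^ 4) (3 * (r (Suc m) - r m)\<^sup>2)"
    using r c by (intro dB_fourth_moment) auto
  \<comment> \<open>The constant 8 is 3 + 3 + 2: two Gaussian fourth moments and the squared
    compensator, each interval length being at most that of the piece.\<close>
  let ?bound = "\<lambda>\<omega>. ?x \<omega> ^ 4 + ?y \<omega> ^ 4 + 2 * (\<beta> m - \<alpha> m)\<^sup>2"
  have D_le: "(D m \<omega>)\<^sup>2 \<le> ?bound \<omega>" for \<omega>
  proof -
    have "2 * (?x \<omega> * ?y \<omega>)\<^sup>2 \<le> ?x \<omega> ^ 4 + ?y \<omega> ^ 4"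
      using sum_squares_bound[of "(?x \<omega>)\<^sup>2" "(?y \<omega>)\<^sup>2"]
      by (simp add: power_mult_distrib power_mult[symmetric])
    moreover have "(\<delta> * (\<beta> m - \<alpha> m))\<^sup>2 \<le> (\<beta> m - \<alpha> m)\<^sup>2" by (simp add: \<delta>_def)
    moreover have "(u - v)\<^sup>2 \<le> 2 * u\<^sup>2 + 2 * v\<^sup>2" for u v :: real
      using sum_squares_bound[of u "- v"] by (simp add: power2_diff)
    then have "(D m \<omega>)\<^sup>2 \<le> 2 * (?x \<omega> * ?y \<omega>)\<^sup>2 + 2 * (\<delta> * (\<beta> m - \<alpha> m))\<^sup>2"
      unfolding D_def .
    ultimately show ?thesis by linarith
  qed
  have bound_int: "has_bochner_integral M ?bound (3 * (\<beta> m - \<alpha> m)\<^sup>2 + 3 * (r (Suc m) - r m)\<^sup>2 + 2 * (\<beta> m - \<alpha> m)\<^sup>2)"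
  proof (intro has_bochner_integral_add x4 y4)
    show "has_bochner_integral M (\<lambda>\<omega>. 2 * (\<beta> m - \<alpha> m)\<^sup>2) (2 * (\<beta> m - \<alpha> m)\<^sup>2)"
      by (simp add: has_bochner_integral_iff prob_space)
  qed
  have D2: "integrable M (\<lambda>\<omega>. (D m \<omega>)\<^sup>2)"
  proof (rule Bochner_Integration.integrable_bound[OF integrable.intros[OF bound_int]])
    show "(\<lambda>\<omega>. (D m \<omega>)\<^sup>2) \<in> borel_measurable M"
      using D_int by (intro borel_measurable_power borel_measurable_integrable)
    have "norm ((D m \<omega>)\<^sup>2) \<le> norm (?bound \<omega>)" for \<omega>
    proof -
      have "norm ((D m \<omega>)\<^sup>2) = (D m \<omega>)\<^sup>2" by simp
      also have "\<dots> \<le> ?bound \<omega>" by (rule D_le)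
      also have "\<dots> \<le> norm (?bound \<omega>)" unfolding real_norm_def by (rule abs_ge_self)
      finally show ?thesis .
    qed
    then show "AE \<omega> in M. norm ((D m \<omega>)\<^sup>2) \<le> norm (?bound \<omega>)" by (rule AE_I2)
  qed
  have D2_le: "expectation (\<lambda>\<omega>. (D m \<omega>)\<^sup>2) \<le> 8 * (r (Suc m) - r m)\<^sup>2"
  proof -
    have "expectation (\<lambda>\<omega>. (D m \<omega>)\<^sup>2) \<le> expectation ?bound"
      by (rule integral_mono[OF D2 integrable.intros[OF bound_int] D_le])
    also have "\<dots> = 5 * (\<beta> m - \<alpha> m)\<^sup>2 + 3 * (r (Suc m) - r m)\<^sup>2"
      unfolding has_bochner_integral_integral_eq[OF bound_int] by linarith
    also have "(\<beta> m - \<alpha> m)\<^sup>2 \<le> (r (Suc m) - r m)\<^sup>2"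
      using c by (intro power_mono) auto
    finally show ?thesis by simp
  qed
  have sq: "(\<Sum>k<Suc m. D k \<omega>)\<^sup>2 = (?S \<omega>)\<^sup>2 + 2 * (?S \<omega> * D m \<omega>) + (D m \<omega>)\<^sup>2" for \<omega>
    unfolding sum.lessThan_Suc power2_sum by (simp only: mult.assoc ac_simps)
  have "D m \<in> borel_measurable (past M B (r (Suc m)))"
    unfolding D_def using r c
    by (intro borel_measurable_diff borel_measurable_times measurable_dB_past borel_measurable_const) auto
  moreover have "?S \<in> borel_measurable (past M B (r (Suc m)))"
    using measurable_past_mono[OF S(1) r(2)] .
  ultimately have m: "(\<lambda>\<omega>. \<Sum>k<Suc m. D k \<omega>) \<in> borel_measurable (past M B (r (Suc m)))"
    unfolding sum.lessThan_Suc by (intro borel_measurable_add)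
  have i: "integrable M (\<lambda>\<omega>. \<Sum>k<Suc m. D k \<omega>)"
    unfolding sum.lessThan_Suc by (intro Bochner_Integration.integrable_add S(2) D_int)
  have "has_bochner_integral M (\<lambda>\<omega>. (?S \<omega>)\<^sup>2 + 2 * (?S \<omega> * D m \<omega>) + (D m \<omega>)\<^sup>2)
      (expectation (\<lambda>\<omega>. (?S \<omega>)\<^sup>2) + 2 * 0 + expectation (\<lambda>\<omega>. (D m \<omega>)\<^sup>2))"
    by (intro has_bochner_integral_add has_bochner_integral_mult_right SD has_bochner_integral_integrable S(3) D2)
  then have hb: "has_bochner_integral M (\<lambda>\<omega>. (\<Sum>k<Suc m. D k \<omega>)\<^sup>2)
      (expectation (\<lambda>\<omega>. (?S \<omega>)\<^sup>2) + 2 * 0 + expectation (\<lambda>\<omega>. (D m \<omega>)\<^sup>2))"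
    unfolding sq .
  have "(\<Sum>k<Suc m. (r (Suc k) - r k)\<^sup>2) = (\<Sum>k<m. (r (Suc k) - r k)\<^sup>2) + (r (Suc m) - r m)\<^sup>2"
    by (rule sum.lessThan_Suc)
  then have "expectation (\<lambda>\<omega>. (\<Sum>k<Suc m. D k \<omega>)\<^sup>2) \<le> 8 * (\<Sum>k<Suc m. (r (Suc k) - r k)\<^sup>2)"
    using S(4) D2_le has_bochner_integral_integral_eq[OF hb] by linarith
  with m i integrable.intros[OF hb] show ?case by (intro conjI)
qed (simp)

end

section \<open>Covariation of step integrands and passage to the limit\<close>

context brownian
begin

text \<open>The bounded coefficient \<xi> is pulled out of the whole sum; what remains belongs to
  the deterministic indicator of \<open>(a, b]\<close>, whose error has second moment at most
  \<open>K / Suc n\<close>.\<close>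

lemma elem_covariation:
  fixes i j :: 'd
  assumes st: "0 \<le> s" "s \<le> t" "t \<le> T" and ok: "elem_ok (a, b, \<xi>)" and ab: "s \<le> a" "b \<le> t"
  shows "(\<lambda>n. psize (\<lambda>\<omega>. \<xi> \<omega> *
    ((\<Sum>k<Suc n. dB j (clip (upart s t n k) (upart s t n (Suc k)) a) (clip (upart s t n k) (upart s t n (Suc k)) b) \<omega> *
       dB i (upart s t n k) (upart s t n (Suc k)) \<omega>) - (if i = j then 1 else 0) * (b - a)))) \<longlonglongrightarrow> 0"
proof -
  define \<delta> where "\<delta> = (if i = j then 1 else 0 :: real)"
  define D where "D n k \<omega> = dB j (clip (upart s t n k) (upart s t n (Suc k)) a) (clip (upart s t n k) (upart s t n (Suc k)) b) \<omega> *
       dB i (upart s t n k) (upart s t n (Suc k)) \<omega> -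
       \<delta> * (clip (upart s t n k) (upart s t n (Suc k)) b - clip (upart s t n k) (upart s t n (Suc k)) a)" for n k \<omega>
  define S where "S n \<omega> = (\<Sum>k<Suc n. D n k \<omega>)" for n \<omega>
  have a_le_b: "a \<le> b" and \<xi> [measurable]: "\<xi> \<in> borel_measurable M" using ok by (auto simp: elem_ok_def)
  from ok obtain C where C: "\<forall>\<omega>\<in>space M. \<bar>\<xi> \<omega>\<bar> \<le> C" by (auto simp: elem_ok_def)
  define K where "K = 8 * (t - s)\<^sup>2"
  have part: "is_partition s t (Suc n) (upart s t n)" for n by (rule is_partition_upart[OF st(2)])
  have S: "integrable M (S n)" "integrable M (\<lambda>\<omega>. (S n \<omega>)\<^sup>2)" "expectation (\<lambda>\<omega>. (S n \<omega>)\<^sup>2) \<le> K / real (Suc n)" for n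
  proof -
    note * = nested_increments[OF st(1,3) part[of n] order_refl a_le_b, of j i]
    show "integrable M (S n)" "integrable M (\<lambda>\<omega>. (S n \<omega>)\<^sup>2)"
      unfolding S_def D_def \<delta>_def using * by blast+
    have "expectation (\<lambda>\<omega>. (S n \<omega>)\<^sup>2) \<le> 8 * (\<Sum>k<Suc n. (upart s t n (Suc k) - upart s t n k)\<^sup>2)"
      unfolding S_def D_def \<delta>_def using * by blast
    also have "\<dots> = K / real (Suc n)"
      unfolding upart_step K_def by (simp add: power_divide power2_eq_square)
    finally show "expectation (\<lambda>\<omega>. (S n \<omega>)\<^sup>2) \<le> K / real (Suc n)" .
  qed
  have bound: "psize (\<lambda>\<omega>. \<xi> \<omega> * S n \<omega>) \<le> ennreal (C * (1 + K) / sqrt (real (Suc n)))" for n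
  proof -
    \<comment> \<open>Balances the two terms of Young's inequality: \<open>e\<close> and
      \<open>K / (e * Suc n)\<close> are both of order \<open>1 / sqrt (Suc n)\<close>.\<close>
    define e where "e = 1 / sqrt (real (Suc n))"
    have e: "0 < e" by (simp add: e_def)
    have "psize (\<lambda>\<omega>. \<xi> \<omega> * S n \<omega>) \<le> (\<integral>\<^sup>+\<omega>. ennreal \<bar>\<xi> \<omega> * S n \<omega>\<bar> \<partial>M)"
      by (rule psize_le_L1)
    also have "\<dots> \<le> (\<integral>\<^sup>+\<omega>. ennreal (C * (e + (1 / e) * (S n \<omega>)\<^sup>2)) \<partial>M)"
    proof (intro nn_integral_mono ennreal_leI)
      fix \<omega> assume "\<omega> \<in> space M"
      then have "\<bar>\<xi> \<omega>\<bar> \<le> C" using C by blast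
      have "2 * e * \<bar>S n \<omega>\<bar> \<le> e\<^sup>2 + (S n \<omega>)\<^sup>2"
        using sum_squares_bound[of e "\<bar>S n \<omega>\<bar>"] by simp
      moreover have "0 \<le> e * \<bar>S n \<omega>\<bar>" using e by simp
      ultimately have "e * \<bar>S n \<omega>\<bar> \<le> e\<^sup>2 + (S n \<omega>)\<^sup>2" by linarith
      then have "\<bar>S n \<omega>\<bar> \<le> e + (1 / e) * (S n \<omega>)\<^sup>2"
        using e by (simp add: field_simps power2_eq_square)
      with \<open>\<bar>\<xi> \<omega>\<bar> \<le> C\<close> show "\<bar>\<xi> \<omega> * S n \<omega>\<bar> \<le> C * (e + (1 / e) * (S n \<omega>)\<^sup>2)"
        unfolding abs_mult by (intro mult_mono) auto
    qed
    also have "\<dots> = ennreal (expectation (\<lambda>\<omega>. C * (e + (1 / e) * (S n \<omega>)\<^sup>2)))"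
    proof (rule nn_integral_eq_integral)
      show "integrable M (\<lambda>\<omega>. C * (e + (1 / e) * (S n \<omega>)\<^sup>2))" using S(2) by simp
      show "AE \<omega> in M. 0 \<le> C * (e + (1 / e) * (S n \<omega>)\<^sup>2)"
        using C e by (intro AE_I2 mult_nonneg_nonneg add_nonneg_nonneg) force+
    qed
    also have "\<dots> \<le> ennreal (C * (1 + K) / sqrt (real (Suc n)))"
    proof (rule ennreal_leI)
      obtain \<omega>0 where "\<omega>0 \<in> space M" using not_empty by blast
      then have "0 \<le> C" using C by force
      have "expectation (\<lambda>\<omega>. C * (e + (1 / e) * (S n \<omega>)\<^sup>2)) = C * (e + (1 / e) * expectation (\<lambda>\<omega>. (S n \<omega>)\<^sup>2))"
        using S(2)[of n] by (simp add: prob_space)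
      also have "\<dots> \<le> C * (e + (1 / e) * (K / real (Suc n)))"
        using S(3)[of n] e \<open>0 \<le> C\<close> by (intro mult_left_mono add_left_mono) auto
      also have "(1 / e) * (K / real (Suc n)) = e * K"
        unfolding e_def by (simp add: divide_simps real_sqrt_mult_self del: of_nat_Suc)
      finally show "expectation (\<lambda>\<omega>. C * (e + (1 / e) * (S n \<omega>)\<^sup>2)) \<le> C * (1 + K) / sqrt (real (Suc n))"
        by (simp add: e_def algebra_simps add_divide_distrib)
    qed
    finally show ?thesis .
  qed
  have "(\<lambda>n. C * (1 + K) / sqrt (real (Suc n))) \<longlonglongrightarrow> 0"
    by (intro real_tendsto_divide_at_top[OF tendsto_const]
        filterlim_compose[OF sqrt_at_top] filterlim_compose[OF filterlim_real_sequentially] filterlim_Suc)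
  then have "(\<lambda>n. ennreal (C * (1 + K) / sqrt (real (Suc n)))) \<longlonglongrightarrow> 0"
    using tendsto_ennrealI[of _ 0] by simp
  then have "(\<lambda>n. psize (\<lambda>\<omega>. \<xi> \<omega> * S n \<omega>)) \<longlonglongrightarrow> 0"
    by (rule tendsto_sandwich[OF always_eventually always_eventually tendsto_const, rotated 2])
      (intro allI zero_le bound)+
  moreover have "S n \<omega> = (\<Sum>k<Suc n. dB j (clip (upart s t n k) (upart s t n (Suc k)) a) (clip (upart s t n k) (upart s t n (Suc k)) b) \<omega> *
       dB i (upart s t n k) (upart s t n (Suc k)) \<omega>) - \<delta> * (b - a)" for n \<omega>
    unfolding S_def D_def sum_subtractf sum_distrib_left[symmetric] sum_clip[OF part ab(1) a_le_b ab(2), unfolded sum_subtractf] ..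
  ultimately show ?thesis unfolding \<delta>_def by simp
qed

lemma measurable_dB_upart:
  assumes "0 \<le> s" "s \<le> t" "t \<le> T" "k < Suc n"
  shows "dB i (upart s t n k) (upart s t n (Suc k)) \<in> borel_measurable M"
  using is_partition_bounds[OF is_partition_upart[OF assms(2)], of k n]
    is_partition_bounds[OF is_partition_upart[OF assms(2)], of "Suc k" n] assms
  by (intro measurable_dB) auto

lemma elem_ok_restrict_upart:
  assumes "0 \<le> s" "s \<le> t" "t \<le> T" "k < Suc n" "list_all elem_ok L"
  shows "list_all elem_ok (restrict_step (upart s t n k) (upart s t n (Suc k)) L)"
  using is_partition_bounds[OF is_partition_upart[OF assms(2)], of k n]
    is_partition_bounds[OF is_partition_upart[OF assms(2)], of "Suc k" n]
    is_partition_mono[OF is_partition_upart[OF assms(2)], of k "Suc k" n] assms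
  by (intro elem_ok_restrict) auto

definition step_total :: "'w step_data \<Rightarrow> 'w \<Rightarrow> real" where
  "step_total L \<omega> = (\<Sum>(a, b, \<xi>)\<leftarrow>L. \<xi> \<omega> * (b - a))"

lemma has_bochner_integral_step:
  "list_all elem_ok L \<Longrightarrow> has_bochner_integral lborel (\<lambda>u. step L u \<omega>) (step_total L \<omega>)"
proof (induction L)
  case (Cons x L)
  obtain a b \<xi> where x: "x = (a, b, \<xi>)" by (cases x)
  with Cons have "a \<le> b" by (simp add: elem_ok_def)
  then have "has_bochner_integral lborel (indicator {a<..b} :: real \<Rightarrow> real) (b - a)"
    using has_bochner_integral_real_indicator[of "{a<..b}" lborel] by simp
  then have "has_bochner_integral lborel (\<lambda>u. \<xi> \<omega> * indicator {a<..b} u) (\<xi> \<omega> * (b - a))"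
    by (rule has_bochner_integral_mult_right)
  from has_bochner_integral_add[OF this] Cons show ?case
    by (simp add: x step_Cons step_total_def)
qed (simp add: has_bochner_integral_zero step_total_def)

lemma measurable_step_total: "list_all elem_ok L \<Longrightarrow> step_total L \<in> borel_measurable M"
proof (induction L)
  case (Cons x L)
  obtain a b \<xi> where x: "x = (a, b, \<xi>)" by (cases x)
  with Cons have "(\<lambda>\<omega>. \<xi> \<omega> * (b - a) + step_total L \<omega>) \<in> borel_measurable M"
    by (intro borel_measurable_add borel_measurable_times) (auto simp: elem_ok_def)
  then show ?case by (simp add: x step_total_def)
qed (simp add: step_total_def[abs_def])

text \<open>Both the sum of increment products and its limit are additive in \<open>L\<close>, so
  the entries are treated one at a time.\<close>

lemma step_covariation:
  fixes i j :: 'd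
  assumes st: "0 \<le> s" "s \<le> t" "t \<le> T"
    and L: "list_all elem_ok L" "list_all (\<lambda>(a, b, \<xi>). s \<le> a \<and> b \<le> t) L"
  shows "(\<lambda>n. psize (\<lambda>\<omega>. (\<Sum>k<Suc n. step_int j (restrict_step (upart s t n k) (upart s t n (Suc k)) L) \<omega> *
       dB i (upart s t n k) (upart s t n (Suc k)) \<omega>) - (if i = j then 1 else 0) * step_total L \<omega>)) \<longlonglongrightarrow> 0"
    (is "(\<lambda>n. psize (?R L n)) \<longlonglongrightarrow> 0")
  using L
proof (induction L)
  case Nil
  then show ?case by (simp add: restrict_step_def step_total_def psize_def)
next
  case (Cons x L)
  obtain a b \<xi> where x: "x = (a, b, \<xi>)" by (cases x)
  let ?E = "\<lambda>n \<omega>. \<xi> \<omega> *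
    ((\<Sum>k<Suc n. dB j (clip (upart s t n k) (upart s t n (Suc k)) a) (clip (upart s t n k) (upart s t n (Suc k)) b) \<omega> *
       dB i (upart s t n k) (upart s t n (Suc k)) \<omega>) - (if i = j then 1 else 0) * (b - a))"
  have meas: "?R L n \<in> borel_measurable M" if "list_all elem_ok L" for n L
    using st that by (intro borel_measurable_diff borel_measurable_sum borel_measurable_times
        measurable_step_int elem_ok_restrict_upart measurable_dB_upart measurable_step_total borel_measurable_const) auto
  have eq: "?R (x # L) n \<omega> = ?E n \<omega> + ?R L n \<omega>" for n \<omega>
  proof -
    have gen: "(\<Sum>k<N. (z * x k + w k) * y k) - d * (z * l + m) =
        z * ((\<Sum>k<N. x k * y k) - d * l) + ((\<Sum>k<N. w k * y k) - d * m)"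
      for x y w :: "nat \<Rightarrow> real" and z d l m :: real and N
      by (simp add: algebra_simps sum.distrib sum_distrib_left)
    have int: "step_int j (restrict_step p q (x # L)) \<omega> =
        \<xi> \<omega> * dB j (clip p q a) (clip p q b) \<omega> + step_int j (restrict_step p q L) \<omega>" for p q
      by (simp add: x restrict_step_def step_int_Cons)
    have total: "step_total (x # L) \<omega> = \<xi> \<omega> * (b - a) + step_total L \<omega>"
      by (simp add: x step_total_def)
    show ?thesis unfolding int total by (rule gen)
  qed
  have ok: "elem_ok (a, b, \<xi>)" "list_all elem_ok L" using Cons x by auto
  \<comment> \<open>Measurability of the summand \<open>?E\<close> is read off as that of a
    difference of two measurable sums.\<close>
  have "(\<lambda>\<omega>. ?R (x # L) n \<omega> - ?R L n \<omega>) \<in> borel_measurable M" for n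
    using meas[OF Cons(2)] meas[OF ok(2)] by (rule borel_measurable_diff)
  then have mE: "?E n \<in> borel_measurable M" for n
    unfolding eq by (simp only: add_diff_cancel_right')
  have "(\<lambda>n. psize (\<lambda>\<omega>. ?E n \<omega> + ?R L n \<omega>)) \<longlonglongrightarrow> 0"
    using Cons x st ok by (intro psize_tendsto_add mE meas elem_covariation) auto
  then show ?case unfolding eq .
qed

text \<open>The half-open pieces are disjoint. The bound is the same for every partition, which
  keeps the approximation of the integrand under control during refinement.\<close>

lemma sum_sqnorm_partition_le:
  assumes F: "joint F" and part: "is_partition s t n r"
  shows "(\<Sum>k<n. sqnorm (\<lambda>u \<omega>. indicator {r k<..r (Suc k)} u * F u \<omega>)) \<le> sqnorm F"
proof -
  let ?F = "\<lambda>k u \<omega>. indicator {r k<..r (Suc k)} u * F u \<omega>"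
  have j: "joint (?F k)" for k by (rule joint_indicator[OF F])
  have "(\<Sum>k<n. sqnorm (?F k)) = (\<integral>\<^sup>+\<omega>. (\<Sum>k<n. \<integral>\<^sup>+u. ennreal ((?F k u \<omega>)\<^sup>2) \<partial>lborel) \<partial>M)"
    unfolding sqnorm_def by (rule nn_integral_sum[symmetric]) (rule measurable_inner[OF j])
  also have "\<dots> \<le> sqnorm F"
    unfolding sqnorm_def
  proof (rule nn_integral_mono)
    fix \<omega> assume \<omega>: "\<omega> \<in> space M"
    have "(\<Sum>k<n. \<integral>\<^sup>+u. ennreal ((?F k u \<omega>)\<^sup>2) \<partial>lborel) = (\<integral>\<^sup>+u. (\<Sum>k<n. ennreal ((?F k u \<omega>)\<^sup>2)) \<partial>lborel)"
      using joint_slice[OF j \<omega>] by (intro nn_integral_sum[symmetric]) auto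
    also have "\<dots> \<le> (\<integral>\<^sup>+u. ennreal ((F u \<omega>)\<^sup>2) \<partial>lborel)"
    proof (rule nn_integral_mono)
      fix u :: real
      have "(\<Sum>k<n. (?F k u \<omega>)\<^sup>2) = (\<Sum>k<n. indicator {r k<..r (Suc k)} u) * (F u \<omega>)\<^sup>2"
        unfolding sum_distrib_right by (intro sum.cong) (auto simp: indicator_def)
      also have "\<dots> \<le> (F u \<omega>)\<^sup>2"
        unfolding sum_indicator_partition[OF part] by (auto simp: indicator_def)
      finally have "(\<Sum>k<n. (?F k u \<omega>)\<^sup>2) \<le> (F u \<omega>)\<^sup>2" .
      then show "(\<Sum>k<n. ennreal ((?F k u \<omega>)\<^sup>2)) \<le> ennreal ((F u \<omega>)\<^sup>2)"
        by (simp add: sum_ennreal ennreal_leI)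
    qed
    finally show "(\<Sum>k<n. \<integral>\<^sup>+u. ennreal ((?F k u \<omega>)\<^sup>2) \<partial>lborel) \<le> (\<integral>\<^sup>+u. ennreal ((F u \<omega>)\<^sup>2) \<partial>lborel)" .
  qed
  finally show ?thesis .
qed

lemma nn_integral_sum_mult_le:
  assumes e: "0 < e" and W: "\<And>k. k < n \<Longrightarrow> W k \<in> borel_measurable M" and V: "\<And>k. k < n \<Longrightarrow> V k \<in> borel_measurable M"
  shows "(\<integral>\<^sup>+\<omega>. ennreal \<bar>\<Sum>k<n. W k \<omega> * V k \<omega>\<bar> \<partial>M) \<le>
    ennreal (1 / e) * (\<Sum>k<n. \<integral>\<^sup>+\<omega>. ennreal ((W k \<omega>)\<^sup>2) \<partial>M) +
    ennreal e * (\<Sum>k<n. \<integral>\<^sup>+\<omega>. ennreal ((V k \<omega>)\<^sup>2) \<partial>M)"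
proof -
  have "(\<integral>\<^sup>+\<omega>. ennreal \<bar>\<Sum>k<n. W k \<omega> * V k \<omega>\<bar> \<partial>M) \<le>
      (\<integral>\<^sup>+\<omega>. (\<Sum>k<n. ennreal (1 / e) * ennreal ((W k \<omega>)\<^sup>2) + ennreal e * ennreal ((V k \<omega>)\<^sup>2)) \<partial>M)"
  proof (rule nn_integral_mono)
    fix \<omega>
    have "ennreal \<bar>\<Sum>k<n. W k \<omega> * V k \<omega>\<bar> \<le> ennreal (\<Sum>k<n. \<bar>W k \<omega> * V k \<omega>\<bar>)"
      by (intro ennreal_leI sum_abs)
    also have "\<dots> = (\<Sum>k<n. ennreal \<bar>W k \<omega> * V k \<omega>\<bar>)" by (rule sum_ennreal[symmetric]) simp
    also have "\<dots> \<le> (\<Sum>k<n. ennreal (1 / e) * ennreal ((W k \<omega>)\<^sup>2) + ennreal e * ennreal ((V k \<omega>)\<^sup>2))"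
      by (intro sum_mono young_ennreal e)
    finally show "ennreal \<bar>\<Sum>k<n. W k \<omega> * V k \<omega>\<bar> \<le>
      (\<Sum>k<n. ennreal (1 / e) * ennreal ((W k \<omega>)\<^sup>2) + ennreal e * ennreal ((V k \<omega>)\<^sup>2))" .
  qed
  also have "\<dots> = (\<Sum>k<n. \<integral>\<^sup>+\<omega>. ennreal (1 / e) * ennreal ((W k \<omega>)\<^sup>2) + ennreal e * ennreal ((V k \<omega>)\<^sup>2) \<partial>M)"
    using W V by (intro nn_integral_sum) (auto simp: measurable_compose[OF _ measurable_ennreal])
  also have "\<dots> = (\<Sum>k<n. ennreal (1 / e) * (\<integral>\<^sup>+\<omega>. ennreal ((W k \<omega>)\<^sup>2) \<partial>M) +
      ennreal e * (\<integral>\<^sup>+\<omega>. ennreal ((V k \<omega>)\<^sup>2) \<partial>M))"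
  proof (rule sum.cong[OF refl])
    fix k assume "k \<in> {..<n}"
    then have [measurable]: "W k \<in> borel_measurable M" "V k \<in> borel_measurable M" using W V by auto
    show "(\<integral>\<^sup>+\<omega>. ennreal (1 / e) * ennreal ((W k \<omega>)\<^sup>2) + ennreal e * ennreal ((V k \<omega>)\<^sup>2) \<partial>M) =
      ennreal (1 / e) * (\<integral>\<^sup>+\<omega>. ennreal ((W k \<omega>)\<^sup>2) \<partial>M) + ennreal e * (\<integral>\<^sup>+\<omega>. ennreal ((V k \<omega>)\<^sup>2) \<partial>M)"
      by (simp add: nn_integral_add nn_integral_cmult)
  qed
  finally show ?thesis by (simp add: sum.distrib sum_distrib_left)
qed

text \<open>Passes from the square norm of the approximation error \<open>F\<close> to the
  \<open>L^1\<close> distance of the time integrals of \<open>G\<close> and its approximation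
  \<open>K\<close>. Young's inequality against the constant 1 on \<open>(s, t]\<close> also makes
  almost every path of \<open>F\<close> integrable, so the two integrals may be subtracted.\<close>

lemma nn_integral_integral_diff_le:
  assumes e: "0 < e" and st: "s \<le> t" and jF: "joint F" and fin: "sqnorm F < \<infinity>"
    and out: "\<And>u \<omega>. u \<notin> {s<..t} \<Longrightarrow> F u \<omega> = 0"
    and G: "\<And>u \<omega>. G u \<omega> = F u \<omega> + K u \<omega>" and K: "\<And>\<omega>. integrable lborel (\<lambda>u. K u \<omega>)"
  shows "(\<integral>\<^sup>+\<omega>. ennreal \<bar>(\<integral>u. K u \<omega> \<partial>lborel) - (\<integral>u. G u \<omega> \<partial>lborel)\<bar> \<partial>M) \<le>
    ennreal (1 / e) * sqnorm F + ennreal (e * (t - s))"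
proof -
  let ?q = "\<lambda>\<omega>. \<integral>\<^sup>+u. ennreal ((F u \<omega>)\<^sup>2) \<partial>lborel"
  note [measurable] = measurable_inner[OF jF]
  have "AE \<omega> in M. ?q \<omega> \<noteq> \<infinity>"
    using fin unfolding sqnorm_def by (intro nn_integral_PInf_AE) auto
  then have "AE \<omega> in M. ennreal \<bar>(\<integral>u. K u \<omega> \<partial>lborel) - (\<integral>u. G u \<omega> \<partial>lborel)\<bar> \<le>
      ennreal (1 / e) * ?q \<omega> + ennreal (e * (t - s))"
    using AE_space
  proof eventually_elim
    case (elim \<omega>)
    have [measurable]: "(\<lambda>u. F u \<omega>) \<in> borel_measurable borel"
      using joint_slice[OF jF] elim by auto
    have "(\<integral>\<^sup>+u. ennreal (norm (F u \<omega>)) \<partial>lborel) \<le>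
        (\<integral>\<^sup>+u. ennreal (1 / e) * ennreal ((F u \<omega>)\<^sup>2) + ennreal e * indicator {s<..t} u \<partial>lborel)"
    proof (rule nn_integral_mono)
      fix u show "ennreal (norm (F u \<omega>)) \<le> ennreal (1 / e) * ennreal ((F u \<omega>)\<^sup>2) + ennreal e * indicator {s<..t} u"
        using young_ennreal[OF e, of "F u \<omega>" 1] out[of u \<omega>] by (cases "u \<in> {s<..t}") auto
    qed
    also have "\<dots> = ennreal (1 / e) * ?q \<omega> + ennreal (e * (t - s))"
      using e st by (simp add: nn_integral_add nn_integral_cmult ennreal_mult)
    finally have le: "(\<integral>\<^sup>+u. ennreal (norm (F u \<omega>)) \<partial>lborel) \<le> ennreal (1 / e) * ?q \<omega> + ennreal (e * (t - s))" .
    also have "\<dots> < \<infinity>" using elim by (simp add: ennreal_mult_less_top top.not_eq_extremum)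
    finally have int: "integrable lborel (\<lambda>u. F u \<omega>)" by (intro integrableI_bounded) auto
    have "(\<integral>u. K u \<omega> \<partial>lborel) - (\<integral>u. G u \<omega> \<partial>lborel) = - (\<integral>u. F u \<omega> \<partial>lborel)"
      using int K by (simp add: G)
    then have "ennreal \<bar>(\<integral>u. K u \<omega> \<partial>lborel) - (\<integral>u. G u \<omega> \<partial>lborel)\<bar> = ennreal (norm (\<integral>u. F u \<omega> \<partial>lborel))"
      by simp
    also have "\<dots> \<le> (\<integral>\<^sup>+u. ennreal (norm (F u \<omega>)) \<partial>lborel)"
      by (rule integral_norm_bound_ennreal[OF int])
    finally show ?case using le by (rule order_trans)
  qed
  then have "(\<integral>\<^sup>+\<omega>. ennreal \<bar>(\<integral>u. K u \<omega> \<partial>lborel) - (\<integral>u. G u \<omega> \<partial>lborel)\<bar> \<partial>M) \<le>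
      (\<integral>\<^sup>+\<omega>. ennreal (1 / e) * ?q \<omega> + ennreal (e * (t - s)) \<partial>M)"
    by (rule nn_integral_mono_AE)
  also have "\<dots> = ennreal (1 / e) * sqnorm F + ennreal (e * (t - s))"
    by (simp add: nn_integral_add nn_integral_cmult sqnorm_def emeasure_space_1)
  finally show ?thesis .
qed

text \<open>With a step integrand \<open>L\<close> fixed, the error has three parts:
  \<open>A n\<close> from replacing the increments of \<open>Y\<close> by those of the step
  integral, small uniformly in \<open>n\<close>; \<open>R n\<close>, the covariation error of
  \<open>L\<close>, which tends to zero; and the difference of the two time integrals.\<close>

lemma ito_covariation:
  fixes i j :: 'd
  assumes st: "0 \<le> s" "s \<le> t" "t \<le> T"
    and Y: "\<And>r. r \<in> {s..t} \<Longrightarrow> ito j (\<lambda>u \<omega>. indicator {s<..r} u * H u \<omega>) (Y r)"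
  shows "(\<lambda>n. psize (\<lambda>\<omega>. (\<Sum>k<Suc n. (Y (upart s t n (Suc k)) \<omega> - Y (upart s t n k) \<omega>) *
      dB i (upart s t n k) (upart s t n (Suc k)) \<omega>) -
      (if i = j then 1 else 0) * (\<integral>u. indicator {s<..t} u * H u \<omega> \<partial>lborel))) \<longlonglongrightarrow> 0"
proof (rule ennreal_tendsto_0I)
  fix e' :: real assume e': "0 < e'"
  define \<delta> where "\<delta> = (if i = j then 1 else 0 :: real)"
  define G where "G u \<omega> = indicator {s<..t} u * H u \<omega>" for u \<omega>
  define J where "J \<omega> = (\<integral>u. G u \<omega> \<partial>lborel)" for \<omega>
  \<comment> \<open>The three bounds \<open>4 * e + e * (t - s)\<close>, \<open>e\<close> and
    \<open>e + e * (t - s)\<close> add up to \<open>e'\<close>.\<close>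
  define e where "e = e' / (6 + 2 * (t - s))"
  have e: "0 < e" and e_e': "e * (6 + 2 * (t - s)) = e'" using e' st by (auto simp: e_def)
  let ?p = "upart s t"
  have part: "is_partition s t (Suc n) (?p n)" for n by (rule is_partition_upart[OF st(2)])
  have G: "ito j G (Y t)" using Y[of t] st by (simp add: G_def[abs_def])
  then have jG: "joint G" by (rule ito_joint)
  from G obtain L' where L': "\<And>m. list_all elem_ok (L' m)"
      "(\<lambda>m. sqnorm (\<lambda>u \<omega>. G u \<omega> - step (L' m) u \<omega>)) \<longlonglongrightarrow> 0"
    by (auto simp: ito_def)
  from ennreal_tendsto_0D[OF L'(2), of "e\<^sup>2"] e obtain m where
    m: "sqnorm (\<lambda>u \<omega>. G u \<omega> - step (L' m) u \<omega>) \<le> ennreal (e\<^sup>2)"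
    by (auto simp: eventually_sequentially)
  \<comment> \<open>Truncation to \<open>(s, t]\<close> puts all endpoints inside
    \<open>[s,t]\<close>, as \<open>step_covariation\<close> requires, and makes the error
    \<open>F\<close> vanish outside.\<close>
  define L where "L = restrict_step s t (L' m)"
  have L: "list_all elem_ok L" unfolding L_def using L'(1) st by (intro elem_ok_restrict) auto
  have L_in: "list_all (\<lambda>(a, b, \<xi>). s \<le> a \<and> b \<le> t) L"
    unfolding L_def restrict_step_def using st by (auto simp: list_all_iff clip_def)
  define F where "F u \<omega> = G u \<omega> - step L u \<omega>" for u \<omega>
  have jF: "joint F" unfolding F_def[abs_def] by (intro joint_diff jG joint_step L)
  have F: "F u \<omega> = indicator {s<..t} u * (G u \<omega> - step (L' m) u \<omega>)" for u \<omega>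
    unfolding F_def L_def step_restrict[OF st(2)] by (simp add: G_def indicator_def)
  have F_out: "F u \<omega> = 0" if "u \<notin> {s<..t}" for u \<omega> using that by (simp add: F)
  have "sqnorm F \<le> sqnorm (\<lambda>u \<omega>. G u \<omega> - step (L' m) u \<omega>)"
    by (rule sqnorm_mono) (simp add: F indicator_def)
  with m have sqF: "sqnorm F \<le> ennreal (e\<^sup>2)" by simp
  \<comment> \<open>On each piece, the increment of \<open>Y\<close> minus that of the step integral
    is the integral of \<open>F\<close> cut down to the piece, so \<open>ito_bound\<close> applies
    piece by piece.\<close>
  define W where "W n k \<omega> = Y (?p n (Suc k)) \<omega> - Y (?p n k) \<omega> - step_int j (restrict_step (?p n k) (?p n (Suc k)) L) \<omega>" for n k \<omega>
  have W: "ito j (\<lambda>u \<omega>. indicator {?p n k<..?p n (Suc k)} u * F u \<omega>) (W n k)" if "k < Suc n" for n k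
  proof -
    have b: "s \<le> ?p n k" "?p n k \<le> ?p n (Suc k)" "?p n (Suc k) \<le> t"
      using is_partition_bounds[OF part] is_partition_mono[OF part, of k "Suc k"] that by auto
    have "ito j (\<lambda>u \<omega>. indicator {s<..?p n (Suc k)} u * H u \<omega> - indicator {s<..?p n k} u * H u \<omega> -
        step (restrict_step (?p n k) (?p n (Suc k)) L) u \<omega>) (W n k)"
      unfolding W_def[abs_def] using b that st L
      by (intro ito_diff Y ito_step elem_ok_restrict_upart) auto
    moreover have "indicator {s<..?p n (Suc k)} u * H u \<omega> - indicator {s<..?p n k} u * H u \<omega> -
        step (restrict_step (?p n k) (?p n (Suc k)) L) u \<omega> = indicator {?p n k<..?p n (Suc k)} u * F u \<omega>" for u \<omega>
      unfolding step_restrict[OF b(2)] F_def G_def using b by (auto simp: indicator_def)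
    ultimately show ?thesis by simp
  qed
  define A where "A n \<omega> = (\<Sum>k<Suc n. W n k \<omega> * dB i (?p n k) (?p n (Suc k)) \<omega>)" for n \<omega>
  define R where "R n \<omega> = (\<Sum>k<Suc n. step_int j (restrict_step (?p n k) (?p n (Suc k)) L) \<omega> *
       dB i (?p n k) (?p n (Suc k)) \<omega>) - \<delta> * step_total L \<omega>" for n \<omega>
  have mW: "W n k \<in> borel_measurable M" and mdB: "dB i (?p n k) (?p n (Suc k)) \<in> borel_measurable M"
    if "k < Suc n" for n k
    using ito_measurable[OF W[OF that]] measurable_dB_upart[OF st that] by auto
  have mA: "A n \<in> borel_measurable M" for n
    unfolding A_def[abs_def] by (intro borel_measurable_sum borel_measurable_times mW mdB) auto
  have mR: "R n \<in> borel_measurable M" for n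
    unfolding R_def[abs_def] using st L
    by (intro borel_measurable_diff borel_measurable_sum borel_measurable_times
        measurable_step_int elem_ok_restrict_upart mdB measurable_step_total borel_measurable_const) auto
  have mJ [measurable]: "J \<in> borel_measurable M"
  proof -
    note [measurable] = joint_swap[OF jG]
    show ?thesis unfolding J_def[abs_def] by measurable
  qed
  note [measurable] = measurable_step_total[OF L]
  have A: "psize (A n) \<le> ennreal (4 * e + e * (t - s))" for n
  proof -
    have "psize (A n) \<le> (\<integral>\<^sup>+\<omega>. ennreal \<bar>A n \<omega>\<bar> \<partial>M)" by (rule psize_le_L1)
    also have "\<dots> \<le> ennreal (1 / e) * (\<Sum>k<Suc n. \<integral>\<^sup>+\<omega>. ennreal ((W n k \<omega>)\<^sup>2) \<partial>M) +
        ennreal e * (\<Sum>k<Suc n. \<integral>\<^sup>+\<omega>. ennreal ((dB i (?p n k) (?p n (Suc k)) \<omega>)\<^sup>2) \<partial>M)"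
      unfolding A_def by (rule nn_integral_sum_mult_le[OF e mW mdB])
    also have "\<dots> \<le> ennreal (1 / e) * (4 * ennreal (e\<^sup>2)) + ennreal e * ennreal (t - s)"
    proof (intro add_mono mult_left_mono zero_le)
      have "(\<Sum>k<Suc n. \<integral>\<^sup>+\<omega>. ennreal ((W n k \<omega>)\<^sup>2) \<partial>M) \<le>
          (\<Sum>k<Suc n. 4 * sqnorm (\<lambda>u \<omega>. indicator {?p n k<..?p n (Suc k)} u * F u \<omega>))"
        by (intro sum_mono ito_bound[OF W]) auto
      also have "\<dots> \<le> 4 * sqnorm F"
        unfolding sum_distrib_left[symmetric]
        by (intro mult_left_mono sum_sqnorm_partition_le[OF jF part]) auto
      also have "\<dots> \<le> 4 * ennreal (e\<^sup>2)" by (intro mult_left_mono sqF) auto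
      finally show "(\<Sum>k<Suc n. \<integral>\<^sup>+\<omega>. ennreal ((W n k \<omega>)\<^sup>2) \<partial>M) \<le> 4 * ennreal (e\<^sup>2)" .
      have "(\<integral>\<^sup>+\<omega>. ennreal ((dB i (?p n k) (?p n (Suc k)) \<omega>)\<^sup>2) \<partial>M) = ennreal (?p n (Suc k) - ?p n k)"
        if "k < Suc n" for k
      proof -
        have b: "s \<le> ?p n k" "?p n k \<le> ?p n (Suc k)" "?p n (Suc k) \<le> t"
          using is_partition_bounds[OF part] is_partition_mono[OF part, of k "Suc k"] that by auto
        then have hb: "has_bochner_integral M (\<lambda>\<omega>. (dB i (?p n k) (?p n (Suc k)) \<omega>)\<^sup>2) (?p n (Suc k) - ?p n k)"
          using dB_second_moment[of "?p n k" "?p n (Suc k)" i i] st unfolding power2_eq_square by simp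
        show ?thesis
          unfolding nn_integral_eq_integral[OF integrable.intros[OF hb] AE_I2[OF zero_le_power2]]
            has_bochner_integral_integral_eq[OF hb] ..
      qed
      then have "(\<Sum>k<Suc n. \<integral>\<^sup>+\<omega>. ennreal ((dB i (?p n k) (?p n (Suc k)) \<omega>)\<^sup>2) \<partial>M) =
          (\<Sum>k<Suc n. ennreal (?p n (Suc k) - ?p n k))"
        by (intro sum.cong) auto
      also have "\<dots> = ennreal (\<Sum>k<Suc n. ?p n (Suc k) - ?p n k)"
        using st by (intro sum_ennreal) (simp add: upart_step)
      also have "(\<Sum>k<Suc n. ?p n (Suc k) - ?p n k) = t - s"
        using part[of n] unfolding sum_lessThan_telescope by (simp add: is_partition_def)
      finally show "(\<Sum>k<Suc n. \<integral>\<^sup>+\<omega>. ennreal ((dB i (?p n k) (?p n (Suc k)) \<omega>)\<^sup>2) \<partial>M) \<le> ennreal (t - s)"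
        by simp
    qed
    also have "4 * ennreal (e\<^sup>2) = ennreal (4 * e\<^sup>2)" by (simp add: ennreal_mult)
    also have "ennreal (1 / e) * ennreal (4 * e\<^sup>2) = ennreal ((1 / e) * (4 * e\<^sup>2))"
      using e by (intro ennreal_mult[symmetric]) auto
    also have "(1 / e) * (4 * e\<^sup>2) = 4 * e" using e by (simp add: power2_eq_square)
    also have "ennreal (4 * e) + ennreal e * ennreal (t - s) = ennreal (4 * e + e * (t - s))"
      using e st by (simp add: ennreal_mult ennreal_plus)
    finally show ?thesis .
  qed
  have C: "psize (\<lambda>\<omega>. \<delta> * (step_total L \<omega> - J \<omega>)) \<le> ennreal (e + e * (t - s))"
  proof -
    have "psize (\<lambda>\<omega>. \<delta> * (step_total L \<omega> - J \<omega>)) \<le> (\<integral>\<^sup>+\<omega>. ennreal \<bar>\<delta> * (step_total L \<omega> - J \<omega>)\<bar> \<partial>M)"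
      by (rule psize_le_L1)
    also have "\<dots> \<le> (\<integral>\<^sup>+\<omega>. ennreal \<bar>step_total L \<omega> - J \<omega>\<bar> \<partial>M)"
      by (intro nn_integral_mono ennreal_leI) (simp add: \<delta>_def)
    also have "\<dots> = (\<integral>\<^sup>+\<omega>. ennreal \<bar>(\<integral>u. step L u \<omega> \<partial>lborel) - (\<integral>u. G u \<omega> \<partial>lborel)\<bar> \<partial>M)"
      unfolding J_def has_bochner_integral_integral_eq[OF has_bochner_integral_step[OF L]] ..
    also have "\<dots> \<le> ennreal (1 / e) * sqnorm F + ennreal (e * (t - s))"
    proof (rule nn_integral_integral_diff_le[OF e st(2) jF _ F_out])
      show "sqnorm F < \<infinity>" using sqF by (rule order_le_less_trans) simp
      show "integrable lborel (\<lambda>u. step L u \<omega>)" for \<omega>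
        by (rule integrable.intros[OF has_bochner_integral_step[OF L]])
      show "G u \<omega> = F u \<omega> + step L u \<omega>" for u \<omega>
        unfolding F_def by simp
    qed
    also have "\<dots> \<le> ennreal (1 / e) * ennreal (e\<^sup>2) + ennreal (e * (t - s))"
      by (intro add_right_mono mult_left_mono sqF) auto
    also have "ennreal (1 / e) * ennreal (e\<^sup>2) = ennreal ((1 / e) * e\<^sup>2)"
      using e by (intro ennreal_mult[symmetric]) auto
    also have "(1 / e) * e\<^sup>2 = e" using e by (simp add: power2_eq_square)
    also have "ennreal e + ennreal (e * (t - s)) = ennreal (e + e * (t - s))"
      using e st by (simp add: ennreal_plus)
    finally show ?thesis .
  qed
  have "(\<lambda>n. psize (R n)) \<longlonglongrightarrow> 0"
    unfolding R_def[abs_def] \<delta>_def by (rule step_covariation[OF st L L_in])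
  then have "eventually (\<lambda>n. psize (R n) \<le> ennreal e) sequentially"
    by (rule ennreal_tendsto_0D[OF _ e])
  then show "eventually (\<lambda>n. psize (\<lambda>\<omega>. (\<Sum>k<Suc n. (Y (?p n (Suc k)) \<omega> - Y (?p n k) \<omega>) *
      dB i (?p n k) (?p n (Suc k)) \<omega>) - (if i = j then 1 else 0) * (\<integral>u. indicator {s<..t} u * H u \<omega> \<partial>lborel))
      \<le> ennreal e') sequentially"
  proof eventually_elim
    case (elim n)
    have "(\<Sum>k<Suc n. (Y (?p n (Suc k)) \<omega> - Y (?p n k) \<omega>) * dB i (?p n k) (?p n (Suc k)) \<omega>) - \<delta> * J \<omega> =
        A n \<omega> + (R n \<omega> + \<delta> * (step_total L \<omega> - J \<omega>))" for \<omega>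
    proof -
      have gen: "(\<Sum>k<N. x k * y k) - d * l = (\<Sum>k<N. (x k - w k) * y k) + ((\<Sum>k<N. w k * y k) - d * m + d * (m - l))"
        for x y w :: "nat \<Rightarrow> real" and d l m :: real and N
        by (simp add: algebra_simps sum_subtractf)
      show ?thesis unfolding A_def R_def W_def by (rule gen)
    qed
    then have "psize (\<lambda>\<omega>. (\<Sum>k<Suc n. (Y (?p n (Suc k)) \<omega> - Y (?p n k) \<omega>) * dB i (?p n k) (?p n (Suc k)) \<omega>) - \<delta> * J \<omega>)
        = psize (\<lambda>\<omega>. A n \<omega> + (R n \<omega> + \<delta> * (step_total L \<omega> - J \<omega>)))"
      by (simp only:)
    also have "\<dots> \<le> psize (A n) + psize (\<lambda>\<omega>. R n \<omega> + \<delta> * (step_total L \<omega> - J \<omega>))"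
      using mA mR by (intro psize_add) auto
    also have "\<dots> \<le> psize (A n) + (psize (R n) + psize (\<lambda>\<omega>. \<delta> * (step_total L \<omega> - J \<omega>)))"
      using mR by (intro add_left_mono psize_add) auto
    also have "\<dots> \<le> ennreal (4 * e + e * (t - s)) + (ennreal e + ennreal (e + e * (t - s)))"
      by (intro add_mono A C elim)
    also have "\<dots> = ennreal ((4 * e + e * (t - s)) + (e + (e + e * (t - s))))"
      using e st by (simp only: ennreal_plus add_nonneg_nonneg mult_nonneg_nonneg less_imp_le
          diff_ge_0_iff_ge zero_less_numeral)
    also have "(4 * e + e * (t - s)) + (e + (e + e * (t - s))) = e'"
      unfolding e_e'[symmetric] by (simp add: algebra_simps)
    finally show ?case unfolding \<delta>_def J_def G_def .
  qed
qed

end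

section \<open>Iterated integrals\<close>

lemma contraction_sum_snoc_Idx:
  "contraction_sum c \<alpha> (w @ [Idx i]) = contraction_sum c (\<lambda>u. \<alpha> (u @ [Idx i])) w +
    (if w \<noteq> [] \<and> last w = Idx i then c * contraction_sum c (\<lambda>u. \<alpha> (u @ [Circ])) (butlast w) else 0)"
proof (cases "w \<noteq> [] \<and> last w = Idx i")
  case True
  then have "w = butlast w @ [Idx i]" by (metis append_butlast_last_id)
  then obtain v where "w = v @ [Idx i]" by blast
  then show ?thesis using contraction_sum_snoc_same[of c \<alpha> v i] by simp
next
  case False
  then show ?thesis using contraction_sum_snoc_other[of w i c \<alpha>] by auto
qed

text \<open>A contraction of \<open>w\<close> ends in \<open>Idx i\<close> exactly when
  \<open>w\<close> does and this last letter is kept, since a contracted last pair ends in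
  \<open>Circ\<close>. Hence the weighted covariations of all contractions of \<open>w\<close>
  collapse to one contraction sum over \<open>butlast w\<close>.\<close>

lemma contraction_sum_last_Idx:
  "contraction_sum c (\<lambda>u. if u \<noteq> [] \<and> last u = Idx i then f (butlast u) else 0) w =
    (if w \<noteq> [] \<and> last w = Idx i then contraction_sum c f (butlast w) else 0)"
proof (cases w rule: rev_cases)
  case (snoc v a)
  then show ?thesis by (cases a) (simp_all add: contraction_sum_snoc_Idx contraction_sum_snoc_Circ)
qed simp

lemma countable_words: "countable (UNIV :: 'd::finite word set)"
proof -
  have "(UNIV :: 'd letter set) = insert Circ (range Idx)"
    by (metis UNIV_eq_I insertI1 insertI2 letter.exhaust rangeI)
  then have "countable (UNIV :: 'd letter set)"
    by (metis countable_finite finite finite_imageI finite.insertI)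
  then have "countable (lists (UNIV :: 'd letter set))" by (rule countable_lists)
  then show ?thesis by simp
qed

text \<open>Cut-off integrands use the Lebesgue integral over the half-open interval, the recursion
  for \<open>Circ\<close> the gauge integral over \<open>{s..t}\<close>; the endpoint
  \<open>s\<close> is a null set.\<close>

lemma integral_indicator_Ioc:
  fixes f :: "real \<Rightarrow> real"
  assumes "continuous_on {s..t} f"
  shows "(\<integral>u. indicator {s<..t} u * f u \<partial>lborel) = integral {s..t} f"
proof -
  have int: "set_integrable lborel {s..t} f" by (rule borel_integrable_atLeastAtMost'[OF assms])
  have 1: "(\<lambda>u. indicator {s..t} u * f u) \<in> borel_measurable lborel"
    using int by (simp add: set_integrable_def borel_measurable_integrable)
  have "(\<lambda>u. indicator {s<..t} u * (indicator {s..t} u * f u)) \<in> borel_measurable lborel"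
    by (rule borel_measurable_times[OF _ 1]) auto
  also have "(\<lambda>u. indicator {s<..t} u * (indicator {s..t} u * f u)) = (\<lambda>u. indicator {s<..t} u * f u)"
    by (auto simp: indicator_def fun_eq_iff)
  finally have 2: "(\<lambda>u. indicator {s<..t} u * f u) \<in> borel_measurable lborel" .
  have "AE u in lborel. indicator {s<..t} u * f u = indicator {s..t} u * f u"
    using AE_lborel_singleton[of s] by eventually_elim (auto simp: indicator_def)
  then have "(\<integral>u. indicator {s<..t} u * f u \<partial>lborel) = (\<integral>u. indicator {s..t} u * f u \<partial>lborel)"
    by (rule integral_cong_AE[OF 2 1])
  also have "\<dots> = integral {s..t} f"
    using set_borel_integral_eq_integral(2)[OF int] by (simp add: set_lebesgue_integral_def)
  finally show ?thesis .
qed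

text \<open>A bounded \<open>f\<close> gives its time integral finite variation, and uniform
  continuity makes the increments of \<open>b\<close> uniformly small along fine partitions; the sum
  is at most variation times oscillation.\<close>

lemma covariation_integral_continuous:
  fixes f b :: "real \<Rightarrow> real"
  assumes "s \<le> t" and f: "continuous_on {s..t} f" and b: "continuous_on {s..t} b"
  shows "(\<lambda>n. \<Sum>k<Suc n. integral {upart s t n k..upart s t n (Suc k)} f *
    (b (upart s t n (Suc k)) - b (upart s t n k))) \<longlonglongrightarrow> 0"
proof (rule LIMSEQ_I)
  fix e :: real assume e: "0 < e"
  have "bounded (f ` {s..t})" by (intro compact_imp_bounded compact_continuous_image f compact_Icc)
  then obtain C where C: "0 < C" "\<And>x. x \<in> {s..t} \<Longrightarrow> norm (f x) \<le> C"
    by (auto simp: bounded_pos)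
  \<comment> \<open>The added 1 keeps the denominator positive for \<open>s = t\<close> and makes
    the final inequality strict.\<close>
  define e' where "e' = e / (C * (t - s) + 1)"
  have pos: "0 < C * (t - s) + 1" using C(1) assms(1) by (simp add: add_nonneg_pos)
  then have e': "0 < e'" using e by (simp add: e'_def)
  have "uniformly_continuous_on {s..t} b" by (rule compact_uniformly_continuous[OF b compact_Icc])
  then obtain d where d: "0 < d" "\<And>x y. x \<in> {s..t} \<Longrightarrow> y \<in> {s..t} \<Longrightarrow> dist y x < d \<Longrightarrow> dist (b y) (b x) < e'"
    unfolding uniformly_continuous_on_def using e' by meson
  have "(\<lambda>n. (t - s) / real (Suc n)) \<longlonglongrightarrow> 0"
    by (intro real_tendsto_divide_at_top[OF tendsto_const]
        filterlim_compose[OF filterlim_real_sequentially] filterlim_Suc)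
  from order_tendstoD(2)[OF this d(1)] obtain N where N: "\<And>n. N \<le> n \<Longrightarrow> (t - s) / real (Suc n) < d"
    by (auto simp: eventually_sequentially)
  have "norm ((\<Sum>k<Suc n. integral {upart s t n k..upart s t n (Suc k)} f *
    (b (upart s t n (Suc k)) - b (upart s t n k))) - 0) < e" if "N \<le> n" for n
  proof -
    let ?p = "upart s t n"
    have part: "is_partition s t (Suc n) ?p" by (rule is_partition_upart[OF assms(1)])
    have "norm (\<Sum>k<Suc n. integral {?p k..?p (Suc k)} f * (b (?p (Suc k)) - b (?p k))) \<le>
        (\<Sum>k<Suc n. C * (?p (Suc k) - ?p k) * e')"
    proof (rule sum_norm_le)
      fix k assume "k \<in> {..<Suc n}"
      then have p: "s \<le> ?p k" "?p k \<le> ?p (Suc k)" "?p (Suc k) \<le> t"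
        using is_partition_bounds[OF part] is_partition_mono[OF part, of k "Suc k"] by auto
      have "norm (integral {?p k..?p (Suc k)} f) \<le> C * (?p (Suc k) - ?p k)"
        using p by (intro integral_bound continuous_on_subset[OF f] C(2)) auto
      moreover have "norm (b (?p (Suc k)) - b (?p k)) \<le> e'"
      proof -
        have "dist (?p (Suc k)) (?p k) < d"
          using N[OF that] p(2) upart_step[of s t n k] by (simp add: dist_real_def)
        then show ?thesis using d(2)[of "?p k" "?p (Suc k)"] p by (simp add: dist_norm)
      qed
      ultimately show "norm (integral {?p k..?p (Suc k)} f * (b (?p (Suc k)) - b (?p k))) \<le>
          C * (?p (Suc k) - ?p k) * e'"
        unfolding norm_mult using C(1) p by (intro mult_mono) auto
    qed
    also have "\<dots> = C * (t - s) * e'"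
      using part unfolding sum_distrib_right[symmetric] sum_distrib_left[symmetric] sum_lessThan_telescope
      by (simp add: is_partition_def)
    also have "\<dots> < e"
      using e pos by (simp add: e'_def field_simps)
    finally show ?thesis by simp
  qed
  then show "\<exists>N. \<forall>n\<ge>N. norm ((\<Sum>k<Suc n. integral {upart s t n k..upart s t n (Suc k)} f *
    (b (upart s t n (Suc k)) - b (upart s t n k))) - 0) < e" by blast
qed

section \<open>Stratonovich integrals as contraction sums of Ito integrals\<close>

locale ito_stratonovich = brownian M T B
  for M :: "'w measure" and T :: real and B :: "real \<Rightarrow> 'w \<Rightarrow> real ^ 'd::finite" +
  fixes I S :: "real \<Rightarrow> real \<Rightarrow> 'w \<Rightarrow> 'd dual"
  assumes T: "0 \<le> T"
    and I: "iterated_integrals M T (has_ito_integral M B) I"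
    and S: "iterated_integrals M T (has_stratonovich_integral M B) S"
begin

definition tri :: "(real \<times> real) set" where
  "tri = {(s, t). 0 \<le> s \<and> s \<le> t \<and> t \<le> T}"

lemma AE_tri:
  fixes F G :: "real \<Rightarrow> real \<Rightarrow> 'w \<Rightarrow> real"
  assumes F: "AE \<omega> in M. continuous_on tri (\<lambda>(s, t). F s t \<omega>)"
    and G: "AE \<omega> in M. continuous_on tri (\<lambda>(s, t). G s t \<omega>)"
    and eq: "\<And>s t. (s, t) \<in> tri \<Longrightarrow> AE \<omega> in M. F s t \<omega> = G s t \<omega>"
  shows "AE \<omega> in M. \<forall>(s, t)\<in>tri. F s t \<omega> = G s t \<omega>"
proof -
  \<comment> \<open>The dense set is taken inside \<open>tri\<close>, where the almost sure
    equalities are known; being countable, it costs only one null set.\<close>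
  obtain D where D: "countable D" "D \<subseteq> tri" "tri \<subseteq> closure D" by (rule separable)
  have "AE \<omega> in M. \<forall>(s, t)\<in>D. F s t \<omega> = G s t \<omega>"
    using D eq by (intro AE_ball_countable') auto
  with F G show ?thesis
  proof eventually_elim
    case (elim \<omega>)
    show ?case
    proof (intro ballI, clarify)
      fix s t assume st: "(s, t) \<in> tri"
      with D(3) obtain x where x: "\<And>n. x n \<in> D" "x \<longlonglongrightarrow> (s, t)"
        unfolding closure_sequential subset_iff by blast
      have "(\<lambda>n. (\<lambda>(s, t). F s t \<omega>) (x n)) \<longlonglongrightarrow> (\<lambda>(s, t). F s t \<omega>) (s, t)"
        using x D(2) st by (intro continuous_on_tendsto_compose[OF elim(1)]) (auto intro: always_eventually)
      moreover have "(\<lambda>n. (\<lambda>(s, t). G s t \<omega>) (x n)) \<longlonglongrightarrow> (\<lambda>(s, t). G s t \<omega>) (s, t)"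
        using x D(2) st by (intro continuous_on_tendsto_compose[OF elim(2)]) (auto intro: always_eventually)
      moreover have "(\<lambda>(s, t). F s t \<omega>) (x n) = (\<lambda>(s, t). G s t \<omega>) (x n)" for n
        using elim(3) x(1)[of n] by auto
      ultimately show "F s t \<omega> = G s t \<omega>"
        using LIMSEQ_unique by (metis (no_types, lifting) case_prod_conv ext)
    qed
  qed
qed

lemma measurable_I: "(s, t) \<in> tri \<Longrightarrow> (\<lambda>\<omega>. I s t \<omega> w) \<in> borel_measurable M"
  and measurable_S: "(s, t) \<in> tri \<Longrightarrow> (\<lambda>\<omega>. S s t \<omega> w) \<in> borel_measurable M"
  using I S unfolding iterated_integrals_def tri_def by auto

lemma continuous_I: "AE \<omega> in M. continuous_on tri (\<lambda>(s, t). I s t \<omega> w)"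
  and continuous_S: "AE \<omega> in M. continuous_on tri (\<lambda>(s, t). S s t \<omega> w)"
  using I S unfolding iterated_integrals_def tri_def by blast+

lemma I_Nil: "(s, t) \<in> tri \<Longrightarrow> AE \<omega> in M. I s t \<omega> [] = 1"
  and S_Nil: "(s, t) \<in> tri \<Longrightarrow> AE \<omega> in M. S s t \<omega> [] = 1"
  using I S unfolding iterated_integrals_def tri_def by auto

lemma I_Circ: "(s, t) \<in> tri \<Longrightarrow> AE \<omega> in M. I s t \<omega> (w @ [Circ]) = integral {s..t} (\<lambda>r. I s r \<omega> w)"
  and S_Circ: "(s, t) \<in> tri \<Longrightarrow> AE \<omega> in M. S s t \<omega> (w @ [Circ]) = integral {s..t} (\<lambda>r. S s r \<omega> w)"
  using I S unfolding iterated_integrals_def tri_def by auto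

lemma I_Idx: "(s, t) \<in> tri \<Longrightarrow> has_ito_integral M B i s t (\<lambda>r \<omega>. I s r \<omega> w) (\<lambda>\<omega>. I s t \<omega> (w @ [Idx i]))"
  and S_Idx: "(s, t) \<in> tri \<Longrightarrow> has_stratonovich_integral M B i s t (\<lambda>r \<omega>. S s r \<omega> w) (\<lambda>\<omega>. S s t \<omega> (w @ [Idx i]))"
  using I S unfolding iterated_integrals_def tri_def by auto

lemma continuous_on_section:
  assumes "continuous_on tri (\<lambda>(s, t). F s t)" "(s, t) \<in> tri"
  shows "continuous_on {s..t} (\<lambda>r. F s r)"
proof -
  have "continuous_on {s..t} (\<lambda>r. (s, r))" by (intro continuous_intros)
  moreover have "(\<lambda>r. (s, r)) ` {s..t} \<subseteq> tri" using assms(2) by (auto simp: tri_def)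
  ultimately have "continuous_on {s..t} (\<lambda>r. (\<lambda>(s, t). F s t) (s, r))"
    by (rule continuous_on_compose2[OF assms(1)])
  then show ?thesis by simp
qed

lemma ito_I: "(s, t) \<in> tri \<Longrightarrow> ito i (\<lambda>u \<omega>. indicator {s<..t} u * I s u \<omega> w) (\<lambda>\<omega>. I s t \<omega> (w @ [Idx i]))"
  by (rule ito_of_has_ito_integral[OF _ _ _ I_Idx]) (auto simp: tri_def)

lemma upart_tri:
  assumes "(s, t) \<in> tri" "k \<le> Suc n"
  shows "(s, upart s t n k) \<in> tri"
  using is_partition_bounds[OF is_partition_upart[of s t n] assms(2)] assms by (auto simp: tri_def)

text \<open>The covariation on \<open>[s,t]\<close> of \<open>r \<mapsto> \<langle>I\<^sub>s\<^sub>r,u\<rangle>\<close> with \<open>B\<^sup>i\<close>.\<close>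

definition cov :: "'d \<Rightarrow> real \<Rightarrow> real \<Rightarrow> 'd word \<Rightarrow> 'w \<Rightarrow> real" where
  "cov i s t u \<omega> = (if u \<noteq> [] \<and> last u = Idx i then I s t \<omega> (butlast u @ [Circ]) else 0)"

abbreviation covsum :: "(real \<Rightarrow> 'w \<Rightarrow> real) \<Rightarrow> 'd \<Rightarrow> real \<Rightarrow> real \<Rightarrow> nat \<Rightarrow> 'w \<Rightarrow> real" where
  "covsum H i s t n \<omega> \<equiv> \<Sum>k<Suc n. (H (upart s t n (Suc k)) \<omega> - H (upart s t n k) \<omega>) *
     dB i (upart s t n k) (upart s t n (Suc k)) \<omega>"

lemma measurable_covsum:
  assumes st: "(s, t) \<in> tri" and H: "\<And>r. r \<in> {s..t} \<Longrightarrow> H r \<in> borel_measurable M"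
  shows "covsum H i s t n \<in> borel_measurable M"
proof (intro borel_measurable_sum borel_measurable_times borel_measurable_diff)
  fix k assume k: "k \<in> {..<Suc n}"
  have st': "0 \<le> s" "s \<le> t" "t \<le> T" using st by (auto simp: tri_def)
  note p = is_partition_bounds[OF is_partition_upart[OF st'(2), of n]]
  show "H (upart s t n (Suc k)) \<in> borel_measurable M" "H (upart s t n k) \<in> borel_measurable M"
    using p[of k] p[of "Suc k"] k by (auto intro!: H)
  show "(\<lambda>\<omega>. B (upart s t n (Suc k)) \<omega> $ i) \<in> borel_measurable M"
    "(\<lambda>\<omega>. B (upart s t n k) \<omega> $ i) \<in> borel_measurable M"
    using p[of k] p[of "Suc k"] k st' by (auto intro!: measurable_B_nth)
qed

lemma measurable_cov: "(s, t) \<in> tri \<Longrightarrow> cov i s t u \<in> borel_measurable M"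
  unfolding cov_def[abs_def] using measurable_I by (cases "u \<noteq> [] \<and> last u = Idx i") auto

lemma I_covariation:
  assumes st: "(s, t) \<in> tri"
  shows "(\<lambda>n. psize (\<lambda>\<omega>. covsum (\<lambda>r \<omega>. I s r \<omega> u) i s t n \<omega> - cov i s t u \<omega>)) \<longlonglongrightarrow> 0"
proof (cases u rule: rev_cases)
  case Nil
  have "psize (\<lambda>\<omega>. covsum (\<lambda>r \<omega>. I s r \<omega> u) i s t n \<omega> - cov i s t u \<omega>) = psize (\<lambda>_. 0)" for n
  proof (rule psize_cong_AE)
    have "AE \<omega> in M. \<forall>k\<in>{..Suc n}. I s (upart s t n k) \<omega> [] = 1"
      using upart_tri[OF st] by (intro AE_finite_allI I_Nil) auto
    then show "AE \<omega> in M. covsum (\<lambda>r \<omega>. I s r \<omega> u) i s t n \<omega> - cov i s t u \<omega> = 0"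
    proof eventually_elim
      case (elim \<omega>)
      then have "covsum (\<lambda>r \<omega>. I s r \<omega> u) i s t n \<omega> = 0"
        using Nil by (intro sum.neutral) auto
      then show ?case using Nil by (simp add: cov_def)
    qed
  qed
  then show ?thesis by (simp add: psize_def)
next
  case (snoc v a)
  have st': "0 \<le> s" "s \<le> t" "t \<le> T" using st by (auto simp: tri_def)
  show ?thesis
  proof (cases a)
    case Circ
    \<comment> \<open>The recursion is used at countably many partition points, so outside one null
      set each path can be treated by real analysis.\<close>
    have "AE \<omega> in M. \<forall>n. \<forall>k\<in>{..Suc n}. I s (upart s t n k) \<omega> (v @ [Circ]) =
        integral {s..upart s t n k} (\<lambda>r. I s r \<omega> v)"
      unfolding AE_all_countable using upart_tri[OF st] by (intro allI AE_finite_allI I_Circ) auto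
    moreover have "AE \<omega> in M. continuous_on {0..T} (\<lambda>t. B t \<omega>)"
      using bm by (simp add: brownian_motion_def)
    ultimately have "AE \<omega> in M. (\<lambda>n. covsum (\<lambda>r \<omega>. I s r \<omega> u) i s t n \<omega>) \<longlonglongrightarrow> 0"
      using continuous_I[of v]
    proof eventually_elim
      case (elim \<omega>)
      let ?f = "\<lambda>r. I s r \<omega> v"
      have f: "continuous_on {s..t} ?f" by (rule continuous_on_section[OF elim(3) st])
      have b: "continuous_on {s..t} (\<lambda>r. B r \<omega> $ i)"
        using st' by (intro continuous_intros continuous_on_subset[OF elim(2)]) auto
      have "covsum (\<lambda>r \<omega>. I s r \<omega> u) i s t n \<omega> =
          (\<Sum>k<Suc n. integral {upart s t n k..upart s t n (Suc k)} ?f *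
            (B (upart s t n (Suc k)) \<omega> $ i - B (upart s t n k) \<omega> $ i))" for n
      proof (rule sum.cong[OF refl])
        fix k assume k: "k \<in> {..<Suc n}"
        let ?p = "upart s t n"
        have part: "is_partition s t (Suc n) ?p" by (rule is_partition_upart[OF st'(2)])
        have p: "s \<le> ?p k" "?p k \<le> ?p (Suc k)" "?p (Suc k) \<le> t"
          using is_partition_bounds[OF part] is_partition_mono[OF part, of k "Suc k"] k by auto
        have "integral {s..?p k} ?f + integral {?p k..?p (Suc k)} ?f = integral {s..?p (Suc k)} ?f"
          using p by (intro Henstock_Kurzweil_Integration.integral_combine integrable_continuous_real
              continuous_on_subset[OF f]) auto
        moreover have "I s (?p k) \<omega> u = integral {s..?p k} ?f" "I s (?p (Suc k)) \<omega> u = integral {s..?p (Suc k)} ?f"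
          using elim(1) k snoc Circ by auto
        ultimately have "I s (?p (Suc k)) \<omega> u - I s (?p k) \<omega> u = integral {?p k..?p (Suc k)} ?f"
          by linarith
        then show "(I s (?p (Suc k)) \<omega> u - I s (?p k) \<omega> u) * dB i (?p k) (?p (Suc k)) \<omega> =
            integral {?p k..?p (Suc k)} ?f * (B (?p (Suc k)) \<omega> $ i - B (?p k) \<omega> $ i)"
          by (simp only:)
      qed
      then show ?case using covariation_integral_continuous[OF st'(2) f b] by (simp only:)
    qed
    then have "(\<lambda>n. psize (covsum (\<lambda>r \<omega>. I s r \<omega> u) i s t n)) \<longlonglongrightarrow> 0"
      using st by (intro psize_tendsto_AE measurable_covsum measurable_I) (auto simp: tri_def)
    then show ?thesis using snoc Circ by (simp add: cov_def del: sum.lessThan_Suc)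
  next
    case (Idx j)
    let ?J = "\<lambda>\<omega>. \<integral>r. indicator {s<..t} r * I s r \<omega> v \<partial>lborel"
    \<comment> \<open>Identifies the time integral in the covariation with the value on the word
      whose last letter is replaced by \<open>Circ\<close>.\<close>
    have "AE \<omega> in M. ?J \<omega> = I s t \<omega> (v @ [Circ])"
      using continuous_I[of v] I_Circ[OF st, of v]
    proof eventually_elim
      case (elim \<omega>)
      have "continuous_on {s..t} (\<lambda>r. I s r \<omega> v)" by (rule continuous_on_section[OF elim(1) st])
      then show ?case using elim(2) by (simp add: integral_indicator_Ioc)
    qed
    then have "AE \<omega> in M. cov i s t u \<omega> = (if i = j then 1 else 0) * ?J \<omega>"
      by eventually_elim (auto simp: cov_def snoc Idx)
    then have "psize (\<lambda>\<omega>. covsum (\<lambda>r \<omega>. I s r \<omega> u) i s t n \<omega> - cov i s t u \<omega>) =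
        psize (\<lambda>\<omega>. covsum (\<lambda>r \<omega>. I s r \<omega> (v @ [Idx j])) i s t n \<omega> - (if i = j then 1 else 0) * ?J \<omega>)" for n
      unfolding snoc Idx by (intro psize_cong_AE) (elim eventually_mono, simp only:)
    moreover have "(\<lambda>n. psize (\<lambda>\<omega>. covsum (\<lambda>r \<omega>. I s r \<omega> (v @ [Idx j])) i s t n \<omega> - (if i = j then 1 else 0) * ?J \<omega>)) \<longlonglongrightarrow> 0"
      using st' by (intro ito_covariation ito_I) (auto simp: tri_def)
    ultimately show ?thesis by (simp only:)
  qed
qed

text \<open>The sums for \<open>S\<close> along uniform partitions tend to \<open>Q\<close> in
  probability by assumption and, expanded by linearity over the contractions of \<open>w\<close>,
  also to the contraction sum of the \<open>cov\<close>; two limits in probability agree almost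
  surely.\<close>

lemma contraction_sum_covariation:
  assumes st: "(s, t) \<in> tri"
    and eq: "AE \<omega> in M. \<forall>(s, t)\<in>tri. S s t \<omega> w = contraction_sum c (I s t \<omega>) w"
    and Q: "has_covariation M s t (\<lambda>r \<omega>. S s r \<omega> w) (\<lambda>u \<omega>. B u \<omega> $ i) Q"
  shows "AE \<omega> in M. Q \<omega> = contraction_sum c (\<lambda>u. cov i s t u \<omega>) w"
proof -
  have st': "0 \<le> s" "s \<le> t" "t \<le> T" using st by (auto simp: tri_def)
  let ?c = "\<lambda>u. c ^ (length w - length u)"
  let ?Z = "\<lambda>u n \<omega>. covsum (\<lambda>r \<omega>. I s r \<omega> u) i s t n \<omega> - cov i s t u \<omega>"
  let ?q = "\<lambda>\<omega>. contraction_sum c (\<lambda>u. cov i s t u \<omega>) w"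
  let ?R = "\<lambda>n \<omega>. covsum (\<lambda>r \<omega>. S s r \<omega> w) i s t n \<omega> - Q \<omega>"
  have mQ [measurable]: "Q \<in> borel_measurable M" using Q by (simp add: has_covariation_def)
  have mZ: "?Z u n \<in> borel_measurable M" for u n
    using st by (intro borel_measurable_diff measurable_covsum measurable_I measurable_cov) (auto simp: tri_def)
  have mR: "?R n \<in> borel_measurable M" for n
    using st by (intro borel_measurable_diff measurable_covsum measurable_S mQ) (auto simp: tri_def)
  have mq [measurable]: "?q \<in> borel_measurable M"
    unfolding contraction_sum_def by (intro borel_measurable_sum borel_measurable_times measurable_cov st) auto
  have R: "(\<lambda>n. psize (?R n)) \<longlonglongrightarrow> 0"
  proof (rule psize_tendsto_prob[OF mR])
    fix e :: real assume e: "0 < e"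
    with Q obtain d where d: "0 < d" "\<And>n r. is_partition s t n r \<and> (\<forall>k<n. r (Suc k) - r k < d) \<Longrightarrow>
        measure M {\<omega> \<in> space M. \<bar>(\<Sum>k<n. (S s (r (Suc k)) \<omega> w - S s (r k) \<omega> w) *
          (B (r (Suc k)) \<omega> $ i - B (r k) \<omega> $ i)) - Q \<omega>\<bar> > e} < e"
      unfolding has_covariation_def by meson
    have "(\<lambda>n. (t - s) / real (Suc n)) \<longlonglongrightarrow> 0"
      by (intro real_tendsto_divide_at_top[OF tendsto_const]
          filterlim_compose[OF filterlim_real_sequentially] filterlim_Suc)
    from order_tendstoD(2)[OF this d(1)]
    show "eventually (\<lambda>n. prob {\<omega>\<in>space M. \<bar>?R n \<omega>\<bar> > e} \<le> e) sequentially"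
    proof eventually_elim
      case (elim n)
      show ?case
        using elim by (intro less_imp_le d(2) conjI is_partition_upart[OF st'(2)]) (simp only: upart_step, simp)
    qed
  qed
  have Z: "(\<lambda>n. psize (\<lambda>\<omega>. \<Sum>u\<in>contracted w. ?c u * ?Z u n \<omega>)) \<longlonglongrightarrow> 0"
    by (intro psize_tendsto_sum finite_contracted mZ I_covariation st)
  have "(\<lambda>n. psize (\<lambda>\<omega>. (\<Sum>u\<in>contracted w. ?c u * ?Z u n \<omega>) + (- 1) * ?R n \<omega>)) \<longlonglongrightarrow> 0"
    by (intro psize_tendsto_add psize_tendsto_cmult borel_measurable_sum borel_measurable_times
        borel_measurable_const mZ mR Z R)
  \<comment> \<open>The partition sums cancel by linearity, so the size is the same for every
    \<open>n\<close>; a constant sequence tending to zero is zero.\<close>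
  moreover have "psize (\<lambda>\<omega>. (\<Sum>u\<in>contracted w. ?c u * ?Z u n \<omega>) + (- 1) * ?R n \<omega>) = psize (\<lambda>\<omega>. Q \<omega> - ?q \<omega>)" for n
  proof (rule psize_cong_AE)
    show "AE \<omega> in M. (\<Sum>u\<in>contracted w. ?c u * ?Z u n \<omega>) + (- 1) * ?R n \<omega> = Q \<omega> - ?q \<omega>"
      using eq
    proof eventually_elim
      case (elim \<omega>)
      have "covsum (\<lambda>r \<omega>. S s r \<omega> w) i s t n \<omega> = (\<Sum>k<Suc n. \<Sum>u\<in>contracted w.
          ?c u * ((I s (upart s t n (Suc k)) \<omega> u - I s (upart s t n k) \<omega> u) *
            dB i (upart s t n k) (upart s t n (Suc k)) \<omega>))"
      proof (rule sum.cong[OF refl])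
        fix k assume k: "k \<in> {..<Suc n}"
        have "S s (upart s t n l) \<omega> w = (\<Sum>u\<in>contracted w. ?c u * I s (upart s t n l) \<omega> u)" if "l \<le> Suc n" for l
          using elim upart_tri[OF st that] by (auto simp: contraction_sum_def)
        with k have "S s (upart s t n (Suc k)) \<omega> w - S s (upart s t n k) \<omega> w =
            (\<Sum>u\<in>contracted w. ?c u * (I s (upart s t n (Suc k)) \<omega> u - I s (upart s t n k) \<omega> u))"
          by (simp add: sum_subtractf right_diff_distrib)
        then show "(S s (upart s t n (Suc k)) \<omega> w - S s (upart s t n k) \<omega> w) *
              dB i (upart s t n k) (upart s t n (Suc k)) \<omega> =
            (\<Sum>u\<in>contracted w. ?c u * ((I s (upart s t n (Suc k)) \<omega> u - I s (upart s t n k) \<omega> u) *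
              dB i (upart s t n k) (upart s t n (Suc k)) \<omega>))"
          by (simp only: sum_distrib_right mult.assoc)
      qed
      also have "\<dots> = (\<Sum>u\<in>contracted w. ?c u * covsum (\<lambda>r \<omega>. I s r \<omega> u) i s t n \<omega>)"
        by (subst sum.swap) (simp only: sum_distrib_left)
      finally show ?case
        by (simp only: contraction_sum_def right_diff_distrib sum_subtractf)
    qed
  qed
  ultimately have "psize (\<lambda>\<omega>. Q \<omega> - ?q \<omega>) = 0"
    by (simp only: LIMSEQ_const_iff)
  then have "AE \<omega> in M. Q \<omega> - ?q \<omega> = 0"
    by (intro psize_zero_AE) measurable
  then show ?thesis by eventually_elim simp
qed

text \<open>The hypothesis holds for all pairs of times outside one null set, so the two integrands
  agree for every \<open>r\<close> in \<open>(s, t]\<close> and their Ito integrals coincide. Half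
  the covariation supplies the contraction of the last pair, and this half is the weight
  \<open>1 / 2\<close>.\<close>

lemma S_Idx_eq:
  assumes st: "(s, t) \<in> tri"
    and eq: "AE \<omega> in M. \<forall>(s, t)\<in>tri. S s t \<omega> w = contraction_sum (1 / 2) (I s t \<omega>) w"
  shows "AE \<omega> in M. S s t \<omega> (w @ [Idx i]) = contraction_sum (1 / 2) (I s t \<omega>) (w @ [Idx i])"
proof -
  have st': "0 \<le> s" "s \<le> t" "t \<le> T" using st by (auto simp: tri_def)
  let ?c = "\<lambda>u. (1 / 2) ^ (length w - length u) :: real"
  obtain Y Q where Y: "has_ito_integral M B i s t (\<lambda>r \<omega>. S s r \<omega> w) Y"
    and Q: "has_covariation M s t (\<lambda>r \<omega>. S s r \<omega> w) (\<lambda>u \<omega>. B u \<omega> $ i) Q"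
    and YQ: "AE \<omega> in M. S s t \<omega> (w @ [Idx i]) = Y \<omega> + Q \<omega> / 2"
    using S_Idx[OF st, of i w] by (auto simp: has_stratonovich_integral_def)
  have "ito i (\<lambda>u \<omega>. indicator {s<..t} u * S s u \<omega> w) Y"
    by (rule ito_of_has_ito_integral[OF st' Y])
  moreover have "ito i (\<lambda>r \<omega>. \<Sum>u\<in>contracted w. ?c u * (indicator {s<..t} r * I s r \<omega> u))
      (\<lambda>\<omega>. \<Sum>u\<in>contracted w. ?c u * I s t \<omega> (u @ [Idx i]))"
    by (intro ito_sum finite_contracted ito_I st)
  ultimately have "ito i (\<lambda>r \<omega>. indicator {s<..t} r * S s r \<omega> w - (\<Sum>u\<in>contracted w. ?c u * (indicator {s<..t} r * I s r \<omega> u)))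
      (\<lambda>\<omega>. Y \<omega> - (\<Sum>u\<in>contracted w. ?c u * I s t \<omega> (u @ [Idx i])))"
    by (rule ito_diff)
  moreover have "sqnorm (\<lambda>r \<omega>. indicator {s<..t} r * S s r \<omega> w - (\<Sum>u\<in>contracted w. ?c u * (indicator {s<..t} r * I s r \<omega> u))) = 0"
  proof -
    have "AE \<omega> in M. (\<integral>\<^sup>+r. ennreal ((indicator {s<..t} r * S s r \<omega> w -
        (\<Sum>u\<in>contracted w. ?c u * (indicator {s<..t} r * I s r \<omega> u)))\<^sup>2) \<partial>lborel) = 0"
      using eq
    proof eventually_elim
      case (elim \<omega>)
      have "indicator {s<..t} r * S s r \<omega> w - (\<Sum>u\<in>contracted w. ?c u * (indicator {s<..t} r * I s r \<omega> u)) = 0" for r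
      proof (cases "r \<in> {s<..t}")
        case True
        then have "(s, r) \<in> tri" using st by (auto simp: tri_def)
        with elim True show ?thesis by (auto simp: contraction_sum_def)
      qed simp
      then show ?case by simp
    qed
    then show ?thesis unfolding sqnorm_def by (simp cong: nn_integral_cong_AE)
  qed
  ultimately have "AE \<omega> in M. Y \<omega> - (\<Sum>u\<in>contracted w. ?c u * I s t \<omega> (u @ [Idx i])) = 0"
    by (rule ito_zero_AE)
  then show ?thesis
    using YQ contraction_sum_covariation[OF st eq Q]
  proof eventually_elim
    case (elim \<omega>)
    have "S s t \<omega> (w @ [Idx i]) = contraction_sum (1 / 2) (\<lambda>u. I s t \<omega> (u @ [Idx i])) w +
        contraction_sum (1 / 2) (\<lambda>u. cov i s t u \<omega>) w / 2"
      using elim by (simp add: contraction_sum_def)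
    then show ?case
      unfolding contraction_sum_snoc_Idx cov_def contraction_sum_last_Idx[of _ i "\<lambda>u. I s t \<omega> (u @ [Circ])"] by simp
  qed
qed

text \<open>A final \<open>Circ\<close> joins no contraction, so linearity of the time integral over
  the finitely many contractions suffices; continuity of their paths gives integrability.\<close>

lemma S_Circ_eq:
  assumes st: "(s, t) \<in> tri"
    and eq: "AE \<omega> in M. \<forall>(s, t)\<in>tri. S s t \<omega> w = contraction_sum c (I s t \<omega>) w"
  shows "AE \<omega> in M. S s t \<omega> (w @ [Circ]) = contraction_sum c (I s t \<omega>) (w @ [Circ])"
proof -
  have "AE \<omega> in M. \<forall>u\<in>contracted w. I s t \<omega> (u @ [Circ]) = integral {s..t} (\<lambda>r. I s r \<omega> u)"
    by (intro AE_finite_allI finite_contracted I_Circ st)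
  moreover have "AE \<omega> in M. \<forall>u\<in>contracted w. continuous_on tri (\<lambda>(s, t). I s t \<omega> u)"
    by (intro AE_finite_allI finite_contracted continuous_I)
  ultimately show ?thesis
    using S_Circ[OF st, of w] eq
  proof eventually_elim
    case (elim \<omega>)
    have int: "(\<lambda>r. I s r \<omega> u) integrable_on {s..t}" if "u \<in> contracted w" for u
      using elim(2) that by (intro integrable_continuous_real continuous_on_section[OF _ st]) auto
    have "S s t \<omega> (w @ [Circ]) = integral {s..t} (\<lambda>r. \<Sum>u\<in>contracted w. c ^ (length w - length u) * I s r \<omega> u)"
      unfolding elim(3)
    proof (rule Henstock_Kurzweil_Integration.integral_cong)
      fix r assume "r \<in> {s..t}"
      then have "(s, r) \<in> tri" using st by (auto simp: tri_def)
      with elim(4) show "S s r \<omega> w = (\<Sum>u\<in>contracted w. c ^ (length w - length u) * I s r \<omega> u)"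
        by (auto simp: contraction_sum_def)
    qed
    also have "\<dots> = (\<Sum>u\<in>contracted w. integral {s..t} (\<lambda>r. c ^ (length w - length u) * I s r \<omega> u))"
      using int by (intro Henstock_Kurzweil_Integration.integral_sum integrable_on_mult_right) auto
    also have "\<dots> = contraction_sum c (\<lambda>u. I s t \<omega> (u @ [Circ])) w"
      unfolding contraction_sum_def using elim(1) by (intro sum.cong) auto
    finally show ?case by (simp only: contraction_sum_snoc_Circ)
  qed
qed

text \<open>For fixed times the last letter decides which recursion applies. Continuity upgrades the
  result to all times at once before the induction continues, because the recursions integrate over
  the inner time.\<close>

lemma S_eq_contraction_sum: "AE \<omega> in M. \<forall>(s, t)\<in>tri. S s t \<omega> w = contraction_sum (1 / 2) (I s t \<omega>) w"
proof (induction w rule: length_induct)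
  case (1 w)
  show ?case
  proof (rule AE_tri[OF continuous_S])
    have "AE \<omega> in M. \<forall>u\<in>contracted w. continuous_on tri (\<lambda>(s, t). I s t \<omega> u)"
      by (intro AE_finite_allI finite_contracted continuous_I)
    then show "AE \<omega> in M. continuous_on tri (\<lambda>(s, t). contraction_sum (1 / 2) (I s t \<omega>) w)"
      by eventually_elim (auto simp: contraction_sum_def case_prod_beta' intro!: continuous_intros)
    fix s t assume st: "(s, t) \<in> tri"
    show "AE \<omega> in M. S s t \<omega> w = contraction_sum (1 / 2) (I s t \<omega>) w"
    proof (cases w rule: rev_cases)
      case Nil
      then show ?thesis using I_Nil[OF st] S_Nil[OF st] by auto
    next
      case (snoc v a)
      with 1 have v: "AE \<omega> in M. \<forall>(s, t)\<in>tri. S s t \<omega> v = contraction_sum (1 / 2) (I s t \<omega>) v" by simp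
      show ?thesis
        using S_Idx_eq[OF st v] S_Circ_eq[OF st v] unfolding snoc by (cases a) auto
    qed
  qed
qed

lemma convolution_inverses:
  "AE \<omega> in M. \<forall>s t. 0 \<le> t \<and> t < s \<and> s \<le> T \<longrightarrow>
    convolution_inverse (I s t \<omega>) (I t s \<omega>) \<and> convolution_inverse (S s t \<omega>) (S t s \<omega>)"
proof -
  have "AE \<omega> in M. \<forall>s t. 0 \<le> t \<and> t < s \<and> s \<le> T \<longrightarrow> convolution_inverse (I s t \<omega>) (I t s \<omega>)"
    "AE \<omega> in M. \<forall>s t. 0 \<le> t \<and> t < s \<and> s \<le> T \<longrightarrow> convolution_inverse (S s t \<omega>) (S t s \<omega>)"
    using I S unfolding iterated_integrals_def by blast+
  then show ?thesis by eventually_elim blast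
qed

lemma S_eq_exp: "AE \<omega> in M. \<forall>s\<in>{0..T}. \<forall>t\<in>{0..T}. S s t \<omega> = contraction_sum (1 / 2) (I s t \<omega>)"
proof -
  \<comment> \<open>Words over a finite alphabet are countable, so all identities hold off one null
    set.\<close>
  have "AE \<omega> in M. \<forall>w\<in>UNIV. \<forall>(s, t)\<in>tri. S s t \<omega> w = contraction_sum (1 / 2) (I s t \<omega>) w"
    by (intro AE_ball_countable' S_eq_contraction_sum countable_words)
  then show ?thesis
    using convolution_inverses
  proof eventually_elim
    case (elim \<omega>)
    have le: "S s t \<omega> = contraction_sum (1 / 2) (I s t \<omega>)" if "(s, t) \<in> tri" for s t
      using elim(1) that by (intro ext) auto
    show ?case
    proof (intro ballI)
      fix s t assume st: "s \<in> {0..T}" "t \<in> {0..T}"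
      show "S s t \<omega> = contraction_sum (1 / 2) (I s t \<omega>)"
      proof (cases "s \<le> t")
        case True
        with st show ?thesis by (intro le) (auto simp: tri_def)
      next
        case False
        with st have inv: "convolution_inverse (I s t \<omega>) (I t s \<omega>)" "convolution_inverse (S s t \<omega>) (S t s \<omega>)"
          using elim(2) by auto
        have "S t s \<omega> = contraction_sum (1 / 2) (I t s \<omega>)"
          using st False by (intro le) (auto simp: tri_def)
        \<comment> \<open>Both \<open>S s t \<omega>\<close> and the contraction sum of
          \<open>I s t \<omega>\<close> are convolution inverses of \<open>S t s \<omega>\<close>,
          so they coincide.\<close>
        with inv show ?thesis
          using convolution_inverse_unique convolution_inverse_contraction_sum by metis
      qed
    qed
  qed
qed

end

theorem corollary3p14:
  fixes M :: "'w measure"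
    and T :: real
    and B :: "real \<Rightarrow> 'w \<Rightarrow> real ^ 'd::finite"
    and I S :: "real \<Rightarrow> real \<Rightarrow> 'w \<Rightarrow> 'd dual"
  assumes "0 \<le> T"
    and "brownian_motion M T B"
    and "iterated_integrals M T (has_ito_integral M B) I"
    and "iterated_integrals M T (has_stratonovich_integral M B) S"
  shows "AE \<omega> in M. \<forall>s\<in>{0..T}. \<forall>t\<in>{0..T}.
    dual_map word_exp (I s t \<omega>) = S s t \<omega> \<and>
    dual_map word_log (S s t \<omega>) = I s t \<omega> \<and>
    (\<forall>w.
      S s t \<omega> w = I s t \<omega> w +
        (\<Sum>u\<in>contractions w. 1 / 2 ^ (length w - length u) * I s t \<omega> u) \<and>
      I s t \<omega> w = S s t \<omega> w +
        (\<Sum>u\<in>contractions w.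
          (- 1) ^ (length w - length u) / 2 ^ (length w - length u) * S s t \<omega> u))"
proof -
  interpret ito_stratonovich M T B I S
    using assms by unfold_locales
  show ?thesis
    using S_eq_exp
  proof eventually_elim
    case (elim \<omega>)
    show ?case
    proof (intro ballI)
      fix s t assume "s \<in> {0..T}" "t \<in> {0..T}"
      with elim have S: "S s t \<omega> = contraction_sum (1 / 2) (I s t \<omega>)" by blast
      have I: "contraction_sum (- (1 / 2)) (S s t \<omega>) = I s t \<omega>"
        unfolding S by (intro ext contraction_sum_inverse)
      have "S s t \<omega> w = I s t \<omega> w +
          (\<Sum>u\<in>contractions w. 1 / 2 ^ (length w - length u) * I s t \<omega> u)" for w
        unfolding S contraction_sum_contractions power_one_over by simp
      moreover have "I s t \<omega> w = S s t \<omega> w + (\<Sum>u\<in>contractions w.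
          (- 1) ^ (length w - length u) / 2 ^ (length w - length u) * S s t \<omega> u)" for w
        using fun_cong[OF I, of w] unfolding contraction_sum_contractions minus_divide_left power_divide by simp
      ultimately show "dual_map word_exp (I s t \<omega>) = S s t \<omega> \<and>
        dual_map word_log (S s t \<omega>) = I s t \<omega> \<and>
        (\<forall>w.
          S s t \<omega> w = I s t \<omega> w +
            (\<Sum>u\<in>contractions w. 1 / 2 ^ (length w - length u) * I s t \<omega> u) \<and>
          I s t \<omega> w = S s t \<omega> w +
            (\<Sum>u\<in>contractions w.
              (- 1) ^ (length w - length u) / 2 ^ (length w - length u) * S s t \<omega> u))"
        unfolding dual_map_exp dual_map_log using S I by simp
    qed
  qed
qed

end
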